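(* Let $\pi\colon Y\to X$ be a proper modification of a complex space $X$ such that $Y$ is locally irreducible. Let $\psi\colon\mathscr{F}\to\mathscr{G}$ be a morphism of coherent analytic sheaves on $X$. If $\psi$ is an epimorphism, then the induced mapping $\pi^T\psi\colon\pi^T\mathscr{F}\to\pi^T\mathscr{G}$ is also an epimorphism. If $\psi$ is a monomorphism, then $\pi^T\psi$ is also a monomorphism.
   Context: A complex space is locally irreducible if every stalk of its structure sheaf is an integral domain (in particular it is reduced). A proper modification $\pi\colon Y\to X$ is a proper surjective holomorphic map of complex spaces for which there are closed analytically rare (in the reduced case: nowhere dense) analytic sets $A\subset Y$, $B\subset X$ with $B=\pi(A)$ such that $\pi|_{Y\setminus A}\colon Y\setminus A\to X\setminus B$ is biholomorphic. For a coherent analytic sheaf $\mathscr{S}$ on $X$, the torsion-free preimage sheaf is $\pi^T\mathscr{S}:=\pi^*\mathscr{S}/\mathscr{T}(\pi^*\mathscr{S})$, where $\pi^*$ is the analytic inverse image and $\mathscr{T}(\cdot)$ the torsion subsheaf. Since $\pi^*\psi$ maps $\mathscr{T}(\pi^*\mathscr{F})$ into $\mathscr{T}(\pi^*\mathscr{G})$, it induces the map $\pi^T\psi$. *)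

theory Defs
  imports "HOL-Analysis.Analysis" "HOL-Algebra.QuotRing" "HOL-Algebra.Module"
    "HOL-Algebra.Free_Abelian_Groups"
begin

section \<open>Sheaves\<close>

text \<open>
  A sheaf is presented by its stalks and, for every open set, its sections, a section over \<open>U\<close>
  being the family of its germs: an element of the product of the stalks over \<open>U\<close>.  This is the
  espace etale description: the total space is the disjoint union of the stalks, and the
  sections are its continuous sections.  Restriction of sections is restriction of functions.
  The stalks are modules over \<open>'k\<close>-rings, or algebras for structure sheaves; the
  multiplication of a mere module is never looked at.
  A sheaf on \<open>X\<close> is restricted to an open \<open>U\<close> by replacing \<open>X\<close> with \<open>subtopology X U\<close>.
\<close>

record ('x, 'k, 'a) sheaf_data =
  stalk :: "'x \<Rightarrow> ('k, 'a) module"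
  sections :: "'x set \<Rightarrow> ('x \<Rightarrow> 'a) set"

locale sheaf =
  fixes X :: "'x topology" and F :: "('x, 'k, 'a) sheaf_data"
  assumes sections_subset:
      "openin X U \<Longrightarrow> sections F U \<subseteq> (\<Pi>\<^sub>E x\<in>U. carrier (stalk F x))"
    and restriction:
      "\<lbrakk>openin X U; openin X V; V \<subseteq> U; s \<in> sections F U\<rbrakk> \<Longrightarrow> restrict s V \<in> sections F V"
    and gluing:
      "\<lbrakk>openin X U; s \<in> extensional U;
        \<And>x. x \<in> U \<Longrightarrow> \<exists>V. openin X V \<and> x \<in> V \<and> V \<subseteq> U \<and> restrict s V \<in> sections F V\<rbrakk>
       \<Longrightarrow> s \<in> sections F U"
    and germ_extends:
      "\<lbrakk>x \<in> topspace X; a \<in> carrier (stalk F x)\<rbrakk>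
       \<Longrightarrow> \<exists>U s. openin X U \<and> x \<in> U \<and> s \<in> sections F U \<and> s x = a"
    and germ_eq_imp_locally_eq:
      "\<lbrakk>openin X U; x \<in> U; s \<in> sections F U; t \<in> sections F U; s x = t x\<rbrakk>
       \<Longrightarrow> \<exists>V. openin X V \<and> x \<in> V \<and> V \<subseteq> U \<and> (\<forall>z\<in>V. s z = t z)"

abbreviation complex_field :: "complex ring" where
  "complex_field \<equiv> \<lparr>carrier = UNIV, mult = (*), one = 1, ring.zero = 0, add = (+)\<rparr>"

text \<open>Locally ringed spaces over the complex numbers.\<close>

locale ringed_space = sheaf X O\<^sub>X
  for X :: "'x topology" and O\<^sub>X :: "('x, complex, 'a) sheaf_data" +
  assumes stalk_algebra: "x \<in> topspace X \<Longrightarrow> Module.algebra complex_field (stalk O\<^sub>X x)"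
    and stalk_nontrivial: "x \<in> topspace X \<Longrightarrow> \<one>\<^bsub>stalk O\<^sub>X x\<^esub> \<noteq> \<zero>\<^bsub>stalk O\<^sub>X x\<^esub>"
    and stalk_local:
      "\<lbrakk>x \<in> topspace X;
        a \<in> carrier (stalk O\<^sub>X x) - Units (stalk O\<^sub>X x);
        b \<in> carrier (stalk O\<^sub>X x) - Units (stalk O\<^sub>X x)\<rbrakk>
       \<Longrightarrow> a \<oplus>\<^bsub>stalk O\<^sub>X x\<^esub> b \<notin> Units (stalk O\<^sub>X x)"
    and one_section: "openin X U \<Longrightarrow> (\<lambda>x\<in>U. \<one>\<^bsub>stalk O\<^sub>X x\<^esub>) \<in> sections O\<^sub>X U"
    and add_section:
      "\<lbrakk>openin X U; s \<in> sections O\<^sub>X U; t \<in> sections O\<^sub>X U\<rbrakk>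
       \<Longrightarrow> (\<lambda>x\<in>U. s x \<oplus>\<^bsub>stalk O\<^sub>X x\<^esub> t x) \<in> sections O\<^sub>X U"
    and mult_section:
      "\<lbrakk>openin X U; s \<in> sections O\<^sub>X U; t \<in> sections O\<^sub>X U\<rbrakk>
       \<Longrightarrow> (\<lambda>x\<in>U. s x \<otimes>\<^bsub>stalk O\<^sub>X x\<^esub> t x) \<in> sections O\<^sub>X U"
    and scale_section:
      "\<lbrakk>openin X U; s \<in> sections O\<^sub>X U\<rbrakk>
       \<Longrightarrow> (\<lambda>x\<in>U. c \<odot>\<^bsub>stalk O\<^sub>X x\<^esub> s x) \<in> sections O\<^sub>X U"

locale module_sheaf = sheaf X F
  for X :: "'x topology" and O\<^sub>X :: "('x, complex, 'a) sheaf_data"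
    and F :: "('x, 'a, 'm) sheaf_data" +
  assumes stalk_module: "x \<in> topspace X \<Longrightarrow> Module.module (stalk O\<^sub>X x) (stalk F x)"
    and zero_section: "openin X U \<Longrightarrow> (\<lambda>x\<in>U. \<zero>\<^bsub>stalk F x\<^esub>) \<in> sections F U"
    and add_section:
      "\<lbrakk>openin X U; s \<in> sections F U; t \<in> sections F U\<rbrakk>
       \<Longrightarrow> (\<lambda>x\<in>U. s x \<oplus>\<^bsub>stalk F x\<^esub> t x) \<in> sections F U"
    and smult_section:
      "\<lbrakk>openin X U; a \<in> sections O\<^sub>X U; s \<in> sections F U\<rbrakk>
       \<Longrightarrow> (\<lambda>x\<in>U. a x \<odot>\<^bsub>stalk F x\<^esub> s x) \<in> sections F U"

definition linear_map ::
  "('r, 'b) ring_scheme \<Rightarrow> ('r, 'm, 'c) module_scheme \<Rightarrow> ('r, 'n, 'd) module_scheme \<Rightarrow> ('m \<Rightarrow> 'n) \<Rightarrow> bool"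
where
  "linear_map R M N h \<longleftrightarrow>
     h \<in> carrier M \<rightarrow> carrier N \<and>
     (\<forall>u\<in>carrier M. \<forall>v\<in>carrier M. h (u \<oplus>\<^bsub>M\<^esub> v) = h u \<oplus>\<^bsub>N\<^esub> h v) \<and>
     (\<forall>r\<in>carrier R. \<forall>u\<in>carrier M. h (r \<odot>\<^bsub>M\<^esub> u) = r \<odot>\<^bsub>N\<^esub> h u)"

definition sheaf_morphism ::
  "'x topology \<Rightarrow> ('x, complex, 'a) sheaf_data \<Rightarrow> ('x, 'a, 'm) sheaf_data \<Rightarrow> ('x, 'a, 'n) sheaf_data
   \<Rightarrow> ('x \<Rightarrow> 'm \<Rightarrow> 'n) \<Rightarrow> bool"
where
  "sheaf_morphism X O\<^sub>X F G \<psi> \<longleftrightarrow>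
     (\<forall>x\<in>topspace X. linear_map (stalk O\<^sub>X x) (stalk F x) (stalk G x) (\<psi> x)) \<and>
     (\<forall>U s. openin X U \<longrightarrow> s \<in> sections F U \<longrightarrow> (\<lambda>x\<in>U. \<psi> x (s x)) \<in> sections G U)"

text \<open>Epimorphisms and monomorphisms of sheaves are those that are surjective, respectively injective,
  on all stalks; surjectivity on sections is not meant.\<close>

definition sheaf_epimorphism ::
  "'x topology \<Rightarrow> ('x, complex, 'a) sheaf_data \<Rightarrow> ('x, 'a, 'm) sheaf_data \<Rightarrow> ('x, 'a, 'n) sheaf_data
   \<Rightarrow> ('x \<Rightarrow> 'm \<Rightarrow> 'n) \<Rightarrow> bool"
where
  "sheaf_epimorphism X O\<^sub>X F G \<psi> \<longleftrightarrow>
     sheaf_morphism X O\<^sub>X F G \<psi> \<and>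
     (\<forall>x\<in>topspace X. \<psi> x ` carrier (stalk F x) = carrier (stalk G x))"

definition sheaf_monomorphism ::
  "'x topology \<Rightarrow> ('x, complex, 'a) sheaf_data \<Rightarrow> ('x, 'a, 'm) sheaf_data \<Rightarrow> ('x, 'a, 'n) sheaf_data
   \<Rightarrow> ('x \<Rightarrow> 'm \<Rightarrow> 'n) \<Rightarrow> bool"
where
  "sheaf_monomorphism X O\<^sub>X F G \<psi> \<longleftrightarrow>
     sheaf_morphism X O\<^sub>X F G \<psi> \<and>
     (\<forall>x\<in>topspace X. inj_on (\<psi> x) (carrier (stalk F x)))"


section \<open>Coherence\<close>

definition lincomb ::
  "('r, 'm, 'c) module_scheme \<Rightarrow> nat \<Rightarrow> (nat \<Rightarrow> 'r) \<Rightarrow> (nat \<Rightarrow> 'm) \<Rightarrow> 'm"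
where
  "lincomb M k a m = finsum M (\<lambda>i. a i \<odot>\<^bsub>M\<^esub> m i) {..<k}"

definition finite_type ::
  "'x topology \<Rightarrow> ('x, complex, 'a) sheaf_data \<Rightarrow> ('x, 'a, 'm) sheaf_data \<Rightarrow> bool"
where
  "finite_type X O\<^sub>X F \<longleftrightarrow>
     (\<forall>x\<in>topspace X. \<exists>U k s. openin X U \<and> x \<in> U \<and> (\<forall>i<k. s i \<in> sections F U) \<and>
        (\<forall>y\<in>U. \<forall>m\<in>carrier (stalk F y). \<exists>a\<in>{..<k} \<rightarrow> carrier (stalk O\<^sub>X y).
           m = lincomb (stalk F y) k a (\<lambda>i. s i y)))"

text \<open>The sheaf of relations of any \<open>k\<close> sections \<open>s\<close> over an open set is of finite type: it is
  locally generated by finitely many tuples \<open>r j\<close> of sections of the structure sheaf.\<close>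

definition relation_finite_type ::
  "'x topology \<Rightarrow> ('x, complex, 'a) sheaf_data \<Rightarrow> ('x, 'a, 'm) sheaf_data \<Rightarrow> bool"
where
  "relation_finite_type X O\<^sub>X F \<longleftrightarrow>
     (\<forall>U k s. openin X U \<longrightarrow> (\<forall>i<k. s i \<in> sections F U) \<longrightarrow>
       (\<forall>x\<in>U. \<exists>V (l::nat) r. openin X V \<and> x \<in> V \<and> V \<subseteq> U \<and>
          (\<forall>j<l. \<forall>i<k. r j i \<in> sections O\<^sub>X V) \<and>
          (\<forall>y\<in>V. \<forall>j<l. lincomb (stalk F y) k (\<lambda>i. r j i y) (\<lambda>i. s i y) = \<zero>\<^bsub>stalk F y\<^esub>) \<and>
          (\<forall>y\<in>V. \<forall>a\<in>{..<k} \<rightarrow> carrier (stalk O\<^sub>X y).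
             lincomb (stalk F y) k a (\<lambda>i. s i y) = \<zero>\<^bsub>stalk F y\<^esub> \<longrightarrow>
             (\<exists>c\<in>{..<l} \<rightarrow> carrier (stalk O\<^sub>X y). \<forall>i<k.
                a i = finsum (stalk O\<^sub>X y) (\<lambda>j. c j \<otimes>\<^bsub>stalk O\<^sub>X y\<^esub> r j i y) {..<l}))))"

definition coherent_sheaf ::
  "'x topology \<Rightarrow> ('x, complex, 'a) sheaf_data \<Rightarrow> ('x, 'a, 'm) sheaf_data \<Rightarrow> bool"
where
  "coherent_sheaf X O\<^sub>X F \<longleftrightarrow>
     module_sheaf X O\<^sub>X F \<and> finite_type X O\<^sub>X F \<and> relation_finite_type X O\<^sub>X F"


section \<open>Holomorphic maps\<close>

text \<open>A morphism of locally ringed spaces over the complex numbers from \<open>Y\<close> to \<open>X\<close>: a continuous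
  map \<open>f\<close> and its comorphism, given on stalks by \<open>\<phi> y\<close> from the stalk at \<open>f y\<close> to that at \<open>y\<close>.\<close>

definition holomorphic_map ::
  "'y topology \<Rightarrow> ('y, complex, 'b) sheaf_data \<Rightarrow> 'x topology \<Rightarrow> ('x, complex, 'a) sheaf_data
   \<Rightarrow> ('y \<Rightarrow> 'x) \<Rightarrow> ('y \<Rightarrow> 'a \<Rightarrow> 'b) \<Rightarrow> bool"
where
  "holomorphic_map Y O\<^sub>Y X O\<^sub>X f \<phi> \<longleftrightarrow>
     continuous_map Y X f \<and>
     (\<forall>y\<in>topspace Y.
        \<phi> y \<in> ring_hom (stalk O\<^sub>X (f y)) (stalk O\<^sub>Y y) \<and>
        (\<forall>c. \<forall>a\<in>carrier (stalk O\<^sub>X (f y)).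
           \<phi> y (c \<odot>\<^bsub>stalk O\<^sub>X (f y)\<^esub> a) = c \<odot>\<^bsub>stalk O\<^sub>Y y\<^esub> \<phi> y a) \<and>
        (\<forall>a\<in>carrier (stalk O\<^sub>X (f y)).
           \<phi> y a \<in> Units (stalk O\<^sub>Y y) \<longrightarrow> a \<in> Units (stalk O\<^sub>X (f y)))) \<and>
     (\<forall>U s. openin X U \<longrightarrow> s \<in> sections O\<^sub>X U \<longrightarrow>
        (\<lambda>y\<in>{y \<in> topspace Y. f y \<in> U}. \<phi> y (s (f y))) \<in> sections O\<^sub>Y {y \<in> topspace Y. f y \<in> U})"

definition biholomorphic_map ::
  "'y topology \<Rightarrow> ('y, complex, 'b) sheaf_data \<Rightarrow> 'x topology \<Rightarrow> ('x, complex, 'a) sheaf_data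
   \<Rightarrow> ('y \<Rightarrow> 'x) \<Rightarrow> ('y \<Rightarrow> 'a \<Rightarrow> 'b) \<Rightarrow> bool"
where
  "biholomorphic_map Y O\<^sub>Y X O\<^sub>X f \<phi> \<longleftrightarrow>
     holomorphic_map Y O\<^sub>Y X O\<^sub>X f \<phi> \<and>
     (\<exists>g \<eta>. holomorphic_map X O\<^sub>X Y O\<^sub>Y g \<eta> \<and>
        (\<forall>y\<in>topspace Y. g (f y) = y \<and> (\<forall>b\<in>carrier (stalk O\<^sub>Y y). \<phi> y (\<eta> (f y) b) = b)) \<and>
        (\<forall>x\<in>topspace X. f (g x) = x \<and> (\<forall>a\<in>carrier (stalk O\<^sub>X x). \<eta> x (\<phi> (g x) a) = a)))"


section \<open>Quotients\<close>

text \<open>\<open>M / N\<close> for a submodule \<open>N\<close> of a module, or for an ideal \<open>N\<close> of an algebra.\<close>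

definition quotient_module ::
  "('r, 'm, 'c) module_scheme \<Rightarrow> 'm set \<Rightarrow> ('r, 'm set) module"
where
  "quotient_module M N =
     ring.extend (M Quot N) (module.fields (\<lambda>r C. \<Union>m\<in>C. N +>\<^bsub>M\<^esub> (r \<odot>\<^bsub>M\<^esub> m)))"

text \<open>The sheaf associated with the presheaf quotient: sections are locally induced from \<open>S\<close>.\<close>

definition quotient_sheaf ::
  "'x topology \<Rightarrow> ('x, 'k, 'm) sheaf_data \<Rightarrow> ('x, 'k, 'm) sheaf_data \<Rightarrow> ('x, 'k, 'm set) sheaf_data"
where
  "quotient_sheaf X S T =
     \<lparr>stalk = \<lambda>x. quotient_module (stalk S x) (carrier (stalk T x)),
      sections = \<lambda>U. {s \<in> extensional U. \<forall>x\<in>U. \<exists>V t. openin X V \<and> x \<in> V \<and> V \<subseteq> U \<and>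
        t \<in> sections S V \<and> (\<forall>z\<in>V. s z = carrier (stalk T z) +>\<^bsub>stalk S z\<^esub> t z)}\<rparr>"

text \<open>The map \<open>S\<^sub>1 / T\<^sub>1 \<rightarrow> S\<^sub>2 / T\<^sub>2\<close> induced by \<open>\<psi>\<close>; for \<open>\<psi>\<close> mapping \<open>T\<^sub>1\<close> into \<open>T\<^sub>2\<close> all the
  cosets united here coincide.\<close>

definition induced_quotient_map ::
  "('x, 'k, 'n) sheaf_data \<Rightarrow> ('x, 'k, 'n) sheaf_data \<Rightarrow> ('x \<Rightarrow> 'm \<Rightarrow> 'n)
   \<Rightarrow> ('x \<Rightarrow> 'm set \<Rightarrow> 'n set)"
where
  "induced_quotient_map S\<^sub>2 T\<^sub>2 \<psi> = (\<lambda>x C. \<Union>c\<in>C. carrier (stalk T\<^sub>2 x) +>\<^bsub>stalk S\<^sub>2 x\<^esub> \<psi> x c)"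


section \<open>Complex spaces\<close>

text \<open>Complex \<open>n\<close>-space, modelled like \<open>Euclidean_space\<close>, because \<open>n\<close> varies with the chart.\<close>

definition complex_affine :: "nat \<Rightarrow> (nat \<Rightarrow> complex) topology" where
  "complex_affine n = subtopology (product_topology (\<lambda>_. euclidean) UNIV) {z. \<forall>i\<ge>n. z i = 0}"

text \<open>Holomorphic functions of \<open>n\<close> variables on the open set \<open>D\<close>: continuous, and holomorphic in
  each variable separately.\<close>

definition holo :: "nat \<Rightarrow> (nat \<Rightarrow> complex) set \<Rightarrow> ((nat \<Rightarrow> complex) \<Rightarrow> complex) \<Rightarrow> bool" where
  "holo n D f \<longleftrightarrow>
     openin (complex_affine n) D \<and>
     continuous_map (subtopology (complex_affine n) D) euclidean f \<and>
     (\<forall>z\<in>D. \<forall>i<n. (\<lambda>w. f (z(i := w))) field_differentiable at (z i))"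

definition germ ::
  "nat \<Rightarrow> (nat \<Rightarrow> complex) \<Rightarrow> ((nat \<Rightarrow> complex) \<Rightarrow> complex) \<Rightarrow> ((nat \<Rightarrow> complex) \<Rightarrow> complex) set"
where
  "germ n z f = {g. \<exists>W. openin (complex_affine n) W \<and> z \<in> W \<and> (\<forall>w\<in>W. g w = f w)}"

definition germ_algebra ::
  "nat \<Rightarrow> (nat \<Rightarrow> complex) \<Rightarrow> (complex, ((nat \<Rightarrow> complex) \<Rightarrow> complex) set) module"
where
  "germ_algebra n z =
     \<lparr>carrier = {germ n z f | f. \<exists>D. z \<in> D \<and> holo n D f},
      mult = \<lambda>a b. \<Union>f\<in>a. \<Union>g\<in>b. germ n z (\<lambda>w. f w * g w),
      one = germ n z (\<lambda>_. 1),
      ring.zero = germ n z (\<lambda>_. 0),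
      add = \<lambda>a b. \<Union>f\<in>a. \<Union>g\<in>b. germ n z (\<lambda>w. f w + g w),
      smult = \<lambda>c a. \<Union>f\<in>a. germ n z (\<lambda>w. c * f w)\<rparr>"

text \<open>The local model: the common zero set in \<open>D\<close> of a finite set \<open>E\<close> of holomorphic functions on
  \<open>D\<close>, with the structure sheaf \<open>O\<^sub>D / (E)\<close> restricted to it.\<close>

definition model_space :: "nat \<Rightarrow> (nat \<Rightarrow> complex) set \<Rightarrow> ((nat \<Rightarrow> complex) \<Rightarrow> complex) set \<Rightarrow>
    (nat \<Rightarrow> complex) topology" where
  "model_space n D E = subtopology (complex_affine n) {z \<in> D. \<forall>f\<in>E. f z = 0}"

definition model_ideal :: "nat \<Rightarrow> ((nat \<Rightarrow> complex) \<Rightarrow> complex) set \<Rightarrow> (nat \<Rightarrow> complex) \<Rightarrow>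
    ((nat \<Rightarrow> complex) \<Rightarrow> complex) set set" where
  "model_ideal n E z = Idl\<^bsub>germ_algebra n z\<^esub> (germ n z ` E)"

definition model_sheaf :: "nat \<Rightarrow> ((nat \<Rightarrow> complex) \<Rightarrow> complex) set \<Rightarrow>
    (nat \<Rightarrow> complex, complex, ((nat \<Rightarrow> complex) \<Rightarrow> complex) set set) sheaf_data" where
  "model_sheaf n E =
     \<lparr>stalk = \<lambda>z. quotient_module (germ_algebra n z) (model_ideal n E z),
      sections = \<lambda>U. {s \<in> extensional U. \<forall>z\<in>U. \<exists>W h. z \<in> W \<and> holo n W h \<and>
        (\<forall>w\<in>W \<inter> U. s w = model_ideal n E w +>\<^bsub>germ_algebra n w\<^esub> germ n w h)}\<rparr>"

text \<open>Complex spaces are Hausdorff, but need be neither reduced nor second countable.\<close>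

locale complex_space = ringed_space X O\<^sub>X
  for X :: "'x topology" and O\<^sub>X :: "('x, complex, 'a) sheaf_data" +
  assumes Hausdorff: "Hausdorff_space X"
    and local_model:
      "x \<in> topspace X \<Longrightarrow>
       \<exists>U n D E g \<theta>. openin X U \<and> x \<in> U \<and>
         openin (complex_affine n) D \<and> finite E \<and> (\<forall>f\<in>E. holo n D f) \<and>
         biholomorphic_map (subtopology X U) O\<^sub>X (model_space n D E) (model_sheaf n E) g \<theta>"

definition locally_irreducible :: "'x topology \<Rightarrow> ('x, complex, 'a) sheaf_data \<Rightarrow> bool" where
  "locally_irreducible X O\<^sub>X \<longleftrightarrow> (\<forall>x\<in>topspace X. domain (stalk O\<^sub>X x))"


section \<open>Proper modifications\<close>

text \<open>A section vanishes at a point if its germ there lies in the maximal ideal, that is, if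
  the germ is not a unit of the local ring.\<close>

definition closed_analytic :: "'x topology \<Rightarrow> ('x, complex, 'a) sheaf_data \<Rightarrow> 'x set \<Rightarrow> bool" where
  "closed_analytic X O\<^sub>X A \<longleftrightarrow>
     closedin X A \<and>
     (\<forall>x\<in>topspace X. \<exists>U E. openin X U \<and> x \<in> U \<and> finite E \<and> E \<subseteq> sections O\<^sub>X U \<and>
        A \<inter> U = {z \<in> U. \<forall>s\<in>E. s z \<notin> Units (stalk O\<^sub>X z)})"

text \<open>Restricting sections to the complement of \<open>A\<close> loses nothing; in the reduced case this is
  equivalent to \<open>A\<close> being nowhere dense.\<close>

definition analytically_rare :: "'x topology \<Rightarrow> ('x, complex, 'a) sheaf_data \<Rightarrow> 'x set \<Rightarrow> bool" where
  "analytically_rare X O\<^sub>X A \<longleftrightarrow>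
     (\<forall>U. openin X U \<longrightarrow> inj_on (\<lambda>s. restrict s (U - A)) (sections O\<^sub>X U))"

definition proper_modification ::
  "'y topology \<Rightarrow> ('y, complex, 'b) sheaf_data \<Rightarrow> 'x topology \<Rightarrow> ('x, complex, 'a) sheaf_data
   \<Rightarrow> ('y \<Rightarrow> 'x) \<Rightarrow> ('y \<Rightarrow> 'a \<Rightarrow> 'b) \<Rightarrow> bool"
where
  "proper_modification Y O\<^sub>Y X O\<^sub>X f \<phi> \<longleftrightarrow>
     complex_space Y O\<^sub>Y \<and> complex_space X O\<^sub>X \<and>
     holomorphic_map Y O\<^sub>Y X O\<^sub>X f \<phi> \<and> proper_map Y X f \<and> f ` topspace Y = topspace X \<and>
     (\<exists>A B. closed_analytic Y O\<^sub>Y A \<and> analytically_rare Y O\<^sub>Y A \<and>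
        closed_analytic X O\<^sub>X B \<and> analytically_rare X O\<^sub>X B \<and> B = f ` A \<and>
        biholomorphic_map (subtopology Y (topspace Y - A)) O\<^sub>Y
                          (subtopology X (topspace X - B)) O\<^sub>X f \<phi>)"


section \<open>Analytic inverse image\<close>

text \<open>The tensor product of \<open>A\<close> and \<open>M\<close> over \<open>R\<close>, for a ring homomorphism \<open>\<phi>\<close> from \<open>R\<close> to \<open>A\<close> and
  an \<open>R\<close>-module \<open>M\<close>: the free abelian group on \<open>A \<times> M\<close> (written multiplicatively in the
  library) modulo the bilinearity relations, as an \<open>A\<close>-module.\<close>

definition tensor_free :: "('a, 'd) ring_scheme \<Rightarrow> ('r, 'm, 'e) module_scheme \<Rightarrow> (('a \<times> 'm) \<Rightarrow>\<^sub>0 int) monoid" where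
  "tensor_free A M = free_Abelian_group (carrier A \<times> carrier M)"

definition tensor_relations ::
  "('r, 'c) ring_scheme \<Rightarrow> ('r \<Rightarrow> 'a) \<Rightarrow> ('a, 'd) ring_scheme \<Rightarrow> ('r, 'm, 'e) module_scheme \<Rightarrow> (('a \<times> 'm) \<Rightarrow>\<^sub>0 int) set"
where
  "tensor_relations R \<phi> A M = generate (tensor_free A M)
     ({frag_of (a \<oplus>\<^bsub>A\<^esub> b, m) - frag_of (a, m) - frag_of (b, m) | a b m.
         a \<in> carrier A \<and> b \<in> carrier A \<and> m \<in> carrier M} \<union>
      {frag_of (a, m \<oplus>\<^bsub>M\<^esub> n) - frag_of (a, m) - frag_of (a, n) | a m n.
         a \<in> carrier A \<and> m \<in> carrier M \<and> n \<in> carrier M} \<union>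
      {frag_of (a \<otimes>\<^bsub>A\<^esub> \<phi> r, m) - frag_of (a, r \<odot>\<^bsub>M\<^esub> m) | a r m.
         a \<in> carrier A \<and> r \<in> carrier R \<and> m \<in> carrier M})"

definition tensor_class ::
  "('r, 'c) ring_scheme \<Rightarrow> ('r \<Rightarrow> 'a) \<Rightarrow> ('a, 'd) ring_scheme \<Rightarrow> ('r, 'm, 'e) module_scheme \<Rightarrow> (('a \<times> 'm) \<Rightarrow>\<^sub>0 int) \<Rightarrow>
   (('a \<times> 'm) \<Rightarrow>\<^sub>0 int) set"
where
  "tensor_class R \<phi> A M c = tensor_relations R \<phi> A M #>\<^bsub>tensor_free A M\<^esub> c"

definition tensor_product ::
  "('r, 'c) ring_scheme \<Rightarrow> ('r \<Rightarrow> 'a) \<Rightarrow> ('a, 'd) ring_scheme \<Rightarrow> ('r, 'm, 'e) module_scheme \<Rightarrow> ('a, (('a \<times> 'm) \<Rightarrow>\<^sub>0 int) set) module"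
where
  "tensor_product R \<phi> A M =
     \<lparr>carrier = rcosets\<^bsub>tensor_free A M\<^esub> tensor_relations R \<phi> A M,
      mult = undefined,
      one = undefined,
      ring.zero = tensor_relations R \<phi> A M,
      add = (<#>\<^bsub>tensor_free A M\<^esub>),
      smult = \<lambda>a C. \<Union>c\<in>C.
        tensor_class R \<phi> A M (frag_extend (\<lambda>(b, m). frag_of (a \<otimes>\<^bsub>A\<^esub> b, m)) c)\<rparr>"

text \<open>The map \<open>id \<otimes> h\<close> into the tensor product of \<open>A\<close> and \<open>N\<close>.\<close>

definition tensor_map ::
  "('r, 'c) ring_scheme \<Rightarrow> ('r \<Rightarrow> 'a) \<Rightarrow> ('a, 'd) ring_scheme \<Rightarrow> ('r, 'n, 'e) module_scheme \<Rightarrow> ('m \<Rightarrow> 'n) \<Rightarrow>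
   (('a \<times> 'm) \<Rightarrow>\<^sub>0 int) set \<Rightarrow> (('a \<times> 'n) \<Rightarrow>\<^sub>0 int) set"
where
  "tensor_map R \<phi> A N h C = (\<Union>c\<in>C.
     tensor_class R \<phi> A N (frag_extend (\<lambda>(a, m). frag_of (a, h m)) c))"

text \<open>The sheaf \<open>f\<^sup>*F\<close>, the tensor product of \<open>O\<^sub>Y\<close> and \<open>f\<^sup>-\<^sup>1F\<close> over \<open>f\<^sup>-\<^sup>1O\<^sub>X\<close>: its sections are locally
  finite sums of \<open>a\<^sub>i \<otimes> (t\<^sub>i \<circ> f)\<close> with sections \<open>a\<^sub>i\<close> of \<open>O\<^sub>Y\<close> and \<open>t\<^sub>i\<close> of \<open>F\<close>.\<close>

definition inverse_image ::
  "'y topology \<Rightarrow> ('y, complex, 'b) sheaf_data \<Rightarrow> 'x topology \<Rightarrow> ('x, complex, 'a) sheaf_data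
   \<Rightarrow> ('y \<Rightarrow> 'x) \<Rightarrow> ('y \<Rightarrow> 'a \<Rightarrow> 'b) \<Rightarrow> ('x, 'a, 'm) sheaf_data
   \<Rightarrow> ('y, 'b, (('b \<times> 'm) \<Rightarrow>\<^sub>0 int) set) sheaf_data"
where
  "inverse_image Y O\<^sub>Y X O\<^sub>X f \<phi> F =
     \<lparr>stalk = \<lambda>y. tensor_product (stalk O\<^sub>X (f y)) (\<phi> y) (stalk O\<^sub>Y y) (stalk F (f y)),
      sections = \<lambda>U. {s \<in> extensional U. \<forall>y\<in>U. \<exists>V W (k::nat) a t.
        openin Y V \<and> y \<in> V \<and> V \<subseteq> U \<and> openin X W \<and> f ` V \<subseteq> W \<and>
        (\<forall>i<k. a i \<in> sections O\<^sub>Y V \<and> t i \<in> sections F W) \<and>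
        (\<forall>z\<in>V. s z = tensor_class (stalk O\<^sub>X (f z)) (\<phi> z) (stalk O\<^sub>Y z) (stalk F (f z))
                       (\<Sum>i<k. frag_of (a i z, t i (f z))))}\<rparr>"

definition inverse_image_map ::
  "('y, complex, 'b) sheaf_data \<Rightarrow> ('x, complex, 'a) sheaf_data
   \<Rightarrow> ('y \<Rightarrow> 'x) \<Rightarrow> ('y \<Rightarrow> 'a \<Rightarrow> 'b) \<Rightarrow> ('x, 'a, 'n) sheaf_data \<Rightarrow> ('x \<Rightarrow> 'm \<Rightarrow> 'n)
   \<Rightarrow> ('y \<Rightarrow> (('b \<times> 'm) \<Rightarrow>\<^sub>0 int) set \<Rightarrow> (('b \<times> 'n) \<Rightarrow>\<^sub>0 int) set)"
where
  "inverse_image_map O\<^sub>Y O\<^sub>X f \<phi> G \<psi> =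
     (\<lambda>y. tensor_map (stalk O\<^sub>X (f y)) (\<phi> y) (stalk O\<^sub>Y y) (stalk G (f y)) (\<psi> (f y)))"


section \<open>Torsion-free preimage sheaves\<close>

text \<open>Torsion elements are those annihilated by some non-zero-divisor; over an integral domain, by
  some nonzero element.\<close>

definition torsion :: "('r, 'b) ring_scheme \<Rightarrow> ('r, 'm, 'c) module_scheme \<Rightarrow> 'm set" where
  "torsion R M = {m \<in> carrier M. \<exists>r\<in>carrier R.
     (\<forall>b\<in>carrier R. r \<otimes>\<^bsub>R\<^esub> b = \<zero>\<^bsub>R\<^esub> \<longrightarrow> b = \<zero>\<^bsub>R\<^esub>) \<and> r \<odot>\<^bsub>M\<^esub> m = \<zero>\<^bsub>M\<^esub>}"

definition torsion_sheaf ::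
  "('x, complex, 'a) sheaf_data \<Rightarrow> ('x, 'a, 'm) sheaf_data \<Rightarrow> ('x, 'a, 'm) sheaf_data"
where
  "torsion_sheaf O\<^sub>X S =
     \<lparr>stalk = \<lambda>x. (stalk S x)\<lparr>carrier := torsion (stalk O\<^sub>X x) (stalk S x)\<rparr>,
      sections = \<lambda>U. {s \<in> sections S U. \<forall>x\<in>U. s x \<in> torsion (stalk O\<^sub>X x) (stalk S x)}\<rparr>"

definition torsion_free_preimage ::
  "'y topology \<Rightarrow> ('y, complex, 'b) sheaf_data \<Rightarrow> 'x topology \<Rightarrow> ('x, complex, 'a) sheaf_data
   \<Rightarrow> ('y \<Rightarrow> 'x) \<Rightarrow> ('y \<Rightarrow> 'a \<Rightarrow> 'b) \<Rightarrow> ('x, 'a, 'm) sheaf_data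
   \<Rightarrow> ('y, 'b, (('b \<times> 'm) \<Rightarrow>\<^sub>0 int) set set) sheaf_data"
where
  "torsion_free_preimage Y O\<^sub>Y X O\<^sub>X f \<phi> F =
     (let S = inverse_image Y O\<^sub>Y X O\<^sub>X f \<phi> F in quotient_sheaf Y S (torsion_sheaf O\<^sub>Y S))"

definition torsion_free_preimage_map ::
  "'y topology \<Rightarrow> ('y, complex, 'b) sheaf_data \<Rightarrow> 'x topology \<Rightarrow> ('x, complex, 'a) sheaf_data
   \<Rightarrow> ('y \<Rightarrow> 'x) \<Rightarrow> ('y \<Rightarrow> 'a \<Rightarrow> 'b) \<Rightarrow> ('x, 'a, 'n) sheaf_data \<Rightarrow> ('x \<Rightarrow> 'm \<Rightarrow> 'n)
   \<Rightarrow> ('y \<Rightarrow> (('b \<times> 'm) \<Rightarrow>\<^sub>0 int) set set \<Rightarrow> (('b \<times> 'n) \<Rightarrow>\<^sub>0 int) set set)"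
where
  "torsion_free_preimage_map Y O\<^sub>Y X O\<^sub>X f \<phi> G \<psi> =
     (let S = inverse_image Y O\<^sub>Y X O\<^sub>X f \<phi> G
      in induced_quotient_map S (torsion_sheaf O\<^sub>Y S) (inverse_image_map O\<^sub>Y O\<^sub>X f \<phi> G \<psi>))"

end

(*
  The stalks of \<pi>^T F are quotients of tensor products, so surjectivity passes to them directly.

  For injectivity, present F near \<pi>(y) by finitely many generators s_i and relations r_j, and write an
  element u over y as a sum of a_i \<otimes> s_i.  By linear algebra over the domain O_(Y,y), either a nonzero
  multiple of the vector (a_i) lies in the span of the pulled back relations, and then u is torsion, or
  there is a functional w that kills the relations but not (a_i).  In the second case, suppose that t is
  nonzero and annihilates the image of u.  All of these data extend to a neighbourhood of y.  Off the
  exceptional set A the map \<pi> is biholomorphic, so there t u = 0 by injectivity of \<psi>, the vector t (a_i)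
  is a combination of the relations, and t w(a) = 0.  As A is analytically rare, t w(a) = 0 at y too,
  a contradiction.  Only a presentation of F is used, not the coherence of O_Y.
*)
theory Submission
  imports Defs
begin

section \<open>Tensor products along a ring homomorphism\<close>

text \<open>Tensoring with O_{Y,y} is not exact where \<pi> fails to be biholomorphic, so
  \<pi>^*\<psi> may acquire a kernel over \<open>A\<close>; what has to be shown is that everything
  it sends into torsion is itself torsion. One obstacle is that rarity of \<open>A\<close> speaks of
  sections of O_Y only: a section of \<pi>^*F may vanish off \<open>A\<close> without being zero.
  This is why a linear form enters: it turns a vector into a scalar, to which rarity applies. The
  other obstacle is that an equation in the tensor product over y must be carried to nearby points.
  Such an equation is a finite combination of bilinearity relations, and these may involve germs
  that do not occur in the equation itself. Sections are therefore chosen through all germs at y at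
  once, and the relations are tested one at a time under the evaluation a \<otimes> m \<mapsto>
  \<eta>(a) m into the stalk of G, where \<eta> inverts the comorphism off \<open>A\<close>.\<close>

lemma tensor_class_conv: "tensor_class R \<phi> A M c = (\<lambda>h. h + c) ` tensor_relations R \<phi> A M"
  by (auto simp: tensor_class_def tensor_free_def r_coset_def)

text \<open>In use, \<open>R\<close> is the stalk of O_X at \<pi>(y), \<open>A\<close> the stalk of
  O_Y at y and \<open>M\<close> the stalk of a module sheaf at \<pi>(y); \<open>P\<close> is then
  the stalk of its analytic inverse image at y.\<close>

locale base_change = M: Module.module R M + A: cring A
  for R :: "('r, 'c) ring_scheme" and \<phi> :: "'r \<Rightarrow> 'a" and A :: "('a, 'd) ring_scheme"
    and M :: "('r, 'm, 'e) module_scheme" +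
  assumes \<phi>_hom: "\<phi> \<in> ring_hom R A"
begin

section \<open>Formal sums of pairs\<close>

abbreviation "frags \<equiv> carrier (tensor_free A M)"
abbreviation "rels \<equiv> tensor_relations R \<phi> A M"
abbreviation "cls \<equiv> tensor_class R \<phi> A M"
abbreviation "P \<equiv> tensor_product R \<phi> A M"

lemma frags_iff: "c \<in> frags \<longleftrightarrow> Poly_Mapping.keys c \<subseteq> carrier A \<times> carrier M"
  by (simp add: tensor_free_def)

lemma frags_frag_of [simp]: "frag_of (a, m) \<in> frags \<longleftrightarrow> a \<in> carrier A \<and> m \<in> carrier M"
  by (auto simp: frags_iff)

lemma frags_zero [simp]: "0 \<in> frags"
  by (simp add: frags_iff)

lemma frags_add: "c \<in> frags \<Longrightarrow> d \<in> frags \<Longrightarrow> c + d \<in> frags"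
  using keys_add[of c d] by (auto simp: frags_iff)

lemma frags_diff: "c \<in> frags \<Longrightarrow> d \<in> frags \<Longrightarrow> c - d \<in> frags"
  using keys_diff[of c d] by (auto simp: frags_iff)

lemma frags_sum: "(\<And>i. i \<in> I \<Longrightarrow> f i \<in> frags) \<Longrightarrow> sum f I \<in> frags"
  by (induct I rule: infinite_finite_induct) (auto intro: frags_add)

text \<open>Differences are the single step because they cover both sums and inverses: c + d is c -
  (0 - d).\<close>

lemma frags_induct [consumes 1, case_names zero one diff]:
  assumes "c \<in> frags" "Q 0"
    "\<And>a m. a \<in> carrier A \<Longrightarrow> m \<in> carrier M \<Longrightarrow> Q (frag_of (a, m))"
    "\<And>c d. c \<in> frags \<Longrightarrow> d \<in> frags \<Longrightarrow> Q c \<Longrightarrow> Q d \<Longrightarrow> Q (c - d)"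
  shows "Q c"
proof -
  from assms(1) have "Poly_Mapping.keys c \<subseteq> carrier A \<times> carrier M" by (simp add: frags_iff)
  then have "c \<in> frags \<and> Q c"
    by (induct rule: frag_induction) (use assms(2-) in \<open>auto simp: frags_diff\<close>)
  then show ?thesis ..
qed

lemma frag_extend_frags:
  assumes "c \<in> frags" "\<And>a m. a \<in> carrier A \<Longrightarrow> m \<in> carrier M \<Longrightarrow> f (a, m) \<in> B"
    "0 \<in> B" "\<And>x y. x \<in> B \<Longrightarrow> y \<in> B \<Longrightarrow> x - y \<in> B"
  shows "frag_extend f c \<in> B"
  using assms(1) by (induct rule: frags_induct) (auto simp: frag_extend_diff assms(2-))

section \<open>The subgroup of bilinearity relations\<close>

abbreviation "rel_add_l a b m \<equiv> frag_of (a \<oplus>\<^bsub>A\<^esub> b, m) - frag_of (a, m) - frag_of (b, m)"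
abbreviation "rel_add_r a m n \<equiv> frag_of (a, m \<oplus>\<^bsub>M\<^esub> n) - frag_of (a, m) - frag_of (a, n)"
abbreviation "rel_balanced a r m \<equiv> frag_of (a \<otimes>\<^bsub>A\<^esub> \<phi> r, m) - frag_of (a, r \<odot>\<^bsub>M\<^esub> m)"

lemma \<phi>_closed [simp]: "r \<in> carrier R \<Longrightarrow> \<phi> r \<in> carrier A"
  using \<phi>_hom by (rule ring_hom_closed)

lemma relations_subset:
  "{rel_add_l a b m | a b m. a \<in> carrier A \<and> b \<in> carrier A \<and> m \<in> carrier M} \<union>
   {rel_add_r a m n | a m n. a \<in> carrier A \<and> m \<in> carrier M \<and> n \<in> carrier M} \<union>
   {rel_balanced a r m | a r m. a \<in> carrier A \<and> r \<in> carrier R \<and> m \<in> carrier M} \<subseteq> frags"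
  by (auto intro!: frags_diff)

lemma comm_group_free: "comm_group (tensor_free A M)"
  by (simp add: tensor_free_def abelian_free_Abelian_group)

lemma subgroup_rels: "subgroup rels (tensor_free A M)"
  unfolding tensor_relations_def
  by (rule group.generate_is_subgroup[OF comm_group.axioms(2)[OF comm_group_free] relations_subset])

lemma rels_frags: "c \<in> rels \<Longrightarrow> c \<in> frags"
  using subgroup.subset[OF subgroup_rels] by auto

lemma rels_zero [simp]: "0 \<in> rels"
  using subgroup.one_closed[OF subgroup_rels] by (simp add: tensor_free_def)

lemma rels_add: "c \<in> rels \<Longrightarrow> d \<in> rels \<Longrightarrow> c + d \<in> rels"
  using subgroup.m_closed[OF subgroup_rels] by (simp add: tensor_free_def)

lemma rels_uminus: "c \<in> rels \<Longrightarrow> - c \<in> rels"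
  using subgroup.m_inv_closed[OF subgroup_rels, of c] rels_frags[of c]
  by (simp add: tensor_free_def)

lemma rels_diff: "c \<in> rels \<Longrightarrow> d \<in> rels \<Longrightarrow> c - d \<in> rels"
  using rels_add[OF _ rels_uminus, of c d] by simp

lemma rels_gen:
  assumes "a \<in> carrier A" "m \<in> carrier M"
  shows "b \<in> carrier A \<Longrightarrow> rel_add_l a b m \<in> rels"
    and "n \<in> carrier M \<Longrightarrow> rel_add_r a m n \<in> rels"
    and "r \<in> carrier R \<Longrightarrow> rel_balanced a r m \<in> rels"
  using assms unfolding tensor_relations_def by (blast intro: generate.incl)+

text \<open>Reduces a claim about all relations to the three generating families. The difference
  step carries only membership in \<open>frags\<close>, which is what the homomorphisms applied
  later need in order to be additive.\<close>

lemma rels_induct [consumes 1, case_names zero add_l add_r balanced diff]: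
  assumes "c \<in> rels" "Q 0"
    and gen: "\<And>a b m. a \<in> carrier A \<Longrightarrow> b \<in> carrier A \<Longrightarrow> m \<in> carrier M \<Longrightarrow> Q (rel_add_l a b m)"
    "\<And>a m n. a \<in> carrier A \<Longrightarrow> m \<in> carrier M \<Longrightarrow> n \<in> carrier M \<Longrightarrow> Q (rel_add_r a m n)"
    "\<And>a r m. a \<in> carrier A \<Longrightarrow> r \<in> carrier R \<Longrightarrow> m \<in> carrier M \<Longrightarrow> Q (rel_balanced a r m)"
    and diff: "\<And>c d. c \<in> frags \<Longrightarrow> d \<in> frags \<Longrightarrow> Q c \<Longrightarrow> Q d \<Longrightarrow> Q (c - d)"
  shows "Q c"
proof -
  have gen': "x \<in> frags \<and> Q x" if "x \<in> {rel_add_l a b m | a b m. a \<in> carrier A \<and> b \<in> carrier A \<and> m \<in> carrier M} \<union>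
   {rel_add_r a m n | a m n. a \<in> carrier A \<and> m \<in> carrier M \<and> n \<in> carrier M} \<union>
   {rel_balanced a r m | a r m. a \<in> carrier A \<and> r \<in> carrier R \<and> m \<in> carrier M}" for x
    using that
    by (elim UnE) (auto intro!: gen frags_diff)
  have "c \<in> frags \<and> Q c"
    using assms(1) unfolding tensor_relations_def
  proof (induct rule: generate.induct)
    case one
    then show ?case using \<open>Q 0\<close> by (simp add: tensor_free_def)
  next
    case (incl h)
    then show ?case by (rule gen')
  next
    case (inv h)
    have h: "h \<in> frags" "Q h" using gen'[OF inv] by auto
    then have "inv\<^bsub>tensor_free A M\<^esub> h = - h"
      by (simp add: tensor_free_def)
    moreover have "- h \<in> frags \<and> Q (- h)"
      using h diff[of 0 h] frags_diff[of 0 h] \<open>Q 0\<close> by simp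
    ultimately show ?case by simp
  next
    case (eng h1 h2)
    \<comment> \<open>Only differences are available, so the group operation is rewritten as
      one.\<close>
    have "h1 - (0 - h2) \<in> frags \<and> Q (h1 - (0 - h2))"
      by (intro conjI diff frags_diff) (use eng \<open>Q 0\<close> in auto)
    then show ?case by (simp add: tensor_free_def)
  qed
  then show ?thesis ..
qed

lemma cls_eq_iff: "cls c = cls d \<longleftrightarrow> c - d \<in> rels"
proof
  assume "cls c = cls d"
  moreover have "c \<in> cls c" by (force simp: tensor_class_conv)
  ultimately have "c \<in> cls d" by simp
  then show "c - d \<in> rels" by (auto simp: tensor_class_conv)
next
  assume *: "c - d \<in> rels"
  have "h + c \<in> cls d" if "h \<in> rels" for h
    using rels_add[OF that *] by (force simp: tensor_class_conv image_iff)
  moreover have "h + d \<in> cls c" if "h \<in> rels" for h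
    using rels_diff[OF that *] by (force simp: tensor_class_conv image_iff)
  ultimately show "cls c = cls d" by (auto simp: tensor_class_conv)
qed

section \<open>The quotient as a module over \<open>A\<close>\<close>

lemma carrier_P: "carrier P = cls ` frags"
  by (auto simp: tensor_product_def RCOSETS_def tensor_class_def)

lemma cls_closed [simp]: "c \<in> frags \<Longrightarrow> cls c \<in> carrier P"
  by (simp add: carrier_P)

lemma P_cases:
  assumes "x \<in> carrier P"
  obtains c where "c \<in> frags" "x = cls c"
  using assms by (auto simp: carrier_P)

lemma add_cls: "c \<in> frags \<Longrightarrow> d \<in> frags \<Longrightarrow> cls c \<oplus>\<^bsub>P\<^esub> cls d = cls (c + d)"
  using normal.rcos_sum[OF comm_group.subgroup_imp_normal[OF comm_group_free subgroup_rels], of c d]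
  by (simp add: tensor_product_def tensor_class_def) (simp add: tensor_free_def)

lemma zero_cls: "\<zero>\<^bsub>P\<^esub> = cls 0"
  by (simp add: tensor_product_def tensor_class_conv)

lemma cls_eq_zero_iff: "cls c = \<zero>\<^bsub>P\<^esub> \<longleftrightarrow> c \<in> rels"
  by (simp add: zero_cls cls_eq_iff)

text \<open>As an additive structure \<open>P\<close> is the factor group of the free abelian group
  by \<open>rels\<close>, written with other field names; the laws are those of the factor
  group.\<close>

lemma abelian_group_P: "abelian_group P"
proof -
  interpret Q: comm_group "tensor_free A M Mod rels"
    by (rule comm_group.abelian_FactGroup[OF comm_group_free subgroup_rels])
  show ?thesis
  proof (rule abelian_groupI)
    show "\<And>x y z. x \<in> carrier P \<Longrightarrow> y \<in> carrier P \<Longrightarrow> z \<in> carrier P \<Longrightarrow>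
      x \<oplus>\<^bsub>P\<^esub> y \<oplus>\<^bsub>P\<^esub> z = x \<oplus>\<^bsub>P\<^esub> (y \<oplus>\<^bsub>P\<^esub> z)"
      using Q.m_assoc by (simp add: tensor_product_def FactGroup_def)
    show "\<And>x y. x \<in> carrier P \<Longrightarrow> y \<in> carrier P \<Longrightarrow> x \<oplus>\<^bsub>P\<^esub> y = y \<oplus>\<^bsub>P\<^esub> x"
      using Q.m_comm by (simp add: tensor_product_def FactGroup_def)
    show "\<And>x y. x \<in> carrier P \<Longrightarrow> y \<in> carrier P \<Longrightarrow> x \<oplus>\<^bsub>P\<^esub> y \<in> carrier P"
      using Q.m_closed by (simp add: tensor_product_def FactGroup_def)
    show "\<zero>\<^bsub>P\<^esub> \<in> carrier P"
      using Q.one_closed by (simp add: tensor_product_def FactGroup_def)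
    show "\<And>x. x \<in> carrier P \<Longrightarrow> \<zero>\<^bsub>P\<^esub> \<oplus>\<^bsub>P\<^esub> x = x"
      using Q.l_one by (simp add: tensor_product_def FactGroup_def)
    show "\<And>x. x \<in> carrier P \<Longrightarrow> \<exists>y\<in>carrier P. y \<oplus>\<^bsub>P\<^esub> x = \<zero>\<^bsub>P\<^esub>"
      using Q.l_inv_ex by (simp add: tensor_product_def FactGroup_def)
  qed
qed

abbreviation "fscale a \<equiv> frag_extend (\<lambda>(b, m). frag_of (a \<otimes>\<^bsub>A\<^esub> b, m))"

lemma fscale_frags: "a \<in> carrier A \<Longrightarrow> c \<in> frags \<Longrightarrow> fscale a c \<in> frags"
  by (erule frag_extend_frags) (auto intro: frags_diff)

lemma fscale_rels:
  assumes "a \<in> carrier A" "c \<in> rels"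
  shows "fscale a c \<in> rels"
  using assms(2)
  by (induct rule: rels_induct)
    (use assms(1) in \<open>auto simp: frag_extend_diff A.r_distr rels_diff rels_gen A.m_assoc[symmetric]\<close>)

text \<open>Scalar multiplication and id \<otimes> h are both defined as unions over all
  representatives of a class, which avoids a choice. The union collapses because \<open>f\<close>
  respects relations, so that all the classes united are equal. The target is left general to cover
  both uses.\<close>

lemma Union_cls:
  assumes "base_change R' \<phi>' A' M'"
    and f: "\<And>h. h \<in> rels \<Longrightarrow> frag_extend f h \<in> tensor_relations R' \<phi>' A' M'"
  shows "(\<Union>d\<in>cls c. tensor_class R' \<phi>' A' M' (frag_extend f d)) =
    tensor_class R' \<phi>' A' M' (frag_extend f c)"
proof -
  interpret N: base_change R' \<phi>' A' M' by fact
  have "N.cls (frag_extend f d) = N.cls (frag_extend f c)" if "d \<in> cls c" for d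
    using that f by (auto simp: tensor_class_conv[of _ _ _ M] N.cls_eq_iff frag_extend_add)
  moreover have "c \<in> cls c" by (force simp: tensor_class_conv)
  ultimately show ?thesis by blast
qed

lemma smult_cls:
  assumes "a \<in> carrier A"
  shows "a \<odot>\<^bsub>P\<^esub> cls c = cls (fscale a c)"
proof -
  have "a \<odot>\<^bsub>P\<^esub> cls c = (\<Union>d\<in>cls c. cls (fscale a d))"
    by (simp add: tensor_product_def)
  also have "\<dots> = cls (fscale a c)"
    by (rule Union_cls[OF base_change_axioms fscale_rels[OF assms]])
  finally show ?thesis .
qed

text \<open>Only an equality modulo \<open>rels\<close>: additivity in the first factor is one of
  the imposed relations. The laws for products and for the unit hold for the formal sums
  themselves.\<close>

lemma fscale_add:
  assumes "a \<in> carrier A" "b \<in> carrier A" "c \<in> frags"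
  shows "fscale (a \<oplus>\<^bsub>A\<^esub> b) c - (fscale a c + fscale b c) \<in> rels"
  using assms(3)
proof (induct rule: frags_induct)
  case (one x m)
  then show ?case
    using assms rels_gen(1)[of "a \<otimes>\<^bsub>A\<^esub> x" m "b \<otimes>\<^bsub>A\<^esub> x"] by (simp add: A.l_distr diff_diff_eq)
next
  case (diff c d)
  show ?case
    using rels_diff[OF diff(3,4)] by (simp add: frag_extend_diff algebra_simps)
qed simp

lemma fscale_mult:
  assumes "a \<in> carrier A" "b \<in> carrier A" "c \<in> frags"
  shows "fscale (a \<otimes>\<^bsub>A\<^esub> b) c = fscale a (fscale b c)"
  using assms(3) by (induct rule: frags_induct) (use assms in \<open>auto simp: frag_extend_diff A.m_assoc\<close>)

lemma fscale_one: "c \<in> frags \<Longrightarrow> fscale \<one>\<^bsub>A\<^esub> c = c"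
  by (induct rule: frags_induct) (auto simp: frag_extend_diff)

lemma module_P: "Module.module A P"
proof (rule moduleI[OF A.is_cring abelian_group_P])
  fix a b x y assume a: "a \<in> carrier A" and b: "b \<in> carrier A" and x: "x \<in> carrier P" and y: "y \<in> carrier P"
  from x obtain c where c: "c \<in> frags" "x = cls c" by (rule P_cases)
  from y obtain d where d: "d \<in> frags" "y = cls d" by (rule P_cases)
  show "a \<odot>\<^bsub>P\<^esub> x \<in> carrier P"
    using a c by (simp add: smult_cls fscale_frags)
  show "(a \<oplus>\<^bsub>A\<^esub> b) \<odot>\<^bsub>P\<^esub> x = a \<odot>\<^bsub>P\<^esub> x \<oplus>\<^bsub>P\<^esub> b \<odot>\<^bsub>P\<^esub> x"
    using a b c by (simp add: smult_cls fscale_frags add_cls cls_eq_iff fscale_add)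
  show "a \<odot>\<^bsub>P\<^esub> (x \<oplus>\<^bsub>P\<^esub> y) = a \<odot>\<^bsub>P\<^esub> x \<oplus>\<^bsub>P\<^esub> a \<odot>\<^bsub>P\<^esub> y"
    using a c d by (simp add: smult_cls fscale_frags add_cls frag_extend_add)
  show "a \<otimes>\<^bsub>A\<^esub> b \<odot>\<^bsub>P\<^esub> x = a \<odot>\<^bsub>P\<^esub> (b \<odot>\<^bsub>P\<^esub> x)"
    using a b c by (simp add: smult_cls fscale_mult)
next
  fix x assume "x \<in> carrier P"
  then obtain c where "c \<in> frags" "x = cls c" by (rule P_cases)
  then show "\<one>\<^bsub>A\<^esub> \<odot>\<^bsub>P\<^esub> x = x" by (simp add: smult_cls fscale_one)
qed

sublocale P: Module.module A P
  by (rule module_P)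

section \<open>Elementary tensors\<close>

definition pure :: "'a \<Rightarrow> 'm \<Rightarrow> (('a \<times> 'm) \<Rightarrow>\<^sub>0 int) set" where
  "pure a m = cls (frag_of (a, m))"

lemma pure_closed [simp]: "a \<in> carrier A \<Longrightarrow> m \<in> carrier M \<Longrightarrow> pure a m \<in> carrier P"
  by (simp add: pure_def)

lemma pure_add_r: "a \<in> carrier A \<Longrightarrow> m \<in> carrier M \<Longrightarrow> n \<in> carrier M \<Longrightarrow>
    pure a (m \<oplus>\<^bsub>M\<^esub> n) = pure a m \<oplus>\<^bsub>P\<^esub> pure a n"
  using rels_gen(2)[of a m n] by (simp add: pure_def add_cls cls_eq_iff diff_diff_eq)

lemma pure_balanced: "a \<in> carrier A \<Longrightarrow> r \<in> carrier R \<Longrightarrow> m \<in> carrier M \<Longrightarrow>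
    pure (a \<otimes>\<^bsub>A\<^esub> \<phi> r) m = pure a (r \<odot>\<^bsub>M\<^esub> m)"
  using rels_gen(3)[of a m r] by (simp add: pure_def cls_eq_iff)

lemma smult_pure: "a \<in> carrier A \<Longrightarrow> b \<in> carrier A \<Longrightarrow> m \<in> carrier M \<Longrightarrow>
    a \<odot>\<^bsub>P\<^esub> pure b m = pure (a \<otimes>\<^bsub>A\<^esub> b) m"
  by (simp add: pure_def smult_cls)

lemma pure_zero_r: "a \<in> carrier A \<Longrightarrow> pure a \<zero>\<^bsub>M\<^esub> = \<zero>\<^bsub>P\<^esub>"
  using pure_add_r[of a "\<zero>\<^bsub>M\<^esub>" "\<zero>\<^bsub>M\<^esub>"] by simp

end

section \<open>Linear combinations, torsion and quotients\<close>

context Module.module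
begin

lemma lincomb_0 [simp]: "lincomb M 0 a m = \<zero>\<^bsub>M\<^esub>"
  by (simp add: lincomb_def)

lemma lincomb_Suc:
  assumes "\<And>i. i < Suc k \<Longrightarrow> a i \<in> carrier R" "\<And>i. i < Suc k \<Longrightarrow> m i \<in> carrier M"
  shows "lincomb M (Suc k) a m = a k \<odot>\<^bsub>M\<^esub> m k \<oplus>\<^bsub>M\<^esub> lincomb M k a m"
proof -
  have "(\<lambda>i. a i \<odot>\<^bsub>M\<^esub> m i) \<in> {..<k} \<rightarrow> carrier M"
    using assms by auto
  then show ?thesis
    using assms by (simp add: lincomb_def lessThan_Suc)
qed

lemma lincomb_closed [simp]:
  assumes "\<And>i. i < k \<Longrightarrow> a i \<in> carrier R" "\<And>i. i < k \<Longrightarrow> m i \<in> carrier M"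
  shows "lincomb M k a m \<in> carrier M"
  unfolding lincomb_def using assms by (intro M.finsum_closed) auto

lemma lincomb_cong:
  assumes "\<And>i. i < k \<Longrightarrow> a i = b i" "\<And>i. i < k \<Longrightarrow> m i = n i"
    "\<And>i. i < k \<Longrightarrow> b i \<in> carrier R" "\<And>i. i < k \<Longrightarrow> n i \<in> carrier M"
  shows "lincomb M k a m = lincomb M k b n"
  unfolding lincomb_def using assms by (intro M.finsum_cong') auto

lemma lincomb_zero: "(\<And>i. i < k \<Longrightarrow> m i \<in> carrier M) \<Longrightarrow> lincomb M k (\<lambda>_. \<zero>\<^bsub>R\<^esub>) m = \<zero>\<^bsub>M\<^esub>"
  by (induct k) (simp_all add: lincomb_Suc)

lemma lincomb_add:
  assumes "\<And>i. i < k \<Longrightarrow> a i \<in> carrier R" "\<And>i. i < k \<Longrightarrow> b i \<in> carrier R"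
    "\<And>i. i < k \<Longrightarrow> m i \<in> carrier M"
  shows "lincomb M k (\<lambda>i. a i \<oplus>\<^bsub>R\<^esub> b i) m = lincomb M k a m \<oplus>\<^bsub>M\<^esub> lincomb M k b m"
  using assms by (induct k) (simp_all add: lincomb_Suc smult_l_distr M.a_ac)

lemma lincomb_smult:
  assumes "r \<in> carrier R" "\<And>i. i < k \<Longrightarrow> a i \<in> carrier R" "\<And>i. i < k \<Longrightarrow> m i \<in> carrier M"
  shows "lincomb M k (\<lambda>i. r \<otimes>\<^bsub>R\<^esub> a i) m = r \<odot>\<^bsub>M\<^esub> lincomb M k a m"
  using assms by (induct k) (simp_all add: lincomb_Suc smult_assoc1 smult_r_distr)

text \<open>The double sum is reorganised by induction on the number of relations, splitting off one
  at a time. It is applied in the tensor product, to pulled back relations, and in a ring over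
  itself, to vectors killed by a linear form.\<close>

lemma lincomb_relations:
  fixes p q :: nat
  assumes "\<And>j. j < q \<Longrightarrow> c j \<in> carrier R" "\<And>i j. i < p \<Longrightarrow> j < q \<Longrightarrow> r j i \<in> carrier R"
    "\<And>i. i < p \<Longrightarrow> s i \<in> carrier M" "\<And>j. j < q \<Longrightarrow> lincomb M p (r j) s = \<zero>\<^bsub>M\<^esub>"
  shows "lincomb M p (\<lambda>i. finsum R (\<lambda>j. c j \<otimes>\<^bsub>R\<^esub> r j i) {..<q}) s = \<zero>\<^bsub>M\<^esub>"
  using assms
proof (induct q)
  case 0
  show ?case using lincomb_zero[of p s] 0(3) by simp
next
  case (Suc q)
  let ?f = "\<lambda>q i. finsum R (\<lambda>j. c j \<otimes>\<^bsub>R\<^esub> r j i) {..<q}"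
  have closed: "c q \<in> carrier R" "\<And>i. i < p \<Longrightarrow> r q i \<in> carrier R"
    using Suc.prems by auto
  have f: "?f q i \<in> carrier R" if "i < p" for i
    using Suc.prems that by (intro R.finsum_closed) auto
  have "?f (Suc q) i = c q \<otimes>\<^bsub>R\<^esub> r q i \<oplus>\<^bsub>R\<^esub> ?f q i" if "i < p" for i
    unfolding lessThan_Suc using Suc.prems(1,2) that by (intro R.finsum_insert) auto
  then have "lincomb M p (?f (Suc q)) s = lincomb M p (\<lambda>i. c q \<otimes>\<^bsub>R\<^esub> r q i \<oplus>\<^bsub>R\<^esub> ?f q i) s"
    using closed f Suc.prems(3) by (intro lincomb_cong) auto
  also have "\<dots> = lincomb M p (\<lambda>i. c q \<otimes>\<^bsub>R\<^esub> r q i) s \<oplus>\<^bsub>M\<^esub> lincomb M p (?f q) s"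
    using closed f Suc.prems(3) by (intro lincomb_add) auto
  also have "lincomb M p (\<lambda>i. c q \<otimes>\<^bsub>R\<^esub> r q i) s = \<zero>\<^bsub>M\<^esub>"
    using closed Suc.prems(3,4) by (simp add: lincomb_smult)
  also have "lincomb M p (?f q) s = \<zero>\<^bsub>M\<^esub>"
    using Suc by simp
  finally show ?case by simp
qed

end

lemma linear_mapD:
  assumes "linear_map R M N h"
  shows "u \<in> carrier M \<Longrightarrow> h u \<in> carrier N"
    and "u \<in> carrier M \<Longrightarrow> v \<in> carrier M \<Longrightarrow> h (u \<oplus>\<^bsub>M\<^esub> v) = h u \<oplus>\<^bsub>N\<^esub> h v"
    and "r \<in> carrier R \<Longrightarrow> u \<in> carrier M \<Longrightarrow> h (r \<odot>\<^bsub>M\<^esub> u) = r \<odot>\<^bsub>N\<^esub> h u"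
  using assms by (auto simp: linear_map_def)

locale linear_map_modules = M: Module.module R M + N: Module.module R N
  for R :: "('r, 'c) ring_scheme" and M :: "('r, 'm, 'd) module_scheme"
    and N :: "('r, 'n, 'e) module_scheme" and h +
  assumes linear: "linear_map R M N h"
begin

lemmas h_closed [simp] = linear_mapD(1)[OF linear]
lemmas h_add = linear_mapD(2)[OF linear]
lemmas h_smult = linear_mapD(3)[OF linear]

lemma h_zero [simp]: "h \<zero>\<^bsub>M\<^esub> = \<zero>\<^bsub>N\<^esub>"
  using h_add[of "\<zero>\<^bsub>M\<^esub>" "\<zero>\<^bsub>M\<^esub>"] by simp

lemma h_minus:
  assumes "u \<in> carrier M" "v \<in> carrier M"
  shows "h (u \<ominus>\<^bsub>M\<^esub> v) = h u \<ominus>\<^bsub>N\<^esub> h v"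
proof -
  have "h (\<ominus>\<^bsub>M\<^esub> v) \<oplus>\<^bsub>N\<^esub> h v = \<zero>\<^bsub>N\<^esub>"
    using assms by (simp flip: h_add add: M.M.l_neg)
  then have "h (\<ominus>\<^bsub>M\<^esub> v) = \<ominus>\<^bsub>N\<^esub> h v"
    using assms by (intro N.M.minus_equality[symmetric]) auto
  with assms show ?thesis by (simp add: a_minus_def h_add)
qed

lemma h_lincomb:
  assumes "\<And>i. i < k \<Longrightarrow> a i \<in> carrier R" "\<And>i. i < k \<Longrightarrow> m i \<in> carrier M"
  shows "h (lincomb M k a m) = lincomb N k a (\<lambda>i. h (m i))"
  using assms by (induct k) (simp_all add: M.lincomb_Suc N.lincomb_Suc h_add h_smult)

lemma torsion_image:
  assumes "u \<in> torsion R M" shows "h u \<in> torsion R N"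
  using assms unfolding torsion_def by (auto simp flip: h_smult)

end

lemma torsionI:
  assumes "m \<in> carrier M" "r \<in> carrier R"
    "\<And>b. b \<in> carrier R \<Longrightarrow> r \<otimes>\<^bsub>R\<^esub> b = \<zero>\<^bsub>R\<^esub> \<Longrightarrow> b = \<zero>\<^bsub>R\<^esub>" "r \<odot>\<^bsub>M\<^esub> m = \<zero>\<^bsub>M\<^esub>"
  shows "m \<in> torsion R M"
  using assms unfolding torsion_def by blast

text \<open>Annihilators multiply: a product of two non-zero-divisors is again a non-zero-divisor,
  and it kills the sum of what the factors kill.\<close>

lemma (in Module.module) torsion_submodule: "submodule (torsion R M) R M"
proof (rule submoduleI)
  show "torsion R M \<subseteq> carrier M" by (auto simp: torsion_def)
  show "\<zero>\<^bsub>M\<^esub> \<in> torsion R M"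
    unfolding torsion_def by (auto intro!: bexI[of _ "\<one>\<^bsub>R\<^esub>"])
  fix u assume "u \<in> torsion R M"
  then obtain r where u: "u \<in> carrier M" "r \<odot>\<^bsub>M\<^esub> u = \<zero>\<^bsub>M\<^esub>" and r: "r \<in> carrier R"
    "\<forall>b\<in>carrier R. r \<otimes>\<^bsub>R\<^esub> b = \<zero>\<^bsub>R\<^esub> \<longrightarrow> b = \<zero>\<^bsub>R\<^esub>"
    by (auto simp: torsion_def)
  have "r \<odot>\<^bsub>M\<^esub> (\<ominus>\<^bsub>M\<^esub> u) = \<zero>\<^bsub>M\<^esub>" using u r by (simp add: smult_r_minus)
  then show "\<ominus>\<^bsub>M\<^esub> u \<in> torsion R M" using u r by (intro torsionI[of _ _ r]) auto
  show "a \<odot>\<^bsub>M\<^esub> u \<in> torsion R M" if "a \<in> carrier R" for a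
  proof -
    have "r \<odot>\<^bsub>M\<^esub> (a \<odot>\<^bsub>M\<^esub> u) = a \<odot>\<^bsub>M\<^esub> (r \<odot>\<^bsub>M\<^esub> u)"
      using that u(1) r(1) smult_assoc1[of r a u] smult_assoc1[of a r u] R.m_comm[of r a] by simp
    then show ?thesis using u r that by (intro torsionI[of _ _ r]) auto
  qed
  fix v assume "v \<in> torsion R M"
  then obtain s where v: "v \<in> carrier M" "s \<odot>\<^bsub>M\<^esub> v = \<zero>\<^bsub>M\<^esub>" and s: "s \<in> carrier R"
    "\<forall>b\<in>carrier R. s \<otimes>\<^bsub>R\<^esub> b = \<zero>\<^bsub>R\<^esub> \<longrightarrow> b = \<zero>\<^bsub>R\<^esub>"
    by (auto simp: torsion_def)
  have "(r \<otimes>\<^bsub>R\<^esub> s) \<odot>\<^bsub>M\<^esub> u = s \<odot>\<^bsub>M\<^esub> (r \<odot>\<^bsub>M\<^esub> u)"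
    using u(1) r(1) s(1) smult_assoc1[of s r u] R.m_comm[of r s] by simp
  moreover have "(r \<otimes>\<^bsub>R\<^esub> s) \<odot>\<^bsub>M\<^esub> v = \<zero>\<^bsub>M\<^esub>"
    using v r s by (simp add: smult_assoc1)
  ultimately have "(r \<otimes>\<^bsub>R\<^esub> s) \<odot>\<^bsub>M\<^esub> (u \<oplus>\<^bsub>M\<^esub> v) = \<zero>\<^bsub>M\<^esub>"
    using u v r s by (simp add: smult_r_distr)
  moreover have "b = \<zero>\<^bsub>R\<^esub>" if "b \<in> carrier R" "r \<otimes>\<^bsub>R\<^esub> s \<otimes>\<^bsub>R\<^esub> b = \<zero>\<^bsub>R\<^esub>" for b
  proof -
    have "r \<otimes>\<^bsub>R\<^esub> (s \<otimes>\<^bsub>R\<^esub> b) = \<zero>\<^bsub>R\<^esub>"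
      using that r(1) s(1) R.m_assoc[of r s b] by simp
    then show ?thesis using that(1) r s by blast
  qed
  ultimately show "u \<oplus>\<^bsub>M\<^esub> v \<in> torsion R M"
    using u(1) v(1) r(1) s(1) by (intro torsionI[of _ _ "r \<otimes>\<^bsub>R\<^esub> s"]) auto
qed

section \<open>Quotient modules and induced maps\<close>

locale quotient_by_submodule = Module.module R M
  for R :: "('r, 'c) ring_scheme" and M :: "('r, 'm, 'd) module_scheme" and N +
  assumes N: "submodule N R M"
begin

abbreviation "Q \<equiv> quotient_module M N"
abbreviation "coset \<equiv> a_r_coset M N"

sublocale abelian_subgroup N M
  using submodule.axioms(1)[OF N] M.abelian_group_axioms
  by (intro abelian_subgroupI3 additive_subgroup.intro)

lemma carrier_Q: "carrier Q = coset ` carrier M"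
  by (auto simp: quotient_module_def ring.extend_def ring.defs FactRing_def A_RCOSETS_def' a_r_coset_def)

lemma coset_eq_iff:
  assumes "u \<in> carrier M" "v \<in> carrier M"
  shows "coset u = coset v \<longleftrightarrow> u \<ominus>\<^bsub>M\<^esub> v \<in> N"
proof -
  have "coset u = coset v \<longleftrightarrow> u \<in> coset v"
    using assms a_repr_independence'[of u v] a_rcos_self[of u] by auto
  also have "\<dots> \<longleftrightarrow> u \<ominus>\<^bsub>M\<^esub> v \<in> N"
    using assms by (simp add: a_rcos_module a_minus_def)
  finally show ?thesis .
qed

lemma add_coset: "u \<in> carrier M \<Longrightarrow> v \<in> carrier M \<Longrightarrow> coset u \<oplus>\<^bsub>Q\<^esub> coset v = coset (u \<oplus>\<^bsub>M\<^esub> v)"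
  by (simp add: quotient_module_def ring.extend_def ring.defs FactRing_def a_rcos_sum)

lemma coset_memD:
  assumes "v \<in> coset u" "u \<in> carrier M"
  shows "v \<in> carrier M" "v \<ominus>\<^bsub>M\<^esub> u \<in> N"
proof -
  show v: "v \<in> carrier M" using assms a_r_coset_subset_G[OF a_subset] by auto
  show "v \<ominus>\<^bsub>M\<^esub> u \<in> N"
    using a_repr_independence'[OF assms] assms v by (simp flip: coset_eq_iff)
qed

lemma smult_coset:
  assumes "r \<in> carrier R" "u \<in> carrier M"
  shows "r \<odot>\<^bsub>Q\<^esub> coset u = coset (r \<odot>\<^bsub>M\<^esub> u)"
proof -
  have "coset (r \<odot>\<^bsub>M\<^esub> v) = coset (r \<odot>\<^bsub>M\<^esub> u)" if "v \<in> coset u" for v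
  proof -
    note v = coset_memD[OF that assms(2)]
    have "r \<odot>\<^bsub>M\<^esub> v \<ominus>\<^bsub>M\<^esub> r \<odot>\<^bsub>M\<^esub> u = r \<odot>\<^bsub>M\<^esub> (v \<ominus>\<^bsub>M\<^esub> u)"
      using v assms by (simp add: a_minus_def smult_r_distr smult_r_minus)
    then show ?thesis
      using v assms submodule.smult_closed[OF N] by (simp add: coset_eq_iff)
  qed
  moreover have "u \<in> coset u" using assms(2) by (rule a_rcos_self)
  ultimately have "(\<Union>v\<in>coset u. coset (r \<odot>\<^bsub>M\<^esub> v)) = coset (r \<odot>\<^bsub>M\<^esub> u)" by blast
  then show ?thesis
    by (simp add: quotient_module_def ring.extend_def ring.defs module.defs)
qed

end

locale quotient_linear_map = linear_map_modules R M M' h +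
    M: quotient_by_submodule R M N + M': quotient_by_submodule R M' N'
  for R :: "('r, 'c) ring_scheme" and M :: "('r, 'm, 'd) module_scheme" and N
    and M' :: "('r, 'n, 'e) module_scheme" and N' and h +
  assumes h_N: "u \<in> N \<Longrightarrow> h u \<in> N'"
begin

text \<open>Representatives differ by an element of \<open>N\<close>, so their images differ by an
  element of \<open>N'\<close>, and all cosets in the union agree.\<close>

lemma Union_coset:
  assumes "u \<in> carrier M"
  shows "(\<Union>v\<in>M.coset u. M'.coset (h v)) = M'.coset (h u)"
proof -
  have "M'.coset (h v) = M'.coset (h u)" if "v \<in> M.coset u" for v
    using M.coset_memD[OF that assms] assms h_N by (simp add: M'.coset_eq_iff flip: h_minus)
  moreover have "u \<in> M.coset u" using assms by (rule M.a_rcos_self)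
  ultimately show ?thesis by blast
qed

lemma induced_linear: "linear_map R M.Q M'.Q (\<lambda>C. \<Union>v\<in>C. M'.coset (h v))"
  unfolding linear_map_def M.carrier_Q M'.carrier_Q
  by (simp add: Pi_iff imageI Union_coset M.add_coset M'.add_coset M.smult_coset M'.smult_coset h_add h_smult)

lemma induced_surj:
  assumes "h ` carrier M = carrier M'"
  shows "(\<lambda>C. \<Union>v\<in>C. M'.coset (h v)) ` carrier M.Q = carrier M'.Q"
proof -
  have "(\<lambda>C. \<Union>v\<in>C. M'.coset (h v)) ` carrier M.Q = M'.coset ` h ` carrier M"
    by (auto simp: M.carrier_Q Union_coset image_image)
  then show ?thesis by (simp add: assms M'.carrier_Q)
qed

text \<open>The kernel of the induced map is the preimage of \<open>N'\<close> modulo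
  \<open>N\<close>. With torsion for \<open>N\<close> and \<open>N'\<close> the assumption says that
  \<open>h\<close> reflects torsion.\<close>

lemma induced_inj:
  assumes "\<And>u. u \<in> carrier M \<Longrightarrow> h u \<in> N' \<Longrightarrow> u \<in> N"
  shows "inj_on (\<lambda>C. \<Union>v\<in>C. M'.coset (h v)) (carrier M.Q)"
proof (rule inj_onI)
  fix C D assume "C \<in> carrier M.Q" "D \<in> carrier M.Q"
  then obtain u v where uv: "u \<in> carrier M" "v \<in> carrier M" "C = M.coset u" "D = M.coset v"
    by (auto simp: M.carrier_Q)
  assume "(\<Union>v\<in>C. M'.coset (h v)) = (\<Union>v\<in>D. M'.coset (h v))"
  then have "h (u \<ominus>\<^bsub>M\<^esub> v) \<in> N'"
    using uv by (simp add: Union_coset M'.coset_eq_iff h_minus)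
  then show "C = D" using uv assms by (simp add: M.coset_eq_iff)
qed

end

section \<open>Linear algebra over a domain\<close>

text \<open>The ring as a module over itself. It lets facts about \<open>lincomb\<close> serve for
  scalar products of vectors, and facts about module sheaves for the structure sheaf.\<close>

definition regular_module :: "('r, 'c) ring_scheme \<Rightarrow> ('r, 'r) module" where
  "regular_module R = \<lparr>carrier = carrier R, mult = mult R, one = \<one>\<^bsub>R\<^esub>, ring.zero = \<zero>\<^bsub>R\<^esub>, add = add R,
    smult = mult R\<rparr>"

lemma regular_module_simps [simp]:
  "carrier (regular_module R) = carrier R" "\<zero>\<^bsub>regular_module R\<^esub> = \<zero>\<^bsub>R\<^esub>"
  "a \<oplus>\<^bsub>regular_module R\<^esub> b = a \<oplus>\<^bsub>R\<^esub> b" "a \<odot>\<^bsub>regular_module R\<^esub> b = a \<otimes>\<^bsub>R\<^esub> b"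
  by (simp_all add: regular_module_def)

lemma (in cring) module_regular_module: "Module.module R (regular_module R)"
  by (intro moduleI abelian_groupI)
    (auto simp: is_cring l_distr r_distr m_assoc a_ac intro: bexI[where x = "\<ominus> _"] l_neg)

text \<open>The pairing of a linear form with a vector, both given by coordinates.\<close>

abbreviation "dot R p u v \<equiv> lincomb (regular_module R) p u v"

context cring
begin

lemma dot_comm:
  assumes "\<And>i. i < p \<Longrightarrow> u i \<in> carrier R" "\<And>i. i < p \<Longrightarrow> v i \<in> carrier R"
  shows "dot R p u v = dot R p v u"
proof -
  interpret V: Module.module R "regular_module R" by (rule module_regular_module)
  show ?thesis using assms by (induct p) (simp_all add: V.lincomb_Suc m_comm)
qed

lemma dot_closed [simp]:
  assumes "\<And>i. i < p \<Longrightarrow> u i \<in> carrier R" "\<And>i. i < p \<Longrightarrow> v i \<in> carrier R"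
  shows "dot R p u v \<in> carrier R"
proof -
  interpret V: Module.module R "regular_module R" by (rule module_regular_module)
  show ?thesis using V.lincomb_closed[of p u v] assms by simp
qed

lemma dot_minus_left:
  assumes "d \<in> carrier R" "e \<in> carrier R" "\<And>i. i < p \<Longrightarrow> u i \<in> carrier R"
    "\<And>i. i < p \<Longrightarrow> v i \<in> carrier R" "\<And>i. i < p \<Longrightarrow> w i \<in> carrier R"
  shows "dot R p (\<lambda>i. d \<otimes> u i \<ominus> e \<otimes> v i) w = d \<otimes> dot R p u w \<ominus> e \<otimes> dot R p v w"
proof -
  interpret V: Module.module R "regular_module R" by (rule module_regular_module)
  have "dot R p (\<lambda>i. d \<otimes> u i \<ominus> e \<otimes> v i) w = dot R p (\<lambda>i. d \<otimes> u i \<oplus> (\<ominus> e) \<otimes> v i) w"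
    using assms by (intro V.lincomb_cong) (auto simp: a_minus_def l_minus)
  also have "\<dots> = d \<otimes> dot R p u w \<oplus> (\<ominus> e) \<otimes> dot R p v w"
    using assms by (subst V.lincomb_add) (auto simp: V.lincomb_smult)
  finally show ?thesis using assms by (simp add: a_minus_def l_minus)
qed

lemma dot_minus_right:
  assumes "d \<in> carrier R" "e \<in> carrier R" "\<And>i. i < p \<Longrightarrow> u i \<in> carrier R"
    "\<And>i. i < p \<Longrightarrow> v i \<in> carrier R" "\<And>i. i < p \<Longrightarrow> w i \<in> carrier R"
  shows "dot R p w (\<lambda>i. d \<otimes> u i \<ominus> e \<otimes> v i) = d \<otimes> dot R p w u \<ominus> e \<otimes> dot R p w v"
  using dot_minus_left[of d e p u v w] assms
  by (simp add: dot_comm[of p w "\<lambda>i. d \<otimes> u i \<ominus> e \<otimes> v i"] dot_comm[of p w u] dot_comm[of p w v])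

lemma dot_smult_right:
  assumes "d \<in> carrier R" "\<And>i. i < p \<Longrightarrow> u i \<in> carrier R" "\<And>i. i < p \<Longrightarrow> w i \<in> carrier R"
  shows "dot R p w (\<lambda>i. d \<otimes> u i) = d \<otimes> dot R p w u"
proof -
  interpret V: Module.module R "regular_module R" by (rule module_regular_module)
  show ?thesis
    using V.lincomb_smult[of d p u w] assms
    by (simp add: dot_comm[of p w "\<lambda>i. d \<otimes> u i"] dot_comm[of p w u])
qed

lemma dot_span:
  fixes p q :: nat
  assumes "\<And>j. j < q \<Longrightarrow> c j \<in> carrier R" "\<And>i j. i < p \<Longrightarrow> j < q \<Longrightarrow> r j i \<in> carrier R"
    "\<And>i. i < p \<Longrightarrow> w i \<in> carrier R" "\<And>j. j < q \<Longrightarrow> dot R p w (r j) = \<zero>"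
  shows "dot R p w (\<lambda>i. \<Oplus>j\<in>{..<q}. c j \<otimes> r j i) = \<zero>"
proof -
  interpret V: Module.module R "regular_module R" by (rule module_regular_module)
  have cl: "(\<Oplus>j\<in>{..<q}. c j \<otimes> r j i) \<in> carrier R" if "i < p" for i
    using assms(1,2) that by (intro finsum_closed) auto
  have "dot R p (\<lambda>i. \<Oplus>j\<in>{..<q}. c j \<otimes> r j i) w = \<zero>\<^bsub>regular_module R\<^esub>"
    using assms(1-3)
    by (intro V.lincomb_relations)
      (auto simp: assms(4) dot_comm[of p "r _" w])
  then show ?thesis using assms(3) cl by (simp add: dot_comm[of p w])
qed

lemma dot_unit:
  assumes "\<And>i. i < p \<Longrightarrow> v i \<in> carrier R" "k < p"
  shows "dot R p (\<lambda>i. if i = k then \<one> else \<zero>) v = v k"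
proof -
  interpret V: Module.module R "regular_module R" by (rule module_regular_module)
  have "dot R p (\<lambda>i. if i = k then \<one> else \<zero>) v =
      finsum (regular_module R) (\<lambda>i. if k = i then v i else \<zero>\<^bsub>regular_module R\<^esub>) {..<p}"
    unfolding lincomb_def using assms by (intro V.M.finsum_cong') auto
  also have "\<dots> = v k"
    using assms by (intro V.M.finsum_singleton) auto
  finally show ?thesis .
qed

end

text \<open>Over the fraction field this is the fact that a subspace is cut out by the functionals that
  vanish on it.\<close>

lemma (in domain) span_or_functional:
  fixes p q :: nat
  assumes "\<And>i j. i < p \<Longrightarrow> j < q \<Longrightarrow> m j i \<in> carrier R" "\<And>i. i < p \<Longrightarrow> a i \<in> carrier R"
  shows "(\<exists>d\<in>carrier R. d \<noteq> \<zero> \<and> (\<exists>c\<in>{..<q} \<rightarrow> carrier R. \<forall>i<p.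
            d \<otimes> a i = (\<Oplus>j\<in>{..<q}. c j \<otimes> m j i))) \<or>
         (\<exists>w\<in>{..<p} \<rightarrow> carrier R. (\<forall>j<q. dot R p w (m j) = \<zero>) \<and> dot R p w a \<noteq> \<zero>)"
    (is "?D q a")
proof -
  interpret V: Module.module R "regular_module R" by (rule module_regular_module)
  show ?thesis using assms
  proof (induct q arbitrary: a)
    case 0
    show ?case
    \<comment> \<open>The empty span is zero: either \<open>a\<close> is zero, or some coordinate
      function does not vanish on it.\<close>
    proof (cases "\<forall>i<p. a i = \<zero>")
      case True
      then have "\<forall>i<p. \<one> \<otimes> a i = (\<Oplus>j\<in>{..<0}. \<zero> \<otimes> m j i)" by simp
      then show ?thesis by (intro disjI1 bexI[of _ \<one>] conjI bexI[of _ "\<lambda>_. \<zero>"]) auto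
    next
      case False
      then obtain k where "k < p" "a k \<noteq> \<zero>" by blast
      with 0(2) show ?thesis
        by (intro disjI2 bexI[of _ "\<lambda>i. if i = k then \<one> else \<zero>"]) (auto simp: dot_unit)
    qed
  next
    case (Suc q)
    have m: "i < p \<Longrightarrow> j < q \<Longrightarrow> m j i \<in> carrier R" and mq: "i < p \<Longrightarrow> m q i \<in> carrier R"
      and a: "i < p \<Longrightarrow> a i \<in> carrier R" for i j
      using Suc.prems by auto
    have span_Suc: "(\<Oplus>j\<in>{..<Suc q}. (c(q := e)) j \<otimes> m j i) = e \<otimes> m q i \<oplus> (\<Oplus>j\<in>{..<q}. c j \<otimes> m j i)"
      if "i < p" "e \<in> carrier R" "c \<in> {..<q} \<rightarrow> carrier R" for c e i
    proof -
      have "(\<Oplus>j\<in>{..<q}. (c(q := e)) j \<otimes> m j i) = (\<Oplus>j\<in>{..<q}. c j \<otimes> m j i)"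
        using that m by (intro finsum_cong') auto
      moreover have "(\<Oplus>j\<in>{..<Suc q}. (c(q := e)) j \<otimes> m j i) =
          e \<otimes> m q i \<oplus> (\<Oplus>j\<in>{..<q}. (c(q := e)) j \<otimes> m j i)"
        unfolding lessThan_Suc using that m mq by (subst finsum_insert) (auto simp: Pi_iff)
      ultimately show ?thesis by simp
    qed
    have span_closed: "(\<Oplus>j\<in>{..<q}. c j \<otimes> m j i) \<in> carrier R" if "i < p" "c \<in> {..<q} \<rightarrow> carrier R" for c i
      using that m by (intro finsum_closed) auto
    have IH: "?D q b" if "\<And>i. i < p \<Longrightarrow> b i \<in> carrier R" for b
      by (rule Suc.hyps) (use m that in auto)
    \<comment> \<open>The alternative for the last vector decides the case: either a non-zero
      multiple of it lies in the span of the others, or some form vanishes on the others but not on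
      it.\<close>
    have "?D q (m q)" by (rule IH) (rule mq)
    then show ?case
    proof (elim disjE bexE conjE)
      fix d c assume d: "d \<in> carrier R" "d \<noteq> \<zero>" and c: "c \<in> {..<q} \<rightarrow> carrier R"
        and dm: "\<forall>i<p. d \<otimes> m q i = (\<Oplus>j\<in>{..<q}. c j \<otimes> m j i)"
      have "?D q a" by (rule IH) (rule a)
      then show ?thesis
      proof (elim disjE bexE conjE)
        fix d c assume d: "d \<in> carrier R" "d \<noteq> \<zero>" and c: "c \<in> {..<q} \<rightarrow> carrier R"
          and da: "\<forall>i<p. d \<otimes> a i = (\<Oplus>j\<in>{..<q}. c j \<otimes> m j i)"
        have "\<forall>i<p. d \<otimes> a i = (\<Oplus>j\<in>{..<Suc q}. (c(q := \<zero>)) j \<otimes> m j i)"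
          using c da mq span_closed by (simp add: span_Suc del: fun_upd_apply)
        moreover have "c(q := \<zero>) \<in> {..<Suc q} \<rightarrow> carrier R" using c by (auto simp: less_Suc_eq)
        ultimately show ?thesis using d by blast
      next
        fix w assume w: "w \<in> {..<p} \<rightarrow> carrier R" "\<forall>j<q. dot R p w (m j) = \<zero>" "dot R p w a \<noteq> \<zero>"
        \<comment> \<open>The form found for the first \<open>q\<close> vectors also kills the last
          one: a non-zero multiple of \<open>m q\<close> lies in their span, and there are no zero
          divisors.\<close>
        have "d \<otimes> dot R p w (m q) = dot R p w (\<lambda>i. d \<otimes> m q i)"
          using w d mq by (subst dot_smult_right) auto
        also have "\<dots> = dot R p w (\<lambda>i. \<Oplus>j\<in>{..<q}. c j \<otimes> m j i)"
          using w dm span_closed c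
          by (intro V.lincomb_cong) auto
        also have "\<dots> = \<zero>"
          using w c m by (intro dot_span) auto
        finally have "dot R p w (m q) = \<zero>"
          using d w mq integral[of d "dot R p w (m q)"] by (auto simp: Pi_iff)
        then show ?thesis using w by (intro disjI2 bexI[of _ w]) (auto simp: less_Suc_eq)
      qed
    next
      fix u assume u: "u \<in> {..<p} \<rightarrow> carrier R" "\<forall>j<q. dot R p u (m j) = \<zero>" "dot R p u (m q) \<noteq> \<zero>"
      define e where "e = dot R p u (m q)"
      define f where "f = dot R p u a"
      have ef: "e \<in> carrier R" "f \<in> carrier R" "e \<noteq> \<zero>"
        using u a mq by (auto simp: e_def f_def Pi_iff)
      \<comment> \<open>Fraction-free projection along \<open>m q\<close> onto the kernel of
        \<open>u\<close>: applying \<open>u\<close> gives e f - f e = 0.\<close>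
      let ?a = "\<lambda>i. e \<otimes> a i \<ominus> f \<otimes> m q i"
      have a': "i < p \<Longrightarrow> ?a i \<in> carrier R" for i using a mq ef by simp
      have "?D q ?a" by (rule IH) (rule a')
      then show ?thesis
      proof (elim disjE bexE conjE)
        fix d c assume d: "d \<in> carrier R" "d \<noteq> \<zero>" and c: "c \<in> {..<q} \<rightarrow> carrier R"
          and da: "\<forall>i<p. d \<otimes> ?a i = (\<Oplus>j\<in>{..<q}. c j \<otimes> m j i)"
        \<comment> \<open>Adding d f times \<open>m q\<close> to d times the projected vector gives
          d e times \<open>a\<close>.\<close>
        have "d \<otimes> e \<otimes> a i = (\<Oplus>j\<in>{..<Suc q}. (c(q := d \<otimes> f)) j \<otimes> m j i)" if "i < p" for i
        proof -
          have "(\<Oplus>j\<in>{..<Suc q}. (c(q := d \<otimes> f)) j \<otimes> m j i) = d \<otimes> f \<otimes> m q i \<oplus> d \<otimes> ?a i"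
            using that c d ef da by (simp add: span_Suc del: fun_upd_apply)
          also have "\<dots> = d \<otimes> e \<otimes> a i"
            using that d ef a mq by algebra
          finally show ?thesis by simp
        qed
        moreover have "d \<otimes> e \<noteq> \<zero>" using d ef integral by blast
        moreover have "c(q := d \<otimes> f) \<in> {..<Suc q} \<rightarrow> carrier R" using c d ef by (auto simp: less_Suc_eq)
        ultimately show ?thesis using d ef by (intro disjI1 bexI[of _ "d \<otimes> e"] conjI bexI) auto
      next
        fix w assume w: "w \<in> {..<p} \<rightarrow> carrier R" "\<forall>j<q. dot R p w (m j) = \<zero>" "dot R p w ?a \<noteq> \<zero>"
        define g where "g = dot R p w (m q)"
        have g: "g \<in> carrier R" using w mq by (auto simp: g_def Pi_iff)
        \<comment> \<open>The same correction on the dual side: \<open>?w\<close> kills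
          \<open>m q\<close> because e g - g e = 0, and its value on \<open>a\<close> is e w(a) - g
          f, which is w applied to \<open>?a\<close> and so non-zero.\<close>
        let ?w = "\<lambda>i. e \<otimes> w i \<ominus> g \<otimes> u i"
        have w': "?w \<in> {..<p} \<rightarrow> carrier R" using w(1) u(1) ef g by (auto simp: Pi_iff)
        have dot_w': "dot R p ?w v = e \<otimes> dot R p w v \<ominus> g \<otimes> dot R p u v"
          if "\<And>i. i < p \<Longrightarrow> v i \<in> carrier R" for v
          using that w(1) u(1) ef g by (intro dot_minus_left) auto
        have "dot R p ?w (m j) = \<zero>" if "j < q" for j
        proof -
          have "dot R p ?w (m j) = e \<otimes> \<zero> \<ominus> g \<otimes> \<zero>"
            using dot_w'[of "m j"] that m w(2) u(2) by simp
          then show ?thesis using ef g by (simp add: a_minus_def)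
        qed
        moreover have "dot R p ?w (m q) = \<zero>"
          using dot_w'[of "m q", folded e_def g_def, unfolded a_minus_def] mq ef g by (simp add: m_comm a_minus_def r_neg)
        moreover have "dot R p ?w a = dot R p w ?a"
        proof -
          have "dot R p w ?a = e \<otimes> dot R p w a \<ominus> f \<otimes> g"
            unfolding g_def using w(1) a mq ef by (intro dot_minus_right) auto
          then show ?thesis using dot_w'[of a, folded f_def] a ef g by (simp add: m_comm)
        qed
        ultimately show ?thesis using w(3) w' by (intro disjI2 bexI[of _ ?w]) (auto simp: less_Suc_eq)
      qed
    qed
  qed
qed

section \<open>Generators and functoriality of the tensor product\<close>

context base_change
begin

text \<open>Coefficients from \<open>R\<close> cross the tensor sign and act through \<phi>.\<close>

lemma pure_lincomb:
  assumes "a \<in> carrier A" "\<And>i. i < k \<Longrightarrow> b i \<in> carrier R" "\<And>i. i < k \<Longrightarrow> s i \<in> carrier M"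
  shows "pure a (lincomb M k b s) = lincomb P k (\<lambda>i. a \<otimes>\<^bsub>A\<^esub> \<phi> (b i)) (\<lambda>i. pure \<one>\<^bsub>A\<^esub> (s i))"
  using assms
  by (induct k)
    (simp_all add: pure_zero_r M.lincomb_Suc P.lincomb_Suc pure_add_r smult_pure pure_balanced)

lemma cls_sum:
  assumes "\<And>i. i < k \<Longrightarrow> a i \<in> carrier A" "\<And>i. i < k \<Longrightarrow> s i \<in> carrier M"
  shows "cls (\<Sum>i<k. frag_of (a i, s i)) = lincomb P k a (\<lambda>i. pure \<one>\<^bsub>A\<^esub> (s i))"
  using assms
proof (induct k)
  case (Suc k)
  have "(\<Sum>i<k. frag_of (a i, s i)) \<in> frags" using Suc.prems by (intro frags_sum) auto
  then have "cls (\<Sum>i<Suc k. frag_of (a i, s i)) = pure (a k) (s k) \<oplus>\<^bsub>P\<^esub> cls (\<Sum>i<k. frag_of (a i, s i))"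
    using Suc.prems by (simp add: pure_def add_cls add.commute)
  then show ?case using Suc by (simp add: P.lincomb_Suc smult_pure)
qed (simp add: zero_cls)

text \<open>Expanding the second factor of each elementary tensor in the generators of
  \<open>M\<close> and moving the coefficients across leaves only the tensors 1 \<otimes>
  s_i.\<close>

lemma pure_span:
  assumes gen: "\<And>i. i < k \<Longrightarrow> s i \<in> carrier M"
    "\<And>m. m \<in> carrier M \<Longrightarrow> \<exists>b\<in>{..<k} \<rightarrow> carrier R. m = lincomb M k b s"
    and x: "x \<in> carrier P"
  obtains a where "a \<in> {..<k} \<rightarrow> carrier A" "x = lincomb P k a (\<lambda>i. pure \<one>\<^bsub>A\<^esub> (s i))"
proof -
  let ?l = "\<lambda>a. lincomb P k a (\<lambda>i. pure \<one>\<^bsub>A\<^esub> (s i))"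
  from x obtain c where c: "c \<in> frags" "x = cls c" by (rule P_cases)
  from c(1) have "\<exists>a\<in>{..<k} \<rightarrow> carrier A. cls c = ?l a"
  proof (induct rule: frags_induct)
    case zero
    show ?case
      using gen(1) by (intro bexI[of _ "\<lambda>_. \<zero>\<^bsub>A\<^esub>"]) (auto simp: P.lincomb_zero zero_cls)
  next
    case (one a m)
    obtain b where b: "b \<in> {..<k} \<rightarrow> carrier R" "m = lincomb M k b s"
      using gen(2)[OF one(2)] by blast
    have "cls (frag_of (a, m)) = ?l (\<lambda>i. a \<otimes>\<^bsub>A\<^esub> \<phi> (b i))"
      using b one gen(1) pure_lincomb[of a k b s] by (auto simp: pure_def)
    then show ?case
      using b(1) one by (intro bexI[of _ "\<lambda>i. a \<otimes>\<^bsub>A\<^esub> \<phi> (b i)"]) (auto simp: Pi_iff)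
  next
    case (diff c d)
    then obtain a b where ab: "a \<in> {..<k} \<rightarrow> carrier A" "cls c = ?l a"
      "b \<in> {..<k} \<rightarrow> carrier A" "cls d = ?l b" by auto
    have e: "\<ominus>\<^bsub>A\<^esub> \<one>\<^bsub>A\<^esub> \<in> carrier A" by simp
    \<comment> \<open>Subtraction is written as adding the multiple by -1, so that the rules for
      sums and multiples of linear combinations apply.\<close>
    have "cls (c - d) = cls c \<oplus>\<^bsub>P\<^esub> (\<ominus>\<^bsub>A\<^esub> \<one>\<^bsub>A\<^esub>) \<odot>\<^bsub>P\<^esub> cls d"
    proof -
      have "cls (c - d) \<oplus>\<^bsub>P\<^esub> cls d = cls c"
        using diff(1,2) by (simp add: add_cls frags_diff)
      moreover have "(\<ominus>\<^bsub>A\<^esub> \<one>\<^bsub>A\<^esub>) \<odot>\<^bsub>P\<^esub> cls d = \<ominus>\<^bsub>P\<^esub> cls d"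
        using diff(2) by (simp add: P.smult_l_minus)
      ultimately show ?thesis
        using P.M.add.inv_solve_right[of "cls (c - d)" "cls c" "cls d"] diff(1,2)
        by (simp add: frags_diff)
    qed
    also have "\<dots> = ?l (\<lambda>i. a i \<oplus>\<^bsub>A\<^esub> (\<ominus>\<^bsub>A\<^esub> \<one>\<^bsub>A\<^esub>) \<otimes>\<^bsub>A\<^esub> b i)"
    proof -
      have "?l (\<lambda>i. (\<ominus>\<^bsub>A\<^esub> \<one>\<^bsub>A\<^esub>) \<otimes>\<^bsub>A\<^esub> b i) = (\<ominus>\<^bsub>A\<^esub> \<one>\<^bsub>A\<^esub>) \<odot>\<^bsub>P\<^esub> ?l b"
        using ab(3) gen(1) e by (intro P.lincomb_smult) auto
      moreover have "?l (\<lambda>i. a i \<oplus>\<^bsub>A\<^esub> (\<ominus>\<^bsub>A\<^esub> \<one>\<^bsub>A\<^esub>) \<otimes>\<^bsub>A\<^esub> b i) = ?l a \<oplus>\<^bsub>P\<^esub> ?l (\<lambda>i. (\<ominus>\<^bsub>A\<^esub> \<one>\<^bsub>A\<^esub>) \<otimes>\<^bsub>A\<^esub> b i)"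
        using ab(1,3) gen(1) e by (intro P.lincomb_add) auto
      ultimately show ?thesis using ab by simp
    qed
    finally show ?case
      using ab(1,3) e by (intro bexI[of _ "\<lambda>i. a i \<oplus>\<^bsub>A\<^esub> (\<ominus>\<^bsub>A\<^esub> \<one>\<^bsub>A\<^esub>) \<otimes>\<^bsub>A\<^esub> b i"]) (auto simp: Pi_iff)
  qed
  with c that show thesis by blast
qed

text \<open>The torsion side of the alternative: relations among the \<open>s i\<close> become
  relations among the tensors 1 \<otimes> s_i after applying \<phi>, so every vector in their span
  represents zero.\<close>

lemma relation_span_annihilates:
  fixes p q :: nat
  assumes s: "\<And>i. i < p \<Longrightarrow> s i \<in> carrier M"
    and r: "\<And>i j. i < p \<Longrightarrow> j < q \<Longrightarrow> r j i \<in> carrier R" "\<And>j. j < q \<Longrightarrow> lincomb M p (r j) s = \<zero>\<^bsub>M\<^esub>"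
    and d: "d \<in> carrier A" and c: "c \<in> {..<q} \<rightarrow> carrier A" and a: "\<And>i. i < p \<Longrightarrow> a i \<in> carrier A"
    and eq: "\<And>i. i < p \<Longrightarrow> d \<otimes>\<^bsub>A\<^esub> a i = (\<Oplus>\<^bsub>A\<^esub>j\<in>{..<q}. c j \<otimes>\<^bsub>A\<^esub> \<phi> (r j i))"
  shows "d \<odot>\<^bsub>P\<^esub> lincomb P p a (\<lambda>i. pure \<one>\<^bsub>A\<^esub> (s i)) = \<zero>\<^bsub>P\<^esub>"
proof -
  have ps: "pure \<one>\<^bsub>A\<^esub> (s i) \<in> carrier P" if "i < p" for i using s that by simp
  have "lincomb P p (\<lambda>i. \<phi> (r j i)) (\<lambda>i. pure \<one>\<^bsub>A\<^esub> (s i)) = \<zero>\<^bsub>P\<^esub>" if "j < q" for j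
  proof -
    have "lincomb P p (\<lambda>i. \<phi> (r j i)) (\<lambda>i. pure \<one>\<^bsub>A\<^esub> (s i)) =
        lincomb P p (\<lambda>i. \<one>\<^bsub>A\<^esub> \<otimes>\<^bsub>A\<^esub> \<phi> (r j i)) (\<lambda>i. pure \<one>\<^bsub>A\<^esub> (s i))"
      using r(1) that ps by (intro P.lincomb_cong) auto
    also have "\<dots> = pure \<one>\<^bsub>A\<^esub> (lincomb M p (r j) s)"
      using r(1) that s by (intro pure_lincomb[symmetric]) auto
    finally show ?thesis using r(2) that by (simp add: pure_zero_r)
  qed
  then have "lincomb P p (\<lambda>i. \<Oplus>\<^bsub>A\<^esub>j\<in>{..<q}. c j \<otimes>\<^bsub>A\<^esub> \<phi> (r j i)) (\<lambda>i. pure \<one>\<^bsub>A\<^esub> (s i)) = \<zero>\<^bsub>P\<^esub>"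
    using c r(1) ps by (intro P.lincomb_relations) auto
  moreover have "d \<odot>\<^bsub>P\<^esub> lincomb P p a (\<lambda>i. pure \<one>\<^bsub>A\<^esub> (s i)) =
      lincomb P p (\<lambda>i. d \<otimes>\<^bsub>A\<^esub> a i) (\<lambda>i. pure \<one>\<^bsub>A\<^esub> (s i))"
    using d a ps by (intro P.lincomb_smult[symmetric]) auto
  moreover have "\<dots> = lincomb P p (\<lambda>i. \<Oplus>\<^bsub>A\<^esub>j\<in>{..<q}. c j \<otimes>\<^bsub>A\<^esub> \<phi> (r j i)) (\<lambda>i. pure \<one>\<^bsub>A\<^esub> (s i))"
    using eq ps c r(1) by (intro P.lincomb_cong) (auto intro!: A.finsum_closed)
  ultimately show ?thesis by simp
qed

end

section \<open>The map id \<otimes> h\<close>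

locale base_change_map = linear_map_modules R M N h +
    M: base_change R \<phi> A M + N: base_change R \<phi> A N
  for R :: "('r, 'c) ring_scheme" and \<phi> :: "'r \<Rightarrow> 'a" and A :: "('a, 'd) ring_scheme"
    and M :: "('r, 'm, 'e) module_scheme" and N :: "('r, 'n, 'f) module_scheme" and h
begin

abbreviation "ext \<equiv> frag_extend (\<lambda>(a, m). frag_of (a, h m))"

lemma ext_frags: "c \<in> M.frags \<Longrightarrow> ext c \<in> N.frags"
  by (erule M.frag_extend_frags) (auto intro: N.frags_diff)

text \<open>Linearity of \<open>h\<close> takes each generating relation to one of the same
  family.\<close>

lemma ext_rels: "c \<in> M.rels \<Longrightarrow> ext c \<in> N.rels"
  by (induct rule: M.rels_induct)
    (auto simp: frag_extend_diff h_add h_smult N.rels_diff N.rels_gen)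

lemma tensor_map_cls: "tensor_map R \<phi> A N h (M.cls c) = N.cls (ext c)"
  unfolding tensor_map_def by (rule M.Union_cls[OF N.base_change_axioms ext_rels])

lemma ext_fscale:
  assumes "a \<in> carrier A" "c \<in> M.frags"
  shows "ext (M.fscale a c) = N.fscale a (ext c)"
  using assms(2) by (induct rule: M.frags_induct) (auto simp: frag_extend_diff)

lemma linear_tensor_map: "linear_map A M.P N.P (tensor_map R \<phi> A N h)"
  unfolding linear_map_def M.carrier_P
  by (auto simp: tensor_map_cls ext_frags M.add_cls N.add_cls M.smult_cls N.smult_cls ext_fscale frag_extend_add)

text \<open>A preimage can be chosen for the second entry of each pair, so the map of formal sums is
  onto even before passing to classes.\<close>

lemma surj_tensor_map:
  assumes "h ` carrier M = carrier N"
  shows "tensor_map R \<phi> A N h ` carrier M.P = carrier N.P"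
proof
  show "tensor_map R \<phi> A N h ` carrier M.P \<subseteq> carrier N.P"
    using linear_mapD(1)[OF linear_tensor_map] by blast
  have "\<exists>d\<in>M.frags. ext d = c" if "c \<in> N.frags" for c
    using that
  proof (induct rule: N.frags_induct)
    case zero
    show ?case by (rule bexI[of _ 0]) auto
  next
    case (one a n)
    then obtain m where "m \<in> carrier M" "n = h m" using assms by blast
    with one show ?case by (intro bexI[of _ "frag_of (a, m)"]) auto
  next
    case (diff c d)
    then obtain c' d' where "c' \<in> M.frags" "d' \<in> M.frags" "ext c' = c" "ext d' = d" by blast
    then show ?case by (intro bexI[of _ "c' - d'"]) (auto simp: frag_extend_diff M.frags_diff)
  qed
  then show "carrier N.P \<subseteq> tensor_map R \<phi> A N h ` carrier M.P"
    by (force simp: M.carrier_P N.carrier_P tensor_map_cls image_iff)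
qed

lemma tensor_map_pure: "tensor_map R \<phi> A N h (M.pure a m) = N.pure a (h m)"
  by (simp add: M.pure_def N.pure_def tensor_map_cls)

end

section \<open>Sections near a point\<close>

text \<open>A stand-in for germs of sections: the function is defined on the whole type and only its
  restriction to some neighbourhood matters. Finitely many such functions, and conditions on them,
  can then be combined through the filter \<open>nhdsin X x\<close> without tracking
  domains.\<close>

definition section_near :: "'x topology \<Rightarrow> ('x, 'k, 'a) sheaf_data \<Rightarrow> 'x \<Rightarrow> ('x \<Rightarrow> 'a) \<Rightarrow> bool" where
  "section_near X F x s \<longleftrightarrow> (\<exists>U. openin X U \<and> x \<in> U \<and> restrict s U \<in> sections F U)"

lemma section_nearI:
  "openin X U \<Longrightarrow> x \<in> U \<Longrightarrow> restrict s U \<in> sections F U \<Longrightarrow> section_near X F x s"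
  by (auto simp: section_near_def)

lemma section_nearE:
  assumes "section_near X F x s"
  obtains U where "openin X U" "x \<in> U" "restrict s U \<in> sections F U"
  using assms by (auto simp: section_near_def)

lemma eventually_nhdsinE:
  assumes "eventually Q (nhdsin X x)" "x \<in> topspace X"
  obtains U where "openin X U" "x \<in> U" "\<And>z. z \<in> U \<Longrightarrow> Q z"
  using assms by (auto simp: eventually_nhdsin)

lemma eventually_nhdsinI:
  "openin X U \<Longrightarrow> x \<in> U \<Longrightarrow> (\<And>z. z \<in> U \<Longrightarrow> Q z) \<Longrightarrow> eventually Q (nhdsin X x)"
  by (auto simp: eventually_nhdsin)

lemma eventually_nhdsin_topspace: "eventually (\<lambda>z. z \<in> topspace X) (nhdsin X x)"
  by (auto simp: eventually_nhdsin)

lemma eventually_nhdsin_compose: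
  assumes f: "continuous_map Y X f" and y: "y \<in> topspace Y" and Q: "eventually Q (nhdsin X (f y))"
  shows "eventually (\<lambda>z. Q (f z)) (nhdsin Y y)"
proof -
  have "f y \<in> topspace X" using f y continuous_map_image_subset_topspace by fastforce
  with Q obtain U where U: "openin X U" "f y \<in> U" "\<And>x. x \<in> U \<Longrightarrow> Q x"
    by (rule eventually_nhdsinE) blast
  have "openin Y {z \<in> topspace Y. f z \<in> U}"
    using f U(1) by (rule openin_continuous_map_preimage)
  then show ?thesis
    by (rule eventually_nhdsinI) (use U y in auto)
qed

context sheaf
begin

lemma section_near_restrict:
  assumes "section_near X F x s"
  obtains U where "openin X U" "x \<in> U"
    "\<And>V. openin X V \<Longrightarrow> V \<subseteq> U \<Longrightarrow> restrict s V \<in> sections F V"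
proof -
  from assms obtain U where U: "openin X U" "x \<in> U" "restrict s U \<in> sections F U"
    by (rule section_nearE)
  have "restrict s V \<in> sections F V" if "openin X V" "V \<subseteq> U" for V
    using restriction[OF U(1) that U(3)] that by (simp add: Int_absorb1)
  with U that show thesis by blast
qed

lemma section_near_common:
  assumes "section_near X F x s" "eventually Q (nhdsin X x)"
  obtains U where "openin X U" "x \<in> U" "\<And>z. z \<in> U \<Longrightarrow> Q z"
    "\<And>V. openin X V \<Longrightarrow> V \<subseteq> U \<Longrightarrow> restrict s V \<in> sections F V"
proof -
  from assms(1) obtain U where U: "openin X U" "x \<in> U"
    "\<And>V. openin X V \<Longrightarrow> V \<subseteq> U \<Longrightarrow> restrict s V \<in> sections F V"
    by (rule section_near_restrict) blast
  then have "x \<in> topspace X" using openin_subset by blast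
  with assms(2) obtain W where W: "openin X W" "x \<in> W" "\<And>z. z \<in> W \<Longrightarrow> Q z"
    by (rule eventually_nhdsinE) blast
  show thesis
    by (rule that[of "U \<inter> W"]) (use U W in auto)
qed

lemma section_near_carrier:
  assumes "section_near X F x s"
  shows "eventually (\<lambda>z. s z \<in> carrier (stalk F z)) (nhdsin X x)"
proof -
  from assms obtain U where U: "openin X U" "x \<in> U" "restrict s U \<in> sections F U"
    by (rule section_nearE)
  with sections_subset[OF U(1)] have "s z \<in> carrier (stalk F z)" if "z \<in> U" for z
    using that by (auto simp: PiE_iff)
  with U show ?thesis by (intro eventually_nhdsinI)
qed

lemma section_near_cong:
  assumes "section_near X F x s" "eventually (\<lambda>z. s z = t z) (nhdsin X x)"
  shows "section_near X F x t"
proof -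
  from assms obtain U where U: "openin X U" "x \<in> U" "\<And>z. z \<in> U \<Longrightarrow> s z = t z"
    "\<And>V. openin X V \<Longrightarrow> V \<subseteq> U \<Longrightarrow> restrict s V \<in> sections F V"
    by (rule section_near_common) blast
  have "restrict s U = restrict t U" using U(3) by (auto simp: restrict_def)
  with U(1,2) U(4)[of U] show ?thesis by (intro section_nearI) auto
qed

text \<open>The sheaf axiom on equal germs in filter form; it carries identities at a point to a
  neighbourhood.\<close>

lemma section_near_eq:
  assumes "section_near X F x s" "section_near X F x t" "s x = t x"
  shows "eventually (\<lambda>z. s z = t z) (nhdsin X x)"
proof -
  from assms(1) obtain U where U: "openin X U" "x \<in> U"
    "\<And>V. openin X V \<Longrightarrow> V \<subseteq> U \<Longrightarrow> restrict s V \<in> sections F V"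
    by (rule section_near_restrict) blast
  from assms(2) obtain V where V: "openin X V" "x \<in> V"
    "\<And>W. openin X W \<Longrightarrow> W \<subseteq> V \<Longrightarrow> restrict t W \<in> sections F W"
    by (rule section_near_restrict) blast
  have UV: "openin X (U \<inter> V)" using U V by auto
  have "restrict s (U \<inter> V) \<in> sections F (U \<inter> V)" "restrict t (U \<inter> V) \<in> sections F (U \<inter> V)"
    using U(3)[OF UV] V(3)[OF UV] by blast+
  then obtain W where W: "openin X W" "x \<in> W" "W \<subseteq> U \<inter> V"
    "\<And>z. z \<in> W \<Longrightarrow> restrict s (U \<inter> V) z = restrict t (U \<inter> V) z"
    using germ_eq_imp_locally_eq[of "U \<inter> V" x "restrict s (U \<inter> V)" "restrict t (U \<inter> V)"]
      UV U(2) V(2) assms(3) by (force simp del: restrict_apply simp: restrict_apply')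
  have "s z = t z" if "z \<in> W" for z
    using W(3) W(4)[OF that] that by (auto split: if_splits)
  with W show ?thesis by (intro eventually_nhdsinI)
qed

lemma section_near_section:
  assumes "openin X U" "x \<in> U" "s \<in> sections F U"
  shows "section_near X F x s"
proof -
  have "restrict s U = s"
    using sections_subset[OF assms(1)] assms(3) by (intro extensional_restrict) (auto simp: PiE_iff)
  with assms show ?thesis by (intro section_nearI) auto
qed

lemma germ_section:
  assumes "x \<in> topspace X" "a \<in> carrier (stalk F x)"
  shows "\<exists>s. s x = a \<and> section_near X F x s"
  using germ_extends[OF assms] section_near_section by blast

text \<open>Meant for choosing a representative of every germ at a point simultaneously. Infinitely
  many germs need not have a common neighbourhood on which all representatives live, so the values
  are made to lie in the stalks everywhere.\<close>

lemma germ_section_total: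
  assumes "\<And>z. z \<in> topspace X \<Longrightarrow> carrier (stalk F z) \<noteq> {}"
    and "x \<in> topspace X" "a \<in> carrier (stalk F x)"
  shows "\<exists>s. s x = a \<and> section_near X F x s \<and> (\<forall>z\<in>topspace X. s z \<in> carrier (stalk F z))"
proof -
  obtain s where s: "s x = a" "section_near X F x s"
    using germ_section[OF assms(2,3)] by blast
  \<comment> \<open>Where \<open>s\<close> leaves the stalk, any element of the stalk will do; near
    \<open>x\<close> nothing changes.\<close>
  define t where "t z = (if s z \<in> carrier (stalk F z) then s z else (SOME b. b \<in> carrier (stalk F z)))" for z
  have "section_near X F x t"
    using s(2) by (rule section_near_cong)
      (use section_near_carrier[OF s(2)] in \<open>auto simp: t_def elim: eventually_mono\<close>)
  moreover have "t z \<in> carrier (stalk F z)" if "z \<in> topspace X" for z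
    using assms(1)[OF that] by (auto simp: t_def some_in_eq)
  ultimately show ?thesis using s assms(3) by (intro exI[of _ t]) (auto simp: t_def)
qed

end

context module_sheaf
begin

lemma section_near_zero: "x \<in> topspace X \<Longrightarrow> section_near X F x (\<lambda>z. \<zero>\<^bsub>stalk F z\<^esub>)"
  using zero_section[of "topspace X"] by (intro section_nearI[of X "topspace X"]) auto

lemma section_near_add:
  assumes "section_near X F x s" "section_near X F x t"
  shows "section_near X F x (\<lambda>z. s z \<oplus>\<^bsub>stalk F z\<^esub> t z)"
proof -
  from assms(1) obtain U where U: "openin X U" "x \<in> U"
    "\<And>V. openin X V \<Longrightarrow> V \<subseteq> U \<Longrightarrow> restrict s V \<in> sections F V"
    by (rule section_near_restrict) blast
  from assms(2) obtain V where V: "openin X V" "x \<in> V"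
    "\<And>W. openin X W \<Longrightarrow> W \<subseteq> V \<Longrightarrow> restrict t W \<in> sections F W"
    by (rule section_near_restrict) blast
  have UV: "openin X (U \<inter> V)" using U V by auto
  have "(\<lambda>z\<in>U \<inter> V. restrict s (U \<inter> V) z \<oplus>\<^bsub>stalk F z\<^esub> restrict t (U \<inter> V) z) \<in> sections F (U \<inter> V)"
    using UV U(3)[OF UV] V(3)[OF UV] by (intro add_section) blast+
  also have "(\<lambda>z\<in>U \<inter> V. restrict s (U \<inter> V) z \<oplus>\<^bsub>stalk F z\<^esub> restrict t (U \<inter> V) z) =
      restrict (\<lambda>z. s z \<oplus>\<^bsub>stalk F z\<^esub> t z) (U \<inter> V)" by (auto simp: restrict_def)
  finally show ?thesis using UV U V by (intro section_nearI[of X "U \<inter> V"]) blast+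
qed

lemma section_near_smult:
  assumes "sheaf X O\<^sub>X" "section_near X O\<^sub>X x a" "section_near X F x s"
  shows "section_near X F x (\<lambda>z. a z \<odot>\<^bsub>stalk F z\<^esub> s z)"
proof -
  from sheaf.section_near_restrict[OF assms(1,2)] obtain U where U: "openin X U" "x \<in> U"
    "\<And>V. openin X V \<Longrightarrow> V \<subseteq> U \<Longrightarrow> restrict a V \<in> sections O\<^sub>X V"
    by blast
  from assms(3) obtain V where V: "openin X V" "x \<in> V"
    "\<And>W. openin X W \<Longrightarrow> W \<subseteq> V \<Longrightarrow> restrict s W \<in> sections F W"
    by (rule section_near_restrict) blast
  have UV: "openin X (U \<inter> V)" using U V by auto
  have "(\<lambda>z\<in>U \<inter> V. restrict a (U \<inter> V) z \<odot>\<^bsub>stalk F z\<^esub> restrict s (U \<inter> V) z) \<in> sections F (U \<inter> V)"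
    using UV U(3)[OF UV] V(3)[OF UV] by (intro smult_section) blast+
  also have "(\<lambda>z\<in>U \<inter> V. restrict a (U \<inter> V) z \<odot>\<^bsub>stalk F z\<^esub> restrict s (U \<inter> V) z) =
      restrict (\<lambda>z. a z \<odot>\<^bsub>stalk F z\<^esub> s z) (U \<inter> V)" by (auto simp: restrict_def)
  finally show ?thesis using UV U V by (intro section_nearI[of X "U \<inter> V"]) blast+
qed

lemma section_near_lincomb:
  assumes "sheaf X O\<^sub>X" "x \<in> topspace X" "\<And>i. i < k \<Longrightarrow> section_near X O\<^sub>X x (a i)"
    "\<And>i. i < k \<Longrightarrow> section_near X F x (s i)"
  shows "section_near X F x (\<lambda>z. lincomb (stalk F z) k (\<lambda>i. a i z) (\<lambda>i. s i z))"
  using assms(3,4)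
proof (induct k)
  case 0
  show ?case
    by (rule section_near_cong[OF section_near_zero[OF assms(2)]],
        rule eventually_mono[OF eventually_nhdsin_topspace])
      (simp add: module.lincomb_0[OF stalk_module])
next
  case (Suc k)
  have near: "section_near X F x (\<lambda>z. a k z \<odot>\<^bsub>stalk F z\<^esub> s k z \<oplus>\<^bsub>stalk F z\<^esub>
      lincomb (stalk F z) k (\<lambda>i. a i z) (\<lambda>i. s i z))"
    using Suc assms(1) by (intro section_near_add section_near_smult) auto
  have "\<forall>\<^sub>F z in nhdsin X x. \<forall>i\<in>{..<Suc k}. a i z \<in> carrier (stalk O\<^sub>X z)"
    using sheaf.section_near_carrier[OF assms(1) Suc.prems(1)] by (intro eventually_ball_finite) auto
  moreover have "\<forall>\<^sub>F z in nhdsin X x. \<forall>i\<in>{..<Suc k}. s i z \<in> carrier (stalk F z)"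
    using section_near_carrier[OF Suc.prems(2)] by (intro eventually_ball_finite) auto
  ultimately have "\<forall>\<^sub>F z in nhdsin X x. a k z \<odot>\<^bsub>stalk F z\<^esub> s k z \<oplus>\<^bsub>stalk F z\<^esub>
      lincomb (stalk F z) k (\<lambda>i. a i z) (\<lambda>i. s i z) =
      lincomb (stalk F z) (Suc k) (\<lambda>i. a i z) (\<lambda>i. s i z)"
    using eventually_nhdsin_topspace[of X x]
  proof eventually_elim
    case (elim z)
    interpret Module.module "stalk O\<^sub>X z" "stalk F z" using elim(3) by (rule stalk_module)
    show ?case using elim(1,2) by (subst lincomb_Suc) auto
  qed
  with near show ?case by (rule section_near_cong)
qed

end

section \<open>The structure sheaf as a module over itself\<close>

definition regular_sheaf :: "('x, complex, 'a) sheaf_data \<Rightarrow> ('x, 'a, 'a) sheaf_data" where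
  "regular_sheaf \<O> = \<lparr>stalk = \<lambda>x. regular_module (stalk \<O> x), sections = sections \<O>\<rparr>"

lemma regular_sheaf_simps [simp]:
  "stalk (regular_sheaf \<O>) x = regular_module (stalk \<O> x)" "sections (regular_sheaf \<O>) = sections \<O>"
  by (simp_all add: regular_sheaf_def)

lemma section_near_regular_sheaf [simp]: "section_near X (regular_sheaf \<O>) = section_near X \<O>"
  by (simp add: section_near_def fun_eq_iff)

context ringed_space
begin

lemma stalk_cring: "x \<in> topspace X \<Longrightarrow> cring (stalk O\<^sub>X x)"
  using algebra.M_cring[OF stalk_algebra] .

lemma zero_section:
  assumes "openin X U"
  shows "(\<lambda>x\<in>U. \<zero>\<^bsub>stalk O\<^sub>X x\<^esub>) \<in> sections O\<^sub>X U"
proof -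
  \<comment> \<open>Zero is obtained as the complex multiple 0 of the unit section, since the axioms
    provide units and complex multiples.\<close>
  have "0 \<odot>\<^bsub>stalk O\<^sub>X x\<^esub> \<one>\<^bsub>stalk O\<^sub>X x\<^esub> = \<zero>\<^bsub>stalk O\<^sub>X x\<^esub>" if "x \<in> U" for x
  proof -
    have x: "x \<in> topspace X" using that assms openin_subset by blast
    interpret algebra complex_field "stalk O\<^sub>X x" using stalk_algebra[OF x] .
    show ?thesis using smult_l_null[of "\<one>\<^bsub>stalk O\<^sub>X x\<^esub>"] by simp
  qed
  then have "(\<lambda>x\<in>U. \<zero>\<^bsub>stalk O\<^sub>X x\<^esub>) = (\<lambda>x\<in>U. 0 \<odot>\<^bsub>stalk O\<^sub>X x\<^esub> (\<lambda>x\<in>U. \<one>\<^bsub>stalk O\<^sub>X x\<^esub>) x)"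
    by (auto simp: restrict_def)
  then show ?thesis
    using scale_section[OF assms one_section[OF assms], of 0] by simp
qed

lemma module_sheaf_regular: "module_sheaf X O\<^sub>X (regular_sheaf O\<^sub>X)"
proof (intro module_sheaf.intro sheaf.intro module_sheaf_axioms.intro)
  show "Module.module (stalk O\<^sub>X x) (stalk (regular_sheaf O\<^sub>X) x)" if "x \<in> topspace X" for x
    using cring.module_regular_module[OF stalk_cring] that by simp
qed (unfold regular_sheaf_simps regular_module_simps;
    fact sections_subset restriction gluing germ_extends germ_eq_imp_locally_eq zero_section
      add_section mult_section)+

lemma section_near_dot:
  assumes "x \<in> topspace X" "\<And>i. i < k \<Longrightarrow> section_near X O\<^sub>X x (a i)"
    "\<And>i. i < k \<Longrightarrow> section_near X O\<^sub>X x (s i)"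
  shows "section_near X O\<^sub>X x (\<lambda>z. dot (stalk O\<^sub>X z) k (\<lambda>i. a i z) (\<lambda>i. s i z))"
  using module_sheaf.section_near_lincomb[OF module_sheaf_regular sheaf_axioms, of x k a s] assms
  by simp

lemma section_near_mult:
  assumes "section_near X O\<^sub>X x s" "section_near X O\<^sub>X x t"
  shows "section_near X O\<^sub>X x (\<lambda>z. s z \<otimes>\<^bsub>stalk O\<^sub>X z\<^esub> t z)"
  using module_sheaf.section_near_smult[OF module_sheaf_regular sheaf_axioms, of x s t] assms
  by simp

lemma section_near_plus:
  assumes "section_near X O\<^sub>X x s" "section_near X O\<^sub>X x t"
  shows "section_near X O\<^sub>X x (\<lambda>z. s z \<oplus>\<^bsub>stalk O\<^sub>X z\<^esub> t z)"
  using module_sheaf.section_near_add[OF module_sheaf_regular, of x s t] assms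
  by simp

end

lemma section_near_comorphism:
  assumes "holomorphic_map Y O\<^sub>Y X O\<^sub>X f \<phi>" "y \<in> topspace Y" "section_near X O\<^sub>X (f y) s"
  shows "section_near Y O\<^sub>Y y (\<lambda>z. \<phi> z (s (f z)))"
proof -
  from assms(3) obtain U where U: "openin X U" "f y \<in> U" "restrict s U \<in> sections O\<^sub>X U"
    by (rule section_nearE)
  let ?V = "{y \<in> topspace Y. f y \<in> U}"
  have "(\<lambda>y\<in>?V. \<phi> y (restrict s U (f y))) \<in> sections O\<^sub>Y ?V"
    using assms(1) U unfolding holomorphic_map_def by blast
  moreover have "(\<lambda>y\<in>?V. \<phi> y (restrict s U (f y))) = restrict (\<lambda>z. \<phi> z (s (f z))) ?V"
    by (auto simp: restrict_def)
  moreover have "openin Y ?V"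
    using assms(1) U(1) by (auto simp: holomorphic_map_def intro: openin_continuous_map_preimage)
  ultimately show ?thesis using U assms(2) by (intro section_nearI[of Y ?V]) auto
qed

lemma section_near_morphism:
  assumes "sheaf_morphism X O\<^sub>X F G \<psi>" "section_near X F x s"
  shows "section_near X G x (\<lambda>z. \<psi> z (s z))"
proof -
  from assms(2) obtain U where U: "openin X U" "x \<in> U" "restrict s U \<in> sections F U"
    by (rule section_nearE)
  have "(\<lambda>x\<in>U. \<psi> x (restrict s U x)) \<in> sections G U"
    using assms(1) U unfolding sheaf_morphism_def by blast
  moreover have "(\<lambda>x\<in>U. \<psi> x (restrict s U x)) = restrict (\<lambda>z. \<psi> z (s z)) U"
    by (auto simp: restrict_def)
  ultimately show ?thesis using U by (intro section_nearI[of X U]) auto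
qed

section \<open>Spreading out relations\<close>

text \<open>Supplies the evaluation of formal sums of germs at a nearby point.\<close>

lemma (in Module.module) free_eval:
  assumes "f ` S \<subseteq> carrier M"
  shows "\<exists>h. h \<in> hom (free_Abelian_group S) (add_monoid M) \<and> (\<forall>x\<in>S. h (frag_of x) = f x)"
  by (rule comm_group.free_Abelian_group_universal[OF M.a_comm_group, of f S]) (use assms in auto)

text \<open>The form in which a proper modification enters the local argument: \<open>A\<close> is
  rare, and off \<open>A\<close> each comorphism \<open>\<phi> z\<close> has the inverse
  \<open>\<eta> z\<close>, indexed by the point of \<open>Y\<close> instead of its image.\<close>

locale modification = X: ringed_space X O\<^sub>X + Y: ringed_space Y O\<^sub>Y
  for X :: "'x topology" and O\<^sub>X :: "('x, complex, 'a) sheaf_data"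
    and Y :: "'y topology" and O\<^sub>Y :: "('y, complex, 'b) sheaf_data"
    and \<pi> :: "'y \<Rightarrow> 'x" and \<phi> :: "'y \<Rightarrow> 'a \<Rightarrow> 'b" and A :: "'y set" and \<eta> :: "'y \<Rightarrow> 'b \<Rightarrow> 'a" +
  assumes holomorphic: "holomorphic_map Y O\<^sub>Y X O\<^sub>X \<pi> \<phi>"
    and irreducible: "locally_irreducible Y O\<^sub>Y"
    and rare: "analytically_rare Y O\<^sub>Y A"
    and \<eta>_hom: "z \<in> topspace Y - A \<Longrightarrow> \<eta> z \<in> ring_hom (stalk O\<^sub>Y z) (stalk O\<^sub>X (\<pi> z))"
    and \<phi>_\<eta>: "z \<in> topspace Y - A \<Longrightarrow> b \<in> carrier (stalk O\<^sub>Y z) \<Longrightarrow> \<phi> z (\<eta> z b) = b"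
    and \<eta>_\<phi>: "z \<in> topspace Y - A \<Longrightarrow> a \<in> carrier (stalk O\<^sub>X (\<pi> z)) \<Longrightarrow> \<eta> z (\<phi> z a) = a"
begin

lemma \<pi>_topspace: "y \<in> topspace Y \<Longrightarrow> \<pi> y \<in> topspace X"
  using holomorphic by (auto simp: holomorphic_map_def dest: continuous_map_funspace)

lemma \<phi>_hom: "y \<in> topspace Y \<Longrightarrow> \<phi> y \<in> ring_hom (stalk O\<^sub>X (\<pi> y)) (stalk O\<^sub>Y y)"
  using holomorphic by (auto simp: holomorphic_map_def)

lemma \<pi>_continuous: "continuous_map Y X \<pi>"
  using holomorphic by (auto simp: holomorphic_map_def)

lemma base_change_stalk:
  assumes "module_sheaf X O\<^sub>X F" "y \<in> topspace Y"
  shows "base_change (stalk O\<^sub>X (\<pi> y)) (\<phi> y) (stalk O\<^sub>Y y) (stalk F (\<pi> y))"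
  using module_sheaf.stalk_module[OF assms(1) \<pi>_topspace[OF assms(2)]] Y.stalk_cring[OF assms(2)]
    \<phi>_hom[OF assms(2)]
  by (intro base_change.intro base_change_axioms.intro)

lemmas eventually_\<pi> = eventually_nhdsin_compose[OF \<pi>_continuous]

text \<open>A relation in the tensor product over \<open>y\<close> involves finitely many germs, so it persists near
  \<open>y\<close>; off \<open>A\<close> the tensor product with \<open>O\<^sub>Y\<close> is the stalk of the sheaf itself.\<close>

lemma relation_spreads:
  assumes G: "module_sheaf X O\<^sub>X G" and y: "y \<in> topspace Y"
    and \<alpha>: "\<And>i. i < k \<Longrightarrow> section_near Y O\<^sub>Y y (\<alpha> i)"
    and \<gamma>: "\<And>i. i < k \<Longrightarrow> section_near X G (\<pi> y) (\<gamma> i)"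
    and rel: "(\<Sum>i<k. frag_of (\<alpha> i y, \<gamma> i (\<pi> y))) \<in>
      tensor_relations (stalk O\<^sub>X (\<pi> y)) (\<phi> y) (stalk O\<^sub>Y y) (stalk G (\<pi> y))"
  shows "\<forall>\<^sub>F z in nhdsin Y y. z \<notin> A \<longrightarrow>
    lincomb (stalk G (\<pi> z)) k (\<lambda>i. \<eta> z (\<alpha> i z)) (\<lambda>i. \<gamma> i (\<pi> z)) = \<zero>\<^bsub>stalk G (\<pi> z)\<^esub>"
proof -
  interpret G: module_sheaf X O\<^sub>X G by (rule G)
  interpret T: base_change "stalk O\<^sub>X (\<pi> y)" "\<phi> y" "stalk O\<^sub>Y y" "stalk G (\<pi> y)"
    by (rule base_change_stalk[OF G y])
  note x = \<pi>_topspace[OF y]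
  \<comment> \<open>One section through each germ at \<open>y\<close>, fixed in advance: the
    relations that make up \<open>rel\<close> may involve germs other than those of the given
    sections.\<close>
  have "\<forall>a. \<exists>s. a \<in> carrier (stalk O\<^sub>Y y) \<longrightarrow> s y = a \<and> section_near Y O\<^sub>Y y s \<and> (\<forall>z\<in>topspace Y. s z \<in> carrier (stalk O\<^sub>Y z))"
    using Y.germ_section_total[OF _ y] cring.cring_simprules(2)[OF Y.stalk_cring] by blast
  then obtain e where e: "\<And>a. a \<in> carrier (stalk O\<^sub>Y y) \<Longrightarrow> e a y = a"
    "\<And>a. a \<in> carrier (stalk O\<^sub>Y y) \<Longrightarrow> section_near Y O\<^sub>Y y (e a)"
    "\<And>a z. a \<in> carrier (stalk O\<^sub>Y y) \<Longrightarrow> z \<in> topspace Y \<Longrightarrow> e a z \<in> carrier (stalk O\<^sub>Y z)"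
    by metis
  have "carrier (stalk G x) \<noteq> {}" if "x \<in> topspace X" for x
  proof -
    interpret Module.module "stalk O\<^sub>X x" "stalk G x" by (rule G.stalk_module[OF that])
    show ?thesis by auto
  qed
  then have "\<forall>m. \<exists>s. m \<in> carrier (stalk G (\<pi> y)) \<longrightarrow> s (\<pi> y) = m \<and> section_near X G (\<pi> y) s \<and> (\<forall>x\<in>topspace X. s x \<in> carrier (stalk G x))"
    using G.germ_section_total[OF _ x] by blast
  then obtain e' where e': "\<And>m. m \<in> carrier (stalk G (\<pi> y)) \<Longrightarrow> e' m (\<pi> y) = m"
    "\<And>m. m \<in> carrier (stalk G (\<pi> y)) \<Longrightarrow> section_near X G (\<pi> y) (e' m)"
    "\<And>m x. m \<in> carrier (stalk G (\<pi> y)) \<Longrightarrow> x \<in> topspace X \<Longrightarrow> e' m x \<in> carrier (stalk G x)"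
    by metis
  \<comment> \<open>The value of a pair of germs at \<open>z\<close>: spread both to
    \<open>z\<close>, then apply a \<otimes> m \<mapsto> \<eta>(a) m, which identifies the tensor
    product with the stalk of \<open>G\<close> because \<eta> inverts \<phi>.\<close>
  define f where "f z = (\<lambda>(a, m). \<eta> z (e a z) \<odot>\<^bsub>stalk G (\<pi> z)\<^esub> e' m (\<pi> z))" for z
  have \<eta>e: "\<eta> z (e a z) \<in> carrier (stalk O\<^sub>X (\<pi> z))"
    if "z \<in> topspace Y - A" "a \<in> carrier (stalk O\<^sub>Y y)" for z a
    using ring_hom_closed[OF \<eta>_hom[OF that(1)]] e(3) that by blast
  have mod: "Module.module (stalk O\<^sub>X (\<pi> z)) (stalk G (\<pi> z))" if "z \<in> topspace Y - A" for z
    using that by (intro G.stalk_module \<pi>_topspace) blast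
  have f_closed: "f z ` (carrier (stalk O\<^sub>Y y) \<times> carrier (stalk G (\<pi> y))) \<subseteq> carrier (stalk G (\<pi> z))"
    if "z \<in> topspace Y - A" for z
    using that by (auto simp: f_def intro!: module.smult_closed[OF mod] \<eta>e e'(3) \<pi>_topspace)
  \<comment> \<open>By the universal property this extends to formal sums. The extension need not
    kill all relations at a given \<open>z\<close>, as the chosen sections respect sums and products
    only near \<open>y\<close>.\<close>
  have "\<exists>h. z \<in> topspace Y - A \<longrightarrow>
      h \<in> hom (tensor_free (stalk O\<^sub>Y y) (stalk G (\<pi> y))) (add_monoid (stalk G (\<pi> z))) \<and>
      (\<forall>x\<in>carrier (stalk O\<^sub>Y y) \<times> carrier (stalk G (\<pi> y)). h (frag_of x) = f z x)" for z
  proof (cases "z \<in> topspace Y - A")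
    case True
    show ?thesis
      using module.free_eval[OF mod[OF True] f_closed[OF True]] unfolding tensor_free_def by blast
  qed blast
  then obtain H where H: "\<And>z. z \<in> topspace Y - A \<Longrightarrow>
      H z \<in> hom (tensor_free (stalk O\<^sub>Y y) (stalk G (\<pi> y))) (add_monoid (stalk G (\<pi> z)))"
    and H_f: "\<And>z x. z \<in> topspace Y - A \<Longrightarrow> x \<in> carrier (stalk O\<^sub>Y y) \<times> carrier (stalk G (\<pi> y)) \<Longrightarrow>
      H z (frag_of x) = f z x"
    by metis
  have H_closed: "H z c \<in> carrier (stalk G (\<pi> z))" if "z \<in> topspace Y - A" "c \<in> T.frags" for z c
    using hom_in_carrier[OF H[OF that(1)] that(2)] by simp
  have H_add: "H z (c + d) = H z c \<oplus>\<^bsub>stalk G (\<pi> z)\<^esub> H z d"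
    if "z \<in> topspace Y - A" "c \<in> T.frags" "d \<in> T.frags" for z c d
    using hom_mult[OF H[OF that(1)] that(2,3)] by (simp add: tensor_free_def)
  have H_diff: "H z (c - d) = \<zero>\<^bsub>stalk G (\<pi> z)\<^esub> \<longleftrightarrow> H z c = H z d"
    if z: "z \<in> topspace Y - A" and "c \<in> T.frags" "d \<in> T.frags" for z c d
  proof -
    interpret Module.module "stalk O\<^sub>X (\<pi> z)" "stalk G (\<pi> z)" by (rule mod[OF z])
    have "H z c = H z (c - d) \<oplus>\<^bsub>stalk G (\<pi> z)\<^esub> H z d"
      using H_add[OF z T.frags_diff[OF that(2,3)] that(3)] by simp
    then show ?thesis
      using H_closed[OF z T.frags_diff[OF that(2,3)]] H_closed[OF z that(3)] by auto
  qed
  have H_diff2: "H z (frag_of p - frag_of q - frag_of r) = \<zero>\<^bsub>stalk G (\<pi> z)\<^esub> \<longleftrightarrow>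
      f z p = f z q \<oplus>\<^bsub>stalk G (\<pi> z)\<^esub> f z r"
    if z: "z \<in> topspace Y - A" and "frag_of p \<in> T.frags" "frag_of q \<in> T.frags" "frag_of r \<in> T.frags" for z p q r
    unfolding diff_diff_eq
    using H_diff[OF z that(2) T.frags_add[OF that(3,4)]] H_add[OF z that(3,4)] H_f[OF z] that(2-)
    by (cases p; cases q; cases r) simp
  have eq_e: "\<forall>\<^sub>F z in nhdsin Y y. e a z = s z"
    if "a \<in> carrier (stalk O\<^sub>Y y)" "section_near Y O\<^sub>Y y s" "s y = a" for a s
    using that e by (intro Y.section_near_eq) auto
  have eq_e': "\<forall>\<^sub>F z in nhdsin Y y. e' m (\<pi> z) = s (\<pi> z)"
    if "m \<in> carrier (stalk G (\<pi> y))" "section_near X G (\<pi> y) s" "s (\<pi> y) = m" for m s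
    using that e' by (intro eventually_\<pi>[OF y] G.section_near_eq) auto
  have topY: "\<forall>\<^sub>F z in nhdsin Y y. z \<in> topspace Y" by (rule eventually_nhdsin_topspace)
  \<comment> \<open>The neighbourhood may depend on \<open>c\<close>. The difference step only
    intersects two neighbourhoods, so the eventual property passes from the generators to every
    relation.\<close>
  have vanish: "\<forall>\<^sub>F z in nhdsin Y y. z \<notin> A \<longrightarrow> H z c = \<zero>\<^bsub>stalk G (\<pi> z)\<^esub>" if "c \<in> T.rels" for c
    using that
  proof (induct rule: T.rels_induct)
    case zero
    show ?case using topY
    proof eventually_elim
      case (elim z)
      \<comment> \<open>With both arguments zero, \<open>H_diff\<close> says that
        \<open>H z 0\<close> is zero.\<close>
      then show ?case using H_diff[of z 0 0] by simp
    qed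
  next
    case (add_l a b m)
    \<comment> \<open>The section chosen for the sum and the sum of the chosen sections have the
      same germ at \<open>y\<close>, hence agree nearby. The other two families follow the same
      pattern.\<close>
    have "\<forall>\<^sub>F z in nhdsin Y y. e (a \<oplus>\<^bsub>stalk O\<^sub>Y y\<^esub> b) z = e a z \<oplus>\<^bsub>stalk O\<^sub>Y z\<^esub> e b z"
      using add_l e by (intro eq_e Y.section_near_plus) auto
    then show ?case using topY
    proof eventually_elim
      case (elim z)
      show ?case
      proof
        assume "z \<notin> A"
        with elim have z: "z \<in> topspace Y - A" by simp
        interpret Module.module "stalk O\<^sub>X (\<pi> z)" "stalk G (\<pi> z)" by (rule mod[OF z])
        show "H z (T.rel_add_l a b m) = \<zero>\<^bsub>stalk G (\<pi> z)\<^esub>"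
          using z add_l elim ring_hom_add[OF \<eta>_hom[OF z], of "e a z" "e b z"]
          by (subst H_diff2) (auto simp: f_def e(3) e'(3) \<pi>_topspace \<eta>e smult_l_distr)
      qed
    qed
  next
    case (add_r a m n)
    have "\<forall>\<^sub>F z in nhdsin Y y. e' (m \<oplus>\<^bsub>stalk G (\<pi> y)\<^esub> n) (\<pi> z) = e' m (\<pi> z) \<oplus>\<^bsub>stalk G (\<pi> z)\<^esub> e' n (\<pi> z)"
      using add_r e' by (intro eq_e' G.section_near_add) auto
    then show ?case using topY
    proof eventually_elim
      case (elim z)
      show ?case
      proof
        assume "z \<notin> A"
        with elim have z: "z \<in> topspace Y - A" by simp
        interpret Module.module "stalk O\<^sub>X (\<pi> z)" "stalk G (\<pi> z)" by (rule mod[OF z])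
        show "H z (T.rel_add_r a m n) = \<zero>\<^bsub>stalk G (\<pi> z)\<^esub>"
          using z add_r elim
          by (subst H_diff2) (auto simp: f_def e(3) e'(3) \<pi>_topspace \<eta>e smult_r_distr)
      qed
    qed
  next
    case (balanced a r m)
    \<comment> \<open>The scalar is spread out on \<open>X\<close>; its pullback under the
      comorphism then spreads out \<open>\<phi> y r\<close> on \<open>Y\<close>.\<close>
    obtain \<rho> where \<rho>: "\<rho> (\<pi> y) = r" "section_near X O\<^sub>X (\<pi> y) \<rho>"
      using X.germ_section[OF x balanced(2)] by blast
    have "\<forall>\<^sub>F z in nhdsin Y y. e (a \<otimes>\<^bsub>stalk O\<^sub>Y y\<^esub> \<phi> y r) z = e a z \<otimes>\<^bsub>stalk O\<^sub>Y z\<^esub> \<phi> z (\<rho> (\<pi> z))"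
      using balanced e \<rho> y by (intro eq_e Y.section_near_mult section_near_comorphism[OF holomorphic]) auto
    moreover have "\<forall>\<^sub>F z in nhdsin Y y. e' (r \<odot>\<^bsub>stalk G (\<pi> y)\<^esub> m) (\<pi> z) = \<rho> (\<pi> z) \<odot>\<^bsub>stalk G (\<pi> z)\<^esub> e' m (\<pi> z)"
      using balanced e' \<rho> by (intro eq_e' G.section_near_smult[OF X.sheaf_axioms]) auto
    moreover have "\<forall>\<^sub>F z in nhdsin Y y. \<rho> (\<pi> z) \<in> carrier (stalk O\<^sub>X (\<pi> z))"
      by (rule eventually_\<pi>[OF y X.section_near_carrier[OF \<rho>(2)]])
    ultimately show ?case using topY
    proof eventually_elim
      case (elim z)
      show ?case
      proof
        assume "z \<notin> A"
        with elim have z: "z \<in> topspace Y - A" by simp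
        interpret Module.module "stalk O\<^sub>X (\<pi> z)" "stalk G (\<pi> z)" by (rule mod[OF z])
        have "\<phi> z (\<rho> (\<pi> z)) \<in> carrier (stalk O\<^sub>Y z)"
          using ring_hom_closed[OF \<phi>_hom] elim by blast
        \<comment> \<open>Since \<eta> inverts \<phi>, the pulled back scalar turns into
          \<open>\<rho> (\<pi> z)\<close>, which acts on the stalk of \<open>G\<close>; this is the
          balancing relation after evaluation.\<close>
        then have "\<eta> z (e (a \<otimes>\<^bsub>stalk O\<^sub>Y y\<^esub> \<phi> y r) z) = \<eta> z (e a z) \<otimes>\<^bsub>stalk O\<^sub>X (\<pi> z)\<^esub> \<rho> (\<pi> z)"
          using elim z balanced ring_hom_mult[OF \<eta>_hom[OF z], of "e a z" "\<phi> z (\<rho> (\<pi> z))"]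
          by (simp add: e(3) \<eta>_\<phi>)
        then show "H z (T.rel_balanced a r m) = \<zero>\<^bsub>stalk G (\<pi> z)\<^esub>"
          using z balanced elim
          by (subst H_diff) (auto simp: H_f f_def e(3) e'(3) \<pi>_topspace \<eta>e smult_assoc1)
      qed
    qed
  next
    case (diff c d)
    from diff(3,4) topY show ?case
    proof eventually_elim
      case (elim z)
      then show ?case using H_diff[of z c d] diff(1,2) by auto
    qed
  qed
  have \<alpha>y: "\<alpha> i y \<in> carrier (stalk O\<^sub>Y y)" and \<gamma>x: "\<gamma> i (\<pi> y) \<in> carrier (stalk G (\<pi> y))" if "i < k" for i
    using Y.section_near_carrier[OF \<alpha>[OF that]] G.section_near_carrier[OF \<gamma>[OF that]] y x
    by (auto simp: eventually_nhdsin)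
  have H_sum: "H z (\<Sum>i<l. frag_of (\<alpha> i y, \<gamma> i (\<pi> y))) =
      lincomb (stalk G (\<pi> z)) l (\<lambda>i. \<eta> z (e (\<alpha> i y) z)) (\<lambda>i. e' (\<gamma> i (\<pi> y)) (\<pi> z))"
    if "l \<le> k" and z: "z \<in> topspace Y - A" for l z
    using that(1)
  proof (induct l)
    case 0
    interpret Module.module "stalk O\<^sub>X (\<pi> z)" "stalk G (\<pi> z)" by (rule mod[OF z])
    show ?case using H_diff[of z 0 0] z by simp
  next
    case (Suc l)
    interpret Module.module "stalk O\<^sub>X (\<pi> z)" "stalk G (\<pi> z)" by (rule mod[OF z])
    have fr: "frag_of (\<alpha> l y, \<gamma> l (\<pi> y)) \<in> T.frags" using Suc.prems \<alpha>y \<gamma>x by simp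
    have "(\<Sum>i<l. frag_of (\<alpha> i y, \<gamma> i (\<pi> y))) \<in> T.frags"
      using Suc.prems \<alpha>y \<gamma>x by (intro T.frags_sum) auto
    then have "H z (\<Sum>i<Suc l. frag_of (\<alpha> i y, \<gamma> i (\<pi> y))) = f z (\<alpha> l y, \<gamma> l (\<pi> y)) \<oplus>\<^bsub>stalk G (\<pi> z)\<^esub>
        H z (\<Sum>i<l. frag_of (\<alpha> i y, \<gamma> i (\<pi> y)))"
      using fr z H_f[OF z, of "(\<alpha> l y, \<gamma> l (\<pi> y))"] by (simp add: add.commute[of _ "frag_of _"] H_add)
    then show ?case
      using Suc z \<alpha>y \<gamma>x by (subst lincomb_Suc) (auto simp: f_def \<eta>e e'(3) \<pi>_topspace)
  qed
  \<comment> \<open>Near \<open>y\<close> the sections chosen through the germs can be exchanged for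
    the given ones, which have the same germs.\<close>
  have "\<forall>\<^sub>F z in nhdsin Y y. \<forall>i\<in>{..<k}. e (\<alpha> i y) z = \<alpha> i z"
    using \<alpha> \<alpha>y by (intro eventually_ball_finite ballI eq_e) auto
  moreover have "\<forall>\<^sub>F z in nhdsin Y y. \<forall>i\<in>{..<k}. e' (\<gamma> i (\<pi> y)) (\<pi> z) = \<gamma> i (\<pi> z)"
    using \<gamma> \<gamma>x by (intro eventually_ball_finite ballI eq_e') auto
  moreover note vanish[OF rel] topY
  ultimately show ?thesis
  proof eventually_elim
    case (elim z)
    show ?case
    proof
      assume "z \<notin> A"
      with elim have z: "z \<in> topspace Y - A" by simp
      interpret Module.module "stalk O\<^sub>X (\<pi> z)" "stalk G (\<pi> z)" by (rule mod[OF z])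
      have "lincomb (stalk G (\<pi> z)) k (\<lambda>i. \<eta> z (\<alpha> i z)) (\<lambda>i. \<gamma> i (\<pi> z)) =
          lincomb (stalk G (\<pi> z)) k (\<lambda>i. \<eta> z (e (\<alpha> i y) z)) (\<lambda>i. e' (\<gamma> i (\<pi> y)) (\<pi> z))"
      proof (rule lincomb_cong)
        fix i assume "i < k"
        then show "\<eta> z (e (\<alpha> i y) z) \<in> carrier (stalk O\<^sub>X (\<pi> z))"
          and "e' (\<gamma> i (\<pi> y)) (\<pi> z) \<in> carrier (stalk G (\<pi> z))"
          using z \<alpha>y \<gamma>x \<eta>e e'(3) \<pi>_topspace by blast+
      qed (use elim(1,2) in auto)
      also have "\<dots> = \<zero>\<^bsub>stalk G (\<pi> z)\<^esub>"
        using H_sum[OF order_refl z] elim(3) z by simp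
      finally show "lincomb (stalk G (\<pi> z)) k (\<lambda>i. \<eta> z (\<alpha> i z)) (\<lambda>i. \<gamma> i (\<pi> z)) = \<zero>\<^bsub>stalk G (\<pi> z)\<^esub>" .
    qed
  qed
qed

end

section \<open>Reflecting torsion\<close>

context modification
begin

text \<open>This is the stalkwise content of injectivity after dividing by torsion: by linearity it
  suffices that only torsion is sent into torsion.\<close>

lemma torsion_reflected:
  assumes F: "coherent_sheaf X O\<^sub>X F" and G: "module_sheaf X O\<^sub>X G"
    and mono: "sheaf_monomorphism X O\<^sub>X F G \<psi>" and y: "y \<in> topspace Y"
    and u: "u \<in> carrier (tensor_product (stalk O\<^sub>X (\<pi> y)) (\<phi> y) (stalk O\<^sub>Y y) (stalk F (\<pi> y)))"
    and tors: "tensor_map (stalk O\<^sub>X (\<pi> y)) (\<phi> y) (stalk O\<^sub>Y y) (stalk G (\<pi> y)) (\<psi> (\<pi> y)) u \<in>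
      torsion (stalk O\<^sub>Y y) (tensor_product (stalk O\<^sub>X (\<pi> y)) (\<phi> y) (stalk O\<^sub>Y y) (stalk G (\<pi> y)))"
  shows "u \<in> torsion (stalk O\<^sub>Y y) (tensor_product (stalk O\<^sub>X (\<pi> y)) (\<phi> y) (stalk O\<^sub>Y y) (stalk F (\<pi> y)))"
proof -
  have FF: "module_sheaf X O\<^sub>X F" "finite_type X O\<^sub>X F" "relation_finite_type X O\<^sub>X F"
    using F by (auto simp: coherent_sheaf_def)
  have \<psi>: "sheaf_morphism X O\<^sub>X F G \<psi>" using mono by (simp add: sheaf_monomorphism_def)
  interpret F: module_sheaf X O\<^sub>X F by (rule FF)
  interpret G: module_sheaf X O\<^sub>X G by (rule G)
  note x = \<pi>_topspace[OF y]
  have linear: "linear_map (stalk O\<^sub>X x) (stalk F x) (stalk G x) (\<psi> x)" if "x \<in> topspace X" for x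
    using \<psi> that by (simp add: sheaf_morphism_def)
  have modules: "linear_map_modules (stalk O\<^sub>X x) (stalk F x) (stalk G x) (\<psi> x)" if "x \<in> topspace X" for x
    by (intro linear_map_modules.intro linear_map_modules_axioms.intro F.stalk_module G.stalk_module linear that)
  interpret L: base_change_map "stalk O\<^sub>X (\<pi> y)" "\<phi> y" "stalk O\<^sub>Y y" "stalk F (\<pi> y)" "stalk G (\<pi> y)" "\<psi> (\<pi> y)"
    by (intro base_change_map.intro modules[OF x] base_change_stalk[OF FF(1) y] base_change_stalk[OF G y])
  interpret T: linear_map_modules "stalk O\<^sub>Y y" L.M.P L.N.P
    "tensor_map (stalk O\<^sub>X (\<pi> y)) (\<phi> y) (stalk O\<^sub>Y y) (stalk G (\<pi> y)) (\<psi> (\<pi> y))"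
    by (intro linear_map_modules.intro linear_map_modules_axioms.intro L.M.module_P L.N.module_P L.linear_tensor_map)
  interpret D: domain "stalk O\<^sub>Y y"
    using irreducible y by (simp add: locally_irreducible_def)

  from FF(2) x obtain U p s where U: "openin X U" "\<pi> y \<in> U" and s: "\<And>i. i < p \<Longrightarrow> s i \<in> sections F U"
    and gen: "\<And>x m. x \<in> U \<Longrightarrow> m \<in> carrier (stalk F x) \<Longrightarrow>
      \<exists>a\<in>{..<p} \<rightarrow> carrier (stalk O\<^sub>X x). m = lincomb (stalk F x) p a (\<lambda>i. s i x)"
    unfolding finite_type_def by metis
  have s_closed: "s i x \<in> carrier (stalk F x)" if "i < p" "x \<in> U" for i x
    using F.sections_subset[OF U(1)] s that by (auto simp: PiE_iff)
  have s_near: "section_near X F (\<pi> y) (s i)" if "i < p" for i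
    by (rule F.section_near_section[OF U s[OF that]])
  have "\<forall>i<p. s i \<in> sections F U" using s by blast
  note FF(3)[unfolded relation_finite_type_def, THEN spec, of U, THEN spec, of p, THEN spec, of s,
      THEN mp, OF U(1), THEN mp, OF this, THEN bspec, OF U(2)]
  then obtain V r and q :: nat where V: "openin X V" "\<pi> y \<in> V" "V \<subseteq> U"
    and r: "\<forall>j<q. \<forall>i<p. r j i \<in> sections O\<^sub>X V"
    and r_rel: "\<forall>x\<in>V. \<forall>j<q. lincomb (stalk F x) p (\<lambda>i. r j i x) (\<lambda>i. s i x) = \<zero>\<^bsub>stalk F x\<^esub>"
    and r_gen: "\<forall>x\<in>V. \<forall>a\<in>{..<p} \<rightarrow> carrier (stalk O\<^sub>X x).
      lincomb (stalk F x) p a (\<lambda>i. s i x) = \<zero>\<^bsub>stalk F x\<^esub> \<longrightarrow>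
      (\<exists>c\<in>{..<q} \<rightarrow> carrier (stalk O\<^sub>X x). \<forall>i<p.
        a i = finsum (stalk O\<^sub>X x) (\<lambda>j. c j \<otimes>\<^bsub>stalk O\<^sub>X x\<^esub> r j i x) {..<q})"
    by (elim exE conjE) (rule that; assumption)
  have r_closed: "r j i x \<in> carrier (stalk O\<^sub>X x)" if "i < p" "j < q" "x \<in> V" for i j x
    using X.sections_subset[OF V(1)] r[rule_format, OF that(2,1)] that(3) by (auto simp: PiE_iff)
  have r_near: "section_near X O\<^sub>X (\<pi> y) (r j i)" if "i < p" "j < q" for i j
    by (rule X.section_near_section[OF V(1,2) r[rule_format, OF that(2,1)]])

  obtain a where a: "a \<in> {..<p} \<rightarrow> carrier (stalk O\<^sub>Y y)"
    and u_a: "u = lincomb L.M.P p a (\<lambda>i. L.M.pure \<one>\<^bsub>stalk O\<^sub>Y y\<^esub> (s i (\<pi> y)))"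
    using L.M.pure_span[OF s_closed[OF _ U(2)] gen[OF U(2)] u] by blast
  \<comment> \<open>The pulled back relations present the stalk of the inverse image of
    \<open>F\<close>. A vector \<open>w\<close> orthogonal to all of them is a linear form on that
    stalk, and its pairing with \<open>a\<close> is its value at \<open>u\<close>.\<close>
  have "(\<exists>d\<in>carrier (stalk O\<^sub>Y y). d \<noteq> \<zero>\<^bsub>stalk O\<^sub>Y y\<^esub> \<and> (\<exists>c\<in>{..<q} \<rightarrow> carrier (stalk O\<^sub>Y y). \<forall>i<p.
        d \<otimes>\<^bsub>stalk O\<^sub>Y y\<^esub> a i = finsum (stalk O\<^sub>Y y) (\<lambda>j. c j \<otimes>\<^bsub>stalk O\<^sub>Y y\<^esub> \<phi> y (r j i (\<pi> y))) {..<q})) \<or>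
      (\<exists>w\<in>{..<p} \<rightarrow> carrier (stalk O\<^sub>Y y). (\<forall>j<q. dot (stalk O\<^sub>Y y) p w (\<lambda>i. \<phi> y (r j i (\<pi> y))) = \<zero>\<^bsub>stalk O\<^sub>Y y\<^esub>) \<and>
        dot (stalk O\<^sub>Y y) p w a \<noteq> \<zero>\<^bsub>stalk O\<^sub>Y y\<^esub>)"
    using a r_closed V(2) by (intro D.span_or_functional) auto
  then show ?thesis
  proof (elim disjE bexE conjE)
    fix d c assume d: "d \<in> carrier (stalk O\<^sub>Y y)" "d \<noteq> \<zero>\<^bsub>stalk O\<^sub>Y y\<^esub>" and c: "c \<in> {..<q} \<rightarrow> carrier (stalk O\<^sub>Y y)"
      and dc: "\<forall>i<p. d \<otimes>\<^bsub>stalk O\<^sub>Y y\<^esub> a i =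
        finsum (stalk O\<^sub>Y y) (\<lambda>j. c j \<otimes>\<^bsub>stalk O\<^sub>Y y\<^esub> \<phi> y (r j i (\<pi> y))) {..<q}"
    have "d \<odot>\<^bsub>L.M.P\<^esub> u = \<zero>\<^bsub>L.M.P\<^esub>"
      unfolding u_a using d c dc a r_closed[OF _ _ V(2)] s_closed[OF _ U(2)] r_rel[rule_format, OF V(2)]
      by (intro L.M.relation_span_annihilates[where r = "\<lambda>j i. r j i (\<pi> y)"]) auto
    then show ?thesis
      using d u D.integral by (intro torsionI[of _ _ d]) blast+
  next
    fix w assume w: "w \<in> {..<p} \<rightarrow> carrier (stalk O\<^sub>Y y)"
      and w_rel: "\<forall>j<q. dot (stalk O\<^sub>Y y) p w (\<lambda>i. \<phi> y (r j i (\<pi> y))) = \<zero>\<^bsub>stalk O\<^sub>Y y\<^esub>"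
      and w_a: "dot (stalk O\<^sub>Y y) p w a \<noteq> \<zero>\<^bsub>stalk O\<^sub>Y y\<^esub>"
    obtain t where t: "t \<in> carrier (stalk O\<^sub>Y y)"
      and t_reg: "\<forall>b\<in>carrier (stalk O\<^sub>Y y). t \<otimes>\<^bsub>stalk O\<^sub>Y y\<^esub> b = \<zero>\<^bsub>stalk O\<^sub>Y y\<^esub> \<longrightarrow> b = \<zero>\<^bsub>stalk O\<^sub>Y y\<^esub>"
      and t_u: "t \<odot>\<^bsub>L.N.P\<^esub> tensor_map (stalk O\<^sub>X (\<pi> y)) (\<phi> y) (stalk O\<^sub>Y y) (stalk G (\<pi> y)) (\<psi> (\<pi> y)) u = \<zero>\<^bsub>L.N.P\<^esub>"
      using tors by (auto simp: torsion_def)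
    have \<psi>s: "\<psi> (\<pi> y) (s i (\<pi> y)) \<in> carrier (stalk G (\<pi> y))" if "i < p" for i
      using s_closed[OF that U(2)] by simp
    obtain \<rho> where \<rho>: "\<rho> y = t" "section_near Y O\<^sub>Y y \<rho>"
      using Y.germ_section[OF y t] by blast
    have "\<forall>i. \<exists>e. i < p \<longrightarrow> e y = a i \<and> section_near Y O\<^sub>Y y e"
      using Y.germ_section[OF y] a by (auto simp: Pi_iff)
    then obtain \<alpha> where \<alpha>: "\<And>i. i < p \<Longrightarrow> \<alpha> i y = a i" "\<And>i. i < p \<Longrightarrow> section_near Y O\<^sub>Y y (\<alpha> i)" by metis
    have "\<forall>i. \<exists>e. i < p \<longrightarrow> e y = w i \<and> section_near Y O\<^sub>Y y e"
      using Y.germ_section[OF y] w by (auto simp: Pi_iff)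
    then obtain \<omega> where \<omega>: "\<And>i. i < p \<Longrightarrow> \<omega> i y = w i" "\<And>i. i < p \<Longrightarrow> section_near Y O\<^sub>Y y (\<omega> i)" by metis

    \<comment> \<open>Rewrites t times the image of \<open>u\<close> as the class of a formal sum of
      germs of sections, the shape that \<open>relation_spreads\<close> takes.\<close>
    have "L.N.cls (\<Sum>i<p. frag_of (t \<otimes>\<^bsub>stalk O\<^sub>Y y\<^esub> a i, \<psi> (\<pi> y) (s i (\<pi> y)))) =
        lincomb L.N.P p (\<lambda>i. t \<otimes>\<^bsub>stalk O\<^sub>Y y\<^esub> a i) (\<lambda>i. L.N.pure \<one>\<^bsub>stalk O\<^sub>Y y\<^esub> (\<psi> (\<pi> y) (s i (\<pi> y))))"
      using a t \<psi>s by (intro L.N.cls_sum) auto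
    also have "\<dots> = t \<odot>\<^bsub>L.N.P\<^esub> lincomb L.N.P p a (\<lambda>i. L.N.pure \<one>\<^bsub>stalk O\<^sub>Y y\<^esub> (\<psi> (\<pi> y) (s i (\<pi> y))))"
      using a t \<psi>s by (intro L.N.P.lincomb_smult) auto
    also have "lincomb L.N.P p a (\<lambda>i. L.N.pure \<one>\<^bsub>stalk O\<^sub>Y y\<^esub> (\<psi> (\<pi> y) (s i (\<pi> y)))) =
        tensor_map (stalk O\<^sub>X (\<pi> y)) (\<phi> y) (stalk O\<^sub>Y y) (stalk G (\<pi> y)) (\<psi> (\<pi> y)) u"
      unfolding u_a using a s_closed[OF _ U(2)]
      by (subst T.h_lincomb) (auto simp: L.tensor_map_pure)
    also note t_u
    finally have "(\<Sum>i<p. frag_of (t \<otimes>\<^bsub>stalk O\<^sub>Y y\<^esub> a i, \<psi> (\<pi> y) (s i (\<pi> y)))) \<in> L.N.rels"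
      by (simp add: L.N.cls_eq_zero_iff)
    then have rel: "(\<Sum>i<p. frag_of (\<rho> y \<otimes>\<^bsub>stalk O\<^sub>Y y\<^esub> \<alpha> i y, \<psi> (\<pi> y) (s i (\<pi> y)))) \<in> L.N.rels"
      using \<rho>(1) \<alpha>(1) by simp
    have vanish: "\<forall>\<^sub>F z in nhdsin Y y. z \<notin> A \<longrightarrow>
        lincomb (stalk G (\<pi> z)) p (\<lambda>i. \<eta> z (\<rho> z \<otimes>\<^bsub>stalk O\<^sub>Y z\<^esub> \<alpha> i z)) (\<lambda>i. \<psi> (\<pi> z) (s i (\<pi> z))) = \<zero>\<^bsub>stalk G (\<pi> z)\<^esub>"
    proof (rule relation_spreads[where \<alpha> = "\<lambda>i z. \<rho> z \<otimes>\<^bsub>stalk O\<^sub>Y z\<^esub> \<alpha> i z"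
          and \<gamma> = "\<lambda>i x. \<psi> x (s i x)", OF G y])
      show "section_near Y O\<^sub>Y y (\<lambda>z. \<rho> z \<otimes>\<^bsub>stalk O\<^sub>Y z\<^esub> \<alpha> i z)"
        and "section_near X G (\<pi> y) (\<lambda>x. \<psi> x (s i x))" if "i < p" for i
        using that \<rho>(2) \<alpha>(2) s_near by (auto intro: Y.section_near_mult section_near_morphism[OF \<psi>])
    qed (rule rel)

    have near: "section_near Y O\<^sub>Y y (\<lambda>z. dot (stalk O\<^sub>Y z) p (\<lambda>i. \<omega> i z) (\<lambda>i. \<phi> z (r j i (\<pi> z))))" if "j < q" for j
      using \<omega>(2) r_near that by (intro Y.section_near_dot y section_near_comorphism[OF holomorphic y])
    have "dot (stalk O\<^sub>Y y) p (\<lambda>i. \<omega> i y) (\<lambda>i. \<phi> y (r j i (\<pi> y))) = \<zero>\<^bsub>stalk O\<^sub>Y y\<^esub>" if "j < q" for j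
    proof -
      interpret V: Module.module "stalk O\<^sub>Y y" "regular_module (stalk O\<^sub>Y y)" by (rule cring.module_regular_module[OF Y.stalk_cring[OF y]])
      have "dot (stalk O\<^sub>Y y) p (\<lambda>i. \<omega> i y) (\<lambda>i. \<phi> y (r j i (\<pi> y))) = dot (stalk O\<^sub>Y y) p w (\<lambda>i. \<phi> y (r j i (\<pi> y)))"
        using \<omega>(1) w r_closed[OF _ that V(2)] by (intro V.lincomb_cong) auto
      then show ?thesis using w_rel that by simp
    qed
    \<comment> \<open>There are finitely many relations, so the orthogonality at \<open>y\<close>
      holds for all of them on one neighbourhood.\<close>
    then have kills: "\<forall>\<^sub>F z in nhdsin Y y. \<forall>j\<in>{..<q}.
        dot (stalk O\<^sub>Y z) p (\<lambda>i. \<omega> i z) (\<lambda>i. \<phi> z (r j i (\<pi> z))) = \<zero>\<^bsub>stalk O\<^sub>Y z\<^esub>"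
      using near module_sheaf.section_near_zero[OF Y.module_sheaf_regular y] by (intro eventually_ball_finite ballI Y.section_near_eq) auto

    \<comment> \<open>The section with germ t w(a) at \<open>y\<close>. Being a section of O_Y, it
      is within reach of rarity.\<close>
    define \<sigma> where "\<sigma> z = \<rho> z \<otimes>\<^bsub>stalk O\<^sub>Y z\<^esub> dot (stalk O\<^sub>Y z) p (\<lambda>i. \<omega> i z) (\<lambda>i. \<alpha> i z)" for z
    have \<sigma>_near: "section_near Y O\<^sub>Y y \<sigma>"
      unfolding \<sigma>_def using \<rho>(2) \<omega>(2) \<alpha>(2) by (intro Y.section_near_mult Y.section_near_dot y)
    have "\<forall>\<^sub>F z in nhdsin Y y. \<pi> z \<in> V"
      by (rule eventually_\<pi>[OF y eventually_nhdsinI[OF V(1,2)]])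
    moreover have "\<forall>\<^sub>F z in nhdsin Y y. \<forall>i\<in>{..<p}. \<alpha> i z \<in> carrier (stalk O\<^sub>Y z)"
      using Y.section_near_carrier[OF \<alpha>(2)] by (intro eventually_ball_finite) auto
    moreover have "\<forall>\<^sub>F z in nhdsin Y y. \<forall>i\<in>{..<p}. \<omega> i z \<in> carrier (stalk O\<^sub>Y z)"
      using Y.section_near_carrier[OF \<omega>(2)] by (intro eventually_ball_finite) auto
    moreover note Y.section_near_carrier[OF \<rho>(2)] vanish kills eventually_nhdsin_topspace[of Y y]
    ultimately have "\<forall>\<^sub>F z in nhdsin Y y. z \<notin> A \<longrightarrow> \<sigma> z = \<zero>\<^bsub>stalk O\<^sub>Y z\<^esub>"
    proof eventually_elim
      case (elim z)
      show ?case
      proof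
        assume "z \<notin> A"
        with elim have z: "z \<in> topspace Y - A" by simp
        note xz = \<pi>_topspace[OF elim(7)]
        interpret Z: cring "stalk O\<^sub>Y z" by (rule Y.stalk_cring[OF elim(7)])
        interpret V: Module.module "stalk O\<^sub>Y z" "regular_module (stalk O\<^sub>Y z)" by (rule Z.module_regular_module)
        interpret Lz: linear_map_modules "stalk O\<^sub>X (\<pi> z)" "stalk F (\<pi> z)" "stalk G (\<pi> z)" "\<psi> (\<pi> z)"
          by (rule modules[OF xz])
        interpret hz: ring_hom_cring "stalk O\<^sub>X (\<pi> z)" "stalk O\<^sub>Y z" "\<phi> z"
          by (intro ring_hom_cring.intro ring_hom_cring_axioms.intro X.stalk_cring[OF xz] Z.is_cring \<phi>_hom[OF elim(7)])
        have \<rho>\<alpha>: "\<rho> z \<otimes>\<^bsub>stalk O\<^sub>Y z\<^esub> \<alpha> i z \<in> carrier (stalk O\<^sub>Y z)" if "i < p" for i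
          using elim(2,4) that by simp
        have \<eta>\<rho>\<alpha>: "\<eta> z (\<rho> z \<otimes>\<^bsub>stalk O\<^sub>Y z\<^esub> \<alpha> i z) \<in> carrier (stalk O\<^sub>X (\<pi> z))" if "i < p" for i
          by (rule ring_hom_closed[OF \<eta>_hom[OF z] \<rho>\<alpha>[OF that]])
        have sz: "s i (\<pi> z) \<in> carrier (stalk F (\<pi> z))" if "i < p" for i
          using s_closed[OF that] elim(1) V(3) by blast
        let ?m = "lincomb (stalk F (\<pi> z)) p (\<lambda>i. \<eta> z (\<rho> z \<otimes>\<^bsub>stalk O\<^sub>Y z\<^esub> \<alpha> i z)) (\<lambda>i. s i (\<pi> z))"
        have m: "?m \<in> carrier (stalk F (\<pi> z))" using \<eta>\<rho>\<alpha> sz by simp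
        \<comment> \<open>The vanishing combination in \<open>G\<close> is the image of a
          combination of the generators of \<open>F\<close>, so injectivity of \<psi> at
          \<open>\<pi> z\<close> applies; no tensor product is left there.\<close>
        have "\<psi> (\<pi> z) ?m = \<zero>\<^bsub>stalk G (\<pi> z)\<^esub>"
          using elim(5) z \<eta>\<rho>\<alpha> sz by (simp add: Lz.h_lincomb)
        then have "\<psi> (\<pi> z) ?m = \<psi> (\<pi> z) \<zero>\<^bsub>stalk F (\<pi> z)\<^esub>" by simp
        moreover have "inj_on (\<psi> (\<pi> z)) (carrier (stalk F (\<pi> z)))"
          using mono xz by (simp add: sheaf_monomorphism_def)
        ultimately have "?m = \<zero>\<^bsub>stalk F (\<pi> z)\<^esub>"
          using m Lz.M.zero_closed by (blast dest: inj_onD)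
        \<comment> \<open>The \<open>r j\<close> generate the relations at every point of
          \<open>V\<close>, and it is at \<open>\<pi> z\<close>, not at \<open>\<pi> y\<close>, that
          this is used.\<close>
        then obtain c where c: "c \<in> {..<q} \<rightarrow> carrier (stalk O\<^sub>X (\<pi> z))"
          and c_eq: "\<And>i. i < p \<Longrightarrow> \<eta> z (\<rho> z \<otimes>\<^bsub>stalk O\<^sub>Y z\<^esub> \<alpha> i z) =
            finsum (stalk O\<^sub>X (\<pi> z)) (\<lambda>j. c j \<otimes>\<^bsub>stalk O\<^sub>X (\<pi> z)\<^esub> r j i (\<pi> z)) {..<q}"
          using r_gen[THEN bspec, OF elim(1), THEN bspec, of "\<lambda>i. \<eta> z (\<rho> z \<otimes>\<^bsub>stalk O\<^sub>Y z\<^esub> \<alpha> i z)"] \<eta>\<rho>\<alpha> by auto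
        have \<phi>c: "\<phi> z (c j) \<in> carrier (stalk O\<^sub>Y z)" if "j < q" for j using c that by auto
        have \<phi>r: "\<phi> z (r j i (\<pi> z)) \<in> carrier (stalk O\<^sub>Y z)" if "i < p" "j < q" for i j
          using r_closed[OF that elim(1)] by simp
        \<comment> \<open>Applying \<phi> undoes \<eta> and brings the combination back to O_Y, now
          with the pulled back relations as vectors.\<close>
        have expand: "\<rho> z \<otimes>\<^bsub>stalk O\<^sub>Y z\<^esub> \<alpha> i z =
            finsum (stalk O\<^sub>Y z) (\<lambda>j. \<phi> z (c j) \<otimes>\<^bsub>stalk O\<^sub>Y z\<^esub> \<phi> z (r j i (\<pi> z))) {..<q}" if "i < p" for i
        proof -
          have cr: "(\<lambda>j. c j \<otimes>\<^bsub>stalk O\<^sub>X (\<pi> z)\<^esub> r j i (\<pi> z)) \<in> {..<q} \<rightarrow> carrier (stalk O\<^sub>X (\<pi> z))"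
            using c r_closed[OF that _ elim(1)] by auto
          have "\<rho> z \<otimes>\<^bsub>stalk O\<^sub>Y z\<^esub> \<alpha> i z = \<phi> z (\<eta> z (\<rho> z \<otimes>\<^bsub>stalk O\<^sub>Y z\<^esub> \<alpha> i z))"
            using \<phi>_\<eta>[OF z \<rho>\<alpha>[OF that]] by simp
          also have "\<dots> = finsum (stalk O\<^sub>Y z) (\<phi> z \<circ> (\<lambda>j. c j \<otimes>\<^bsub>stalk O\<^sub>X (\<pi> z)\<^esub> r j i (\<pi> z))) {..<q}"
            unfolding c_eq[OF that] by (rule hz.hom_finsum[OF cr])
          also have "\<dots> = finsum (stalk O\<^sub>Y z) (\<lambda>j. \<phi> z (c j) \<otimes>\<^bsub>stalk O\<^sub>Y z\<^esub> \<phi> z (r j i (\<pi> z))) {..<q}"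
            using c r_closed[OF that _ elim(1)] \<phi>c \<phi>r[OF that]
            by (intro Z.finsum_cong') (auto simp: Pi_iff)
          finally show ?thesis .
        qed
        \<comment> \<open>The scalar moves into the vector, which then lies in the span of vectors
          killed by \<omega>.\<close>
        have "\<sigma> z = dot (stalk O\<^sub>Y z) p (\<lambda>i. \<omega> i z) (\<lambda>i. \<rho> z \<otimes>\<^bsub>stalk O\<^sub>Y z\<^esub> \<alpha> i z)"
          unfolding \<sigma>_def using elim(2-4) by (intro Z.dot_smult_right[symmetric]) auto
        also have "\<dots> = dot (stalk O\<^sub>Y z) p (\<lambda>i. \<omega> i z)
            (\<lambda>i. finsum (stalk O\<^sub>Y z) (\<lambda>j. \<phi> z (c j) \<otimes>\<^bsub>stalk O\<^sub>Y z\<^esub> \<phi> z (r j i (\<pi> z))) {..<q})"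
          using expand \<rho>\<alpha> elim(3) by (intro V.lincomb_cong) auto
        also have "\<dots> = \<zero>\<^bsub>stalk O\<^sub>Y z\<^esub>"
          using \<phi>c \<phi>r elim(3,6) by (intro Z.dot_span) auto
        finally show "\<sigma> z = \<zero>\<^bsub>stalk O\<^sub>Y z\<^esub>" .
      qed
    qed
    with \<sigma>_near obtain W where W: "openin Y W" "y \<in> W" "\<And>z. z \<in> W \<Longrightarrow> z \<notin> A \<longrightarrow> \<sigma> z = \<zero>\<^bsub>stalk O\<^sub>Y z\<^esub>"
      "\<And>W'. openin Y W' \<Longrightarrow> W' \<subseteq> W \<Longrightarrow> restrict \<sigma> W' \<in> sections O\<^sub>Y W'"
      by (rule Y.section_near_common) blast
    \<comment> \<open>Two sections over \<open>W\<close> with the same restriction off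
      \<open>A\<close>: rarity identifies them, and with them their germs at \<open>y\<close>, which
      may well lie in \<open>A\<close>.\<close>
    have "restrict (restrict \<sigma> W) (W - A) = restrict (\<lambda>z\<in>W. \<zero>\<^bsub>stalk O\<^sub>Y z\<^esub>) (W - A)"
      using W(3) by (auto simp: restrict_def)
    then have "restrict \<sigma> W = (\<lambda>z\<in>W. \<zero>\<^bsub>stalk O\<^sub>Y z\<^esub>)"
      by (rule inj_onD[OF rare[unfolded analytically_rare_def, rule_format, OF W(1)]])
        (rule W(4)[OF W(1) order_refl] Y.zero_section[OF W(1)])+
    then have "\<sigma> y = \<zero>\<^bsub>stalk O\<^sub>Y y\<^esub>" using W(2) by (metis restrict_apply')
    moreover have "\<sigma> y = t \<otimes>\<^bsub>stalk O\<^sub>Y y\<^esub> dot (stalk O\<^sub>Y y) p w a"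
    proof -
      interpret V: Module.module "stalk O\<^sub>Y y" "regular_module (stalk O\<^sub>Y y)" by (rule cring.module_regular_module[OF Y.stalk_cring[OF y]])
      have "dot (stalk O\<^sub>Y y) p (\<lambda>i. \<omega> i y) (\<lambda>i. \<alpha> i y) = dot (stalk O\<^sub>Y y) p w a"
        using \<omega>(1) \<alpha>(1) w a by (intro V.lincomb_cong) auto
      then show ?thesis by (simp add: \<sigma>_def \<rho>(1))
    qed
    moreover have "dot (stalk O\<^sub>Y y) p w a \<in> carrier (stalk O\<^sub>Y y)" using w a by (intro cring.dot_closed[OF Y.stalk_cring[OF y]]) auto
    \<comment> \<open>As t is a non-zero-divisor, w(a) would have to be zero.\<close>
    ultimately have False using t_reg w_a by auto
    then show ?thesis ..
  qed
qed

end

section \<open>Torsion-free preimages\<close>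

locale modification_morphism = modification X O\<^sub>X Y O\<^sub>Y \<pi> \<phi> A \<eta> + F: module_sheaf X O\<^sub>X F + G: module_sheaf X O\<^sub>X G
  for X :: "'x topology" and O\<^sub>X :: "('x, complex, 'a) sheaf_data"
    and Y :: "'y topology" and O\<^sub>Y :: "('y, complex, 'b) sheaf_data"
    and \<pi> \<phi> A \<eta> and F :: "('x, 'a, 'm) sheaf_data" and G :: "('x, 'a, 'n) sheaf_data" +
  fixes \<psi> :: "'x \<Rightarrow> 'm \<Rightarrow> 'n"
  assumes morphism: "sheaf_morphism X O\<^sub>X F G \<psi>"
begin

abbreviation "F' \<equiv> inverse_image Y O\<^sub>Y X O\<^sub>X \<pi> \<phi> F"
abbreviation "G' \<equiv> inverse_image Y O\<^sub>Y X O\<^sub>X \<pi> \<phi> G"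
abbreviation "\<psi>' \<equiv> inverse_image_map O\<^sub>Y O\<^sub>X \<pi> \<phi> G \<psi>"
abbreviation "tfF \<equiv> torsion_free_preimage Y O\<^sub>Y X O\<^sub>X \<pi> \<phi> F"
abbreviation "tfG \<equiv> torsion_free_preimage Y O\<^sub>Y X O\<^sub>X \<pi> \<phi> G"
abbreviation "tf\<psi> \<equiv> torsion_free_preimage_map Y O\<^sub>Y X O\<^sub>X \<pi> \<phi> G \<psi>"

lemma base_change_map_stalk:
  assumes y: "y \<in> topspace Y"
  shows "base_change_map (stalk O\<^sub>X (\<pi> y)) (\<phi> y) (stalk O\<^sub>Y y) (stalk F (\<pi> y)) (stalk G (\<pi> y)) (\<psi> (\<pi> y))"
  using morphism \<pi>_topspace[OF y]
  by (intro base_change_map.intro linear_map_modules.intro linear_map_modules_axioms.intro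
      base_change_stalk[OF F.module_sheaf_axioms y] base_change_stalk[OF G.module_sheaf_axioms y]
      F.stalk_module G.stalk_module) (auto simp: sheaf_morphism_def)

lemma stalk_inverse_image:
  "stalk (inverse_image Y O\<^sub>Y X O\<^sub>X \<pi> \<phi> H) y =
    tensor_product (stalk O\<^sub>X (\<pi> y)) (\<phi> y) (stalk O\<^sub>Y y) (stalk H (\<pi> y))"
  by (simp add: inverse_image_def)

lemma \<psi>'_eq: "\<psi>' y = tensor_map (stalk O\<^sub>X (\<pi> y)) (\<phi> y) (stalk O\<^sub>Y y) (stalk G (\<pi> y)) (\<psi> (\<pi> y))"
  by (simp add: inverse_image_map_def)

lemma quotient_linear_map_stalk:
  assumes y: "y \<in> topspace Y"
  shows "quotient_linear_map (stalk O\<^sub>Y y) (stalk F' y) (torsion (stalk O\<^sub>Y y) (stalk F' y))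
    (stalk G' y) (torsion (stalk O\<^sub>Y y) (stalk G' y)) (\<psi>' y)"
proof -
  interpret L: base_change_map "stalk O\<^sub>X (\<pi> y)" "\<phi> y" "stalk O\<^sub>Y y" "stalk F (\<pi> y)" "stalk G (\<pi> y)" "\<psi> (\<pi> y)"
    by (rule base_change_map_stalk[OF y])
  interpret T: linear_map_modules "stalk O\<^sub>Y y" "stalk F' y" "stalk G' y" "\<psi>' y"
    unfolding stalk_inverse_image \<psi>'_eq
    by (intro linear_map_modules.intro linear_map_modules_axioms.intro L.M.module_P L.N.module_P L.linear_tensor_map)
  show ?thesis
    by (intro quotient_linear_map.intro quotient_linear_map_axioms.intro quotient_by_submodule.intro
        quotient_by_submodule_axioms.intro T.linear_map_modules_axioms T.M.module_axioms T.N.module_axioms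
        T.M.torsion_submodule T.N.torsion_submodule T.torsion_image)
qed

lemma stalk_torsion_free_preimage:
  "stalk (torsion_free_preimage Y O\<^sub>Y X O\<^sub>X \<pi> \<phi> H) y =
    quotient_module (stalk (inverse_image Y O\<^sub>Y X O\<^sub>X \<pi> \<phi> H) y)
      (torsion (stalk O\<^sub>Y y) (stalk (inverse_image Y O\<^sub>Y X O\<^sub>X \<pi> \<phi> H) y))"
  by (simp add: torsion_free_preimage_def Let_def quotient_sheaf_def torsion_sheaf_def)

lemma tf\<psi>_eq: "tf\<psi> y = (\<lambda>C. \<Union>c\<in>C. a_r_coset (stalk G' y) (torsion (stalk O\<^sub>Y y) (stalk G' y)) (\<psi>' y c))"
  by (simp add: torsion_free_preimage_map_def Let_def induced_quotient_map_def torsion_sheaf_def)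

text \<open>Membership in the stalk allows the induced map to be evaluated on the coset of
  \<open>t z\<close>. It comes from the local form of a section as a finite sum of elementary
  tensors.\<close>

lemma inverse_image_section_closed:
  assumes "openin Y U" "t \<in> sections F' U" "z \<in> U"
  shows "t z \<in> carrier (stalk F' z)"
proof -
  have z: "z \<in> topspace Y" using assms openin_subset by blast
  interpret T: base_change "stalk O\<^sub>X (\<pi> z)" "\<phi> z" "stalk O\<^sub>Y z" "stalk F (\<pi> z)"
    by (rule base_change_stalk[OF F.module_sheaf_axioms z])
  from assms obtain V W a t' and k :: nat where V: "openin Y V" "z \<in> V" "openin X W" "\<pi> ` V \<subseteq> W"
    and at: "\<forall>i<k. a i \<in> sections O\<^sub>Y V \<and> t' i \<in> sections F W"
    and tz: "\<forall>z\<in>V. t z = tensor_class (stalk O\<^sub>X (\<pi> z)) (\<phi> z) (stalk O\<^sub>Y z) (stalk F (\<pi> z))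
      (\<Sum>i<k. frag_of (a i z, t' i (\<pi> z)))"
    by (auto simp: inverse_image_def)
  have "a i z \<in> carrier (stalk O\<^sub>Y z)" "t' i (\<pi> z) \<in> carrier (stalk F (\<pi> z))" if "i < k" for i
  proof -
    have "\<pi> z \<in> W" using V(2,4) by blast
    moreover have "a i \<in> (\<Pi>\<^sub>E x\<in>V. carrier (stalk O\<^sub>Y x))" "t' i \<in> (\<Pi>\<^sub>E x\<in>W. carrier (stalk F x))"
      using Y.sections_subset[OF V(1)] F.sections_subset[OF V(3)] at that by blast+
    ultimately show "a i z \<in> carrier (stalk O\<^sub>Y z)" "t' i (\<pi> z) \<in> carrier (stalk F (\<pi> z))"
      using V(2) by (auto dest: PiE_mem)
  qed
  then show ?thesis
    using tz V(2) by (auto simp: stalk_inverse_image intro!: T.cls_closed T.frags_sum)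
qed

text \<open>Locally the map changes a_i \<otimes> t_i into a_i \<otimes> \<psi>(t_i), over the same
  open sets and with the same a_i, and \<psi> takes the t_i to sections of \<open>G\<close>.\<close>

lemma inverse_image_map_section:
  assumes U: "openin Y U" and t: "t \<in> sections F' U"
  shows "(\<lambda>z\<in>U. \<psi>' z (t z)) \<in> sections G' U"
proof -
  have "\<exists>V W (k::nat) a t'. openin Y V \<and> y \<in> V \<and> V \<subseteq> U \<and> openin X W \<and> \<pi> ` V \<subseteq> W \<and>
      (\<forall>i<k. a i \<in> sections O\<^sub>Y V \<and> t' i \<in> sections G W) \<and>
      (\<forall>z\<in>V. (\<lambda>z\<in>U. \<psi>' z (t z)) z = tensor_class (stalk O\<^sub>X (\<pi> z)) (\<phi> z) (stalk O\<^sub>Y z) (stalk G (\<pi> z))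
        (\<Sum>i<k. frag_of (a i z, t' i (\<pi> z))))" if "y \<in> U" for y
  proof -
    from t that obtain V W a t' and k :: nat where V: "openin Y V" "y \<in> V" "V \<subseteq> U" "openin X W" "\<pi> ` V \<subseteq> W"
      and at: "\<forall>i<k. a i \<in> sections O\<^sub>Y V \<and> t' i \<in> sections F W"
      and tz: "\<forall>z\<in>V. t z = tensor_class (stalk O\<^sub>X (\<pi> z)) (\<phi> z) (stalk O\<^sub>Y z) (stalk F (\<pi> z))
        (\<Sum>i<k. frag_of (a i z, t' i (\<pi> z)))"
      by (auto simp: inverse_image_def)
    have "(\<lambda>z\<in>U. \<psi>' z (t z)) z = tensor_class (stalk O\<^sub>X (\<pi> z)) (\<phi> z) (stalk O\<^sub>Y z) (stalk G (\<pi> z))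
        (\<Sum>i<k. frag_of (a i z, (\<lambda>x\<in>W. \<psi> x (t' i x)) (\<pi> z)))" if z: "z \<in> V" for z
    proof -
      have "z \<in> topspace Y" using z V(1) openin_subset by blast
      then interpret L: base_change_map "stalk O\<^sub>X (\<pi> z)" "\<phi> z" "stalk O\<^sub>Y z" "stalk F (\<pi> z)" "stalk G (\<pi> z)" "\<psi> (\<pi> z)"
        by (rule base_change_map_stalk)
      have "\<pi> z \<in> W" "z \<in> U" using z V by auto
      then show ?thesis
        using tz z by (simp add: \<psi>'_eq L.tensor_map_cls frag_extend_sum o_def)
    qed
    moreover have "\<forall>i<k. a i \<in> sections O\<^sub>Y V \<and> (\<lambda>x\<in>W. \<psi> x (t' i x)) \<in> sections G W"
      using at morphism V(4) by (auto simp: sheaf_morphism_def)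
    ultimately show ?thesis
      by (intro exI[of _ V] exI[of _ W] exI[of _ k] exI[of _ a] exI[of _ "\<lambda>i. \<lambda>x\<in>W. \<psi> x (t' i x)"]
          conjI V ballI)
  qed
  then show ?thesis by (simp add: inverse_image_def)
qed

text \<open>A section of the quotient lifts locally to the inverse image of \<open>F\<close>;
  applying \<open>\<psi>'\<close> to the lift gives a local lift of the image.\<close>

lemma torsion_free_preimage_morphism: "sheaf_morphism Y O\<^sub>Y tfF tfG tf\<psi>"
  unfolding sheaf_morphism_def
proof (intro conjI ballI allI impI)
  fix y assume "y \<in> topspace Y"
  then interpret quotient_linear_map "stalk O\<^sub>Y y" "stalk F' y" "torsion (stalk O\<^sub>Y y) (stalk F' y)"
    "stalk G' y" "torsion (stalk O\<^sub>Y y) (stalk G' y)" "\<psi>' y"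
    by (rule quotient_linear_map_stalk)
  show "linear_map (stalk O\<^sub>Y y) (stalk tfF y) (stalk tfG y) (tf\<psi> y)"
    unfolding stalk_torsion_free_preimage tf\<psi>_eq by (rule induced_linear)
next
  fix U s assume U: "openin Y U" and s: "s \<in> sections tfF U"
  have "\<exists>V t. openin Y V \<and> y \<in> V \<and> V \<subseteq> U \<and> t \<in> sections G' V \<and>
      (\<forall>z\<in>V. (\<lambda>y\<in>U. tf\<psi> y (s y)) z = a_r_coset (stalk G' z) (torsion (stalk O\<^sub>Y z) (stalk G' z)) (t z))"
    if "y \<in> U" for y
  proof -
    from s that obtain V t where V: "openin Y V" "y \<in> V" "V \<subseteq> U" and t: "t \<in> sections F' V"
      and st: "\<forall>z\<in>V. s z = a_r_coset (stalk F' z) (torsion (stalk O\<^sub>Y z) (stalk F' z)) (t z)"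
      by (auto simp: torsion_free_preimage_def Let_def quotient_sheaf_def torsion_sheaf_def)
    have "(\<lambda>y\<in>U. tf\<psi> y (s y)) z = a_r_coset (stalk G' z) (torsion (stalk O\<^sub>Y z) (stalk G' z)) ((\<lambda>z\<in>V. \<psi>' z (t z)) z)"
      if z: "z \<in> V" for z
    proof -
      have "z \<in> topspace Y" using z V(1) openin_subset by blast
      then interpret quotient_linear_map "stalk O\<^sub>Y z" "stalk F' z" "torsion (stalk O\<^sub>Y z) (stalk F' z)"
        "stalk G' z" "torsion (stalk O\<^sub>Y z) (stalk G' z)" "\<psi>' z"
        by (rule quotient_linear_map_stalk)
      show ?thesis
        using z V(3) st Union_coset[OF inverse_image_section_closed[OF V(1) t z]] by (auto simp: tf\<psi>_eq)
    qed
    with V inverse_image_map_section[OF V(1) t] show ?thesis by blast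
  qed
  then show "(\<lambda>y\<in>U. tf\<psi> y (s y)) \<in> sections tfG U"
    by (simp add: torsion_free_preimage_def Let_def quotient_sheaf_def torsion_sheaf_def)
qed

lemma torsion_free_preimage_epimorphism:
  assumes "sheaf_epimorphism X O\<^sub>X F G \<psi>"
  shows "sheaf_epimorphism Y O\<^sub>Y tfF tfG tf\<psi>"
  unfolding sheaf_epimorphism_def
proof (intro conjI ballI torsion_free_preimage_morphism)
  fix y assume y: "y \<in> topspace Y"
  interpret L: base_change_map "stalk O\<^sub>X (\<pi> y)" "\<phi> y" "stalk O\<^sub>Y y" "stalk F (\<pi> y)" "stalk G (\<pi> y)" "\<psi> (\<pi> y)"
    by (rule base_change_map_stalk[OF y])
  interpret quotient_linear_map "stalk O\<^sub>Y y" "stalk F' y" "torsion (stalk O\<^sub>Y y) (stalk F' y)"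
    "stalk G' y" "torsion (stalk O\<^sub>Y y) (stalk G' y)" "\<psi>' y"
    by (rule quotient_linear_map_stalk[OF y])
  have "\<psi>' y ` carrier (stalk F' y) = carrier (stalk G' y)"
    unfolding \<psi>'_eq stalk_inverse_image using assms \<pi>_topspace[OF y]
    by (intro L.surj_tensor_map) (simp add: sheaf_epimorphism_def)
  then show "tf\<psi> y ` carrier (stalk tfF y) = carrier (stalk tfG y)"
    unfolding stalk_torsion_free_preimage tf\<psi>_eq by (rule induced_surj)
qed

lemma torsion_free_preimage_monomorphism:
  assumes "coherent_sheaf X O\<^sub>X F" "sheaf_monomorphism X O\<^sub>X F G \<psi>"
  shows "sheaf_monomorphism Y O\<^sub>Y tfF tfG tf\<psi>"
  unfolding sheaf_monomorphism_def
proof (intro conjI ballI torsion_free_preimage_morphism)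
  fix y assume y: "y \<in> topspace Y"
  interpret quotient_linear_map "stalk O\<^sub>Y y" "stalk F' y" "torsion (stalk O\<^sub>Y y) (stalk F' y)"
    "stalk G' y" "torsion (stalk O\<^sub>Y y) (stalk G' y)" "\<psi>' y"
    by (rule quotient_linear_map_stalk[OF y])
  have "u \<in> torsion (stalk O\<^sub>Y y) (stalk F' y)"
    if "u \<in> carrier (stalk F' y)" "\<psi>' y u \<in> torsion (stalk O\<^sub>Y y) (stalk G' y)" for u
    using torsion_reflected[OF assms(1) G.module_sheaf_axioms assms(2) y] that
    unfolding stalk_inverse_image \<psi>'_eq by blast
  then show "inj_on (tf\<psi> y) (carrier (stalk tfF y))"
    unfolding stalk_torsion_free_preimage tf\<psi>_eq by (rule induced_inj)
qed

end

lemma proper_modification_modification: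
  assumes "proper_modification Y O\<^sub>Y X O\<^sub>X \<pi> \<phi>" "locally_irreducible Y O\<^sub>Y"
  obtains A \<eta> where "modification X O\<^sub>X Y O\<^sub>Y \<pi> \<phi> A \<eta>"
proof -
  from assms obtain A B where rare: "analytically_rare Y O\<^sub>Y A"
    and bihol: "biholomorphic_map (subtopology Y (topspace Y - A)) O\<^sub>Y (subtopology X (topspace X - B)) O\<^sub>X \<pi> \<phi>"
    and spaces: "ringed_space X O\<^sub>X" "ringed_space Y O\<^sub>Y" and holo: "holomorphic_map Y O\<^sub>Y X O\<^sub>X \<pi> \<phi>"
    by (auto simp: proper_modification_def complex_space_def)
  from bihol obtain g \<eta> where \<pi>: "holomorphic_map (subtopology Y (topspace Y - A)) O\<^sub>Y (subtopology X (topspace X - B)) O\<^sub>X \<pi> \<phi>"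
    and g: "holomorphic_map (subtopology X (topspace X - B)) O\<^sub>X (subtopology Y (topspace Y - A)) O\<^sub>Y g \<eta>"
    and g\<pi>: "\<And>y. y \<in> topspace Y - A \<Longrightarrow> g (\<pi> y) = y \<and> (\<forall>b\<in>carrier (stalk O\<^sub>Y y). \<phi> y (\<eta> (\<pi> y) b) = b)"
    and \<pi>g: "\<And>x. x \<in> topspace X - B \<Longrightarrow> \<pi> (g x) = x \<and> (\<forall>a\<in>carrier (stalk O\<^sub>X x). \<eta> x (\<phi> (g x) a) = a)"
    by (auto simp: biholomorphic_map_def)
  \<comment> \<open>Continuity into the subtopology is what places \<open>\<pi> z\<close> outside
    \<open>B\<close>.\<close>
  have \<pi>z: "\<pi> z \<in> topspace X - B" if "z \<in> topspace Y - A" for z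
  proof -
    have "continuous_map (subtopology Y (topspace Y - A)) (subtopology X (topspace X - B)) \<pi>"
      using \<pi> unfolding holomorphic_map_def by blast
    from continuous_map_funspace[OF this] show ?thesis using that by auto
  qed
  have "modification X O\<^sub>X Y O\<^sub>Y \<pi> \<phi> A (\<lambda>z. \<eta> (\<pi> z))"
  proof (intro modification.intro modification_axioms.intro spaces holo assms(2) rare)
    fix z assume z: "z \<in> topspace Y - A"
    \<comment> \<open>At \<open>\<pi> z\<close> the comorphism of \<open>g\<close> starts from the
      stalk at \<open>g (\<pi> z)\<close>, which is the stalk at \<open>z\<close>.\<close>
    have "\<eta> (\<pi> z) \<in> ring_hom (stalk O\<^sub>Y (g (\<pi> z))) (stalk O\<^sub>X (\<pi> z))"
      using g \<pi>z[OF z] by (auto simp: holomorphic_map_def)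
    then show "\<eta> (\<pi> z) \<in> ring_hom (stalk O\<^sub>Y z) (stalk O\<^sub>X (\<pi> z))"
      using g\<pi>[OF z] by simp
    show "\<phi> z (\<eta> (\<pi> z) b) = b" if "b \<in> carrier (stalk O\<^sub>Y z)" for b
      using g\<pi>[OF z] that by blast
    show "\<eta> (\<pi> z) (\<phi> z a) = a" if "a \<in> carrier (stalk O\<^sub>X (\<pi> z))" for a
      using \<pi>g[OF \<pi>z[OF z]] g\<pi>[OF z] that by auto
  qed
  then show thesis by (rule that)
qed

theorem lemma6p1:
  fixes X :: "'x topology" and O\<^sub>X :: "('x, complex, 'a) sheaf_data"
    and Y :: "'y topology" and O\<^sub>Y :: "('y, complex, 'b) sheaf_data"
    and \<pi> :: "'y \<Rightarrow> 'x" and \<phi> :: "'y \<Rightarrow> 'a \<Rightarrow> 'b"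
    and F :: "('x, 'a, 'm) sheaf_data" and G :: "('x, 'a, 'n) sheaf_data"
    and \<psi> :: "'x \<Rightarrow> 'm \<Rightarrow> 'n"
  assumes "complex_space X O\<^sub>X" and "complex_space Y O\<^sub>Y"
    and "proper_modification Y O\<^sub>Y X O\<^sub>X \<pi> \<phi>"
    and "locally_irreducible Y O\<^sub>Y"
    and "coherent_sheaf X O\<^sub>X F" and "coherent_sheaf X O\<^sub>X G"
    and "sheaf_morphism X O\<^sub>X F G \<psi>"
  shows "(sheaf_epimorphism X O\<^sub>X F G \<psi> \<longrightarrow>
            sheaf_epimorphism Y O\<^sub>Y
              (torsion_free_preimage Y O\<^sub>Y X O\<^sub>X \<pi> \<phi> F) (torsion_free_preimage Y O\<^sub>Y X O\<^sub>X \<pi> \<phi> G)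
              (torsion_free_preimage_map Y O\<^sub>Y X O\<^sub>X \<pi> \<phi> G \<psi>)) \<and>
         (sheaf_monomorphism X O\<^sub>X F G \<psi> \<longrightarrow>
            sheaf_monomorphism Y O\<^sub>Y
              (torsion_free_preimage Y O\<^sub>Y X O\<^sub>X \<pi> \<phi> F) (torsion_free_preimage Y O\<^sub>Y X O\<^sub>X \<pi> \<phi> G)
              (torsion_free_preimage_map Y O\<^sub>Y X O\<^sub>X \<pi> \<phi> G \<psi>))"
proof -
  obtain A \<eta> where "modification X O\<^sub>X Y O\<^sub>Y \<pi> \<phi> A \<eta>"
    using assms(3,4) by (rule proper_modification_modification)
  then interpret modification_morphism X O\<^sub>X Y O\<^sub>Y \<pi> \<phi> A \<eta> F G \<psi>
    using assms(5-7)
    by (intro modification_morphism.intro modification_morphism_axioms.intro) (auto simp: coherent_sheaf_def)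
  show ?thesis
    using torsion_free_preimage_epimorphism torsion_free_preimage_monomorphism[OF assms(5)] by blast
qed

end
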